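(* Let $d=2$. The modified scaled bilinear form $a_h^{\mathrm{mod}}$ is uniformly positive definite on $(V_h\cap V_0)\times(V_h\cap V_0)$ for all simplicial hierarchical meshes: for every macro triangulation $\mathcal{T}_H$ of $\Omega$ there is a constant $c>0$, independent of $h$, such that for every uniformly refined mesh $\mathcal{T}_h$, $h\in\{H/2,H/4,\dots\}$, $$a_h^{\mathrm{mod}}(v_h,v_h)\ge c\,\|v_h\|_{H^1(\Omega)}^2\qquad\text{for all } v_h\in V_h\cap V_0 .$$
   Context: Setting. $\Omega\subset\mathbb{R}^2$ is a bounded polygonal domain, $V_0=H_0^1(\Omega)$. $\mathcal{T}_H$ ($H>0$ fixed) is a (possibly unstructured) conforming triangulation of $\Omega$, the macro triangulation, with elements $T$. The meshes $\mathcal{T}_h$, $h\in\{H/2,H/4,\dots\}$, are obtained by successive uniform refinement, each triangle being decomposed into four congruent triangles by joining its edge midpoints. $V_h\subset H^1(\Omega)$ is the space of continuous piecewise linear functions on $\mathcal{T}_h$ (no boundary conditions imposed), with nodal basis functions $\phi_i$ associated with the nodes $x_i$. The coefficient $k$ is scalar and uniformly positive on $\Omega$, with $k|_T\in W^{2,\infty}(T)$ for each $T\in\mathcal{T}_H$ (jumps across macro-element boundaries allowed; $k|_T$ is extended continuously to $\overline T$). Unmodified form. For $v_h=\sum_i\nu_i\phi_i$, $w_h=\sum_j\chi_j\phi_j$ in $V_h$, $$a_h(v_h,w_h)=\frac12\sum_{T\in\mathcal{T}_H}\sum_{i\ne j}k_{ij}^T(\nu_i-\nu_j)(\chi_j-\chi_i)\int_T\nabla\phi_i\cdot\nabla\phi_j\,dx,\qquad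 k_{ij}^T=\tfrac12\big(k|_T(x_i)+k|_T(x_j)\big).$$ Only pairs $i,j$ whose nodes are the endpoints of an edge $e\subset\overline T$ of $\mathcal{T}_h$ contribute; for such an edge write $k_e=k_{ij}^T$. Modification. For each macro element $T$ let $\hat A_T=(a_{i,j}^T)_{i,j=1}^3$ be the local stiffness matrix of the Laplacian, $a_{i,j}^T=\int_T\nabla\lambda_i\cdot\nabla\lambda_j\,dx$ with $\lambda_i$ the linear nodal basis functions of $T$, where the local enumeration is such that the largest interior angle of $T$ is located at local node $3$. Thus if $T$ has an obtuse angle, then $a_{1,2}^T>0$, $a_{1,3}^T<0$, $a_{2,3}^T<0$, and otherwise all off-diagonal entries are $\le0$. Let $\lambda_{\min}^T>0$ be the smallest nonzero (non-degenerate) eigenvalue of the generalized eigenvalue problem $$\hat A_T\mathbf x=\lambda\begin{pmatrix}2&-1&-1\\-1&2&-1\\-1&-1&2\end{pmatrix}\mathbf x,\qquad \mathbf x\in\mathbb{R}^3$$ (both matrices are symmetric positive semi-definite with the same one-dimensional kernel). If $T$ has an obtuse angle, the edges $e\subset\overline T$ of $\mathcal{T}_h$ associated with a positive reference (Laplacian) stencil entry, i.e. those parallel to the edge of $T$ joining local nodes $1$ and $2$, are called of gray type in $T$; if $T$ has no obtuse angle there are no gray type edges in $T$. For a gray type edge $e$ in $T$ let $\omega_{e;T}$ be the patch of all elements $t\in\mathcal{T}_h$ with $t\subset T$ and $e\subset\partial t$, let $\mathcal{E}_h^e$ be the set of all edges of $\mathcal{T}_h$ contained in $\overline\omega_{e;T}$,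 and put $$k_{e;\min}=\min_{\tilde e\in\mathcal{E}_h^e}k_{\tilde e},\qquad k_{\tilde e}=\tfrac12\big(k|_T(x_1^{\tilde e})+k|_T(x_2^{\tilde e})\big),$$ where $x_1^{\tilde e},x_2^{\tilde e}$ are the endpoints of $\tilde e$. The form $a_h^{\mathrm{mod}}$ is obtained from $a_h$ by the following replacement, carried out for every $T$ and every gray type edge $e$ in $T$ (in the contribution of $T$ only): if $$(k_e-k_{e;\min})\,a_{1,2}^T>k_{e;\min}\,\lambda_{\min}^T,$$ then the scaling factor $k_e$ is replaced by $$k_e^{\mathrm{mod}}=k_{e;\min}\Big(1+\frac{\lambda_{\min}^T}{a_{1,2}^T}\Big);$$ otherwise $k_e$ is left unchanged. *)

theory Defs
  imports "HOL-Analysis.Analysis"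
begin

section \<open>Sobolev spaces\<close>

definition grad :: "('a::real_inner \<Rightarrow> real) \<Rightarrow> 'a \<Rightarrow> 'a" where
  "grad f x = (SOME D. GDERIV f x :> D)"

fun C_k :: "nat \<Rightarrow> ('a::euclidean_space \<Rightarrow> real) \<Rightarrow> bool" where
  "C_k 0 f \<longleftrightarrow> continuous_on UNIV f"
| "C_k (Suc n) f \<longleftrightarrow>
     (\<forall>x. f differentiable (at x)) \<and> (\<forall>b\<in>Basis. C_k n (\<lambda>x. grad f x \<bullet> b))"

definition test_functions :: "'a::euclidean_space set \<Rightarrow> ('a \<Rightarrow> real) set" where
  "test_functions U =
     {\<phi>. (\<forall>n. C_k n \<phi>) \<and> compact (closure {x. \<phi> x \<noteq> 0}) \<and> closure {x. \<phi> x \<noteq> 0} \<subseteq> U}"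

definition locally_integrable ::
    "'a::euclidean_space set \<Rightarrow> ('a \<Rightarrow> 'b::euclidean_space) \<Rightarrow> bool" where
  "locally_integrable U f \<longleftrightarrow> (\<forall>K. compact K \<and> K \<subseteq> U \<longrightarrow> integrable (lebesgue_on K) f)"

definition is_weak_grad ::
    "'a::euclidean_space set \<Rightarrow> ('a \<Rightarrow> real) \<Rightarrow> ('a \<Rightarrow> 'a) \<Rightarrow> bool" where
  "is_weak_grad U v g \<longleftrightarrow>
     locally_integrable U v \<and> locally_integrable U g \<and>
     (\<forall>\<phi>\<in>test_functions U.
        (LINT x|lebesgue_on U. v x *\<^sub>R grad \<phi> x) = - (LINT x|lebesgue_on U. \<phi> x *\<^sub>R g x))"

definition L2 :: "'a::euclidean_space set \<Rightarrow> ('a \<Rightarrow> 'b::euclidean_space) \<Rightarrow> bool" where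
  "L2 U f \<longleftrightarrow> f \<in> borel_measurable (lebesgue_on U) \<and>
     integrable (lebesgue_on U) (\<lambda>x. (norm (f x))\<^sup>2)"

definition L_infty :: "'a::euclidean_space set \<Rightarrow> ('a \<Rightarrow> 'b::euclidean_space) \<Rightarrow> bool" where
  "L_infty U f \<longleftrightarrow> f \<in> borel_measurable (lebesgue_on U) \<and>
     (\<exists>C. AE x in lebesgue_on U. norm (f x) \<le> C)"

definition W2_infty :: "'a::euclidean_space set \<Rightarrow> ('a \<Rightarrow> real) \<Rightarrow> bool" where
  "W2_infty U f \<longleftrightarrow> L_infty U f \<and>
     (\<exists>g. is_weak_grad U f g \<and> L_infty U g \<and>
        (\<forall>b\<in>Basis. \<exists>h. is_weak_grad U (\<lambda>x. g x \<bullet> b) h \<and> L_infty U h))"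

definition H1 :: "'a::euclidean_space set \<Rightarrow> ('a \<Rightarrow> real) set" where
  "H1 U = {v. L2 U v \<and> (\<exists>g. is_weak_grad U v g \<and> L2 U g)}"

text \<open>The weak gradient is unique only up to null sets; \<open>weak_grad\<close> picks a representative.\<close>

definition weak_grad :: "'a::euclidean_space set \<Rightarrow> ('a \<Rightarrow> real) \<Rightarrow> 'a \<Rightarrow> 'a" where
  "weak_grad U v = (SOME g. is_weak_grad U v g)"

definition H1_norm :: "'a::euclidean_space set \<Rightarrow> ('a \<Rightarrow> real) \<Rightarrow> real" where
  "H1_norm U v =
     sqrt ((LINT x|lebesgue_on U. (v x)\<^sup>2) + (LINT x|lebesgue_on U. (norm (weak_grad U v x))\<^sup>2))"

definition H1_0 :: "'a::euclidean_space set \<Rightarrow> ('a \<Rightarrow> real) set" where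
  "H1_0 U = {v \<in> H1 U. \<exists>\<phi>::nat \<Rightarrow> 'a \<Rightarrow> real.
     (\<forall>m. \<phi> m \<in> test_functions U) \<and> (\<lambda>m. H1_norm U (\<lambda>x. v x - \<phi> m x)) \<longlonglongrightarrow> 0}"


section \<open>Triangulations and piecewise linear functions\<close>

type_synonym pt = "real^2"
type_synonym mesh = "pt set set"

text \<open>The boundary is polygonal but need not be Lipschitz.\<close>

definition polygonal_domain :: "pt set \<Rightarrow> bool" where
  "polygonal_domain \<Omega> \<longleftrightarrow> open \<Omega> \<and> connected \<Omega> \<and> bounded \<Omega> \<and> \<Omega> \<noteq> {} \<and>
     (\<exists>S. finite S \<and> frontier \<Omega> = (\<Union>(a, b)\<in>S. closed_segment a b))"

text \<open>Elements are closed triangles. Conformity is part of \<^const>\<open>triangulation\<close>: two elements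
  meet in a common (possibly empty) face.\<close>

definition triangulation_of :: "pt set \<Rightarrow> mesh \<Rightarrow> bool" where
  "triangulation_of \<Omega> M \<longleftrightarrow> triangulation M \<and> (\<forall>T\<in>M. 2 simplex T \<and> interior T \<subseteq> \<Omega>) \<and>
     \<Union>M = closure \<Omega>"

definition vertices :: "pt set \<Rightarrow> pt set" where
  "vertices T = {x. x extreme_point_of T}"

text \<open>The three corner triangles are the images of the vertex set under \<open>midpoint a\<close> for a
  vertex \<open>a\<close>; the fourth triangle is spanned by the edge midpoints.\<close>

definition refine_triangle :: "pt set \<Rightarrow> mesh" where
  "refine_triangle T =
     insert (convex hull {midpoint a b |a b. a \<in> vertices T \<and> b \<in> vertices T \<and> a \<noteq> b})
       ((\<lambda>a. convex hull (midpoint a ` vertices T)) ` vertices T)"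

definition refine :: "mesh \<Rightarrow> mesh" where
  "refine M = (\<Union>T\<in>M. refine_triangle T)"

text \<open>\<open>refined_mesh M n\<close> is the mesh of width \<open>h = H / 2 ^ n\<close>.\<close>

definition refined_mesh :: "mesh \<Rightarrow> nat \<Rightarrow> mesh" where
  "refined_mesh M n = (refine ^^ n) M"

definition nodes :: "mesh \<Rightarrow> pt set" where
  "nodes M = (\<Union>t\<in>M. vertices t)"

definition mesh_edges :: "mesh \<Rightarrow> pt set set" where
  "mesh_edges M = {e. \<exists>t\<in>M. e edge_of t}"

text \<open>Functions are total, so values outside \<open>\<Union>M\<close> are unconstrained.\<close>

definition P1_space :: "mesh \<Rightarrow> (pt \<Rightarrow> real) set" where
  "P1_space M = {v. continuous_on (\<Union>M) v \<and> (\<forall>t\<in>M. \<exists>g c. \<forall>x\<in>t. v x = g \<bullet> x + c)}"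

definition nodal_basis :: "mesh \<Rightarrow> pt \<Rightarrow> pt \<Rightarrow> real" where
  "nodal_basis M x =
     (SOME \<phi>. \<phi> \<in> P1_space M \<and> \<phi> x = 1 \<and> (\<forall>y\<in>nodes M - {x}. \<phi> y = 0))"

text \<open>For piecewise linear functions \<^const>\<open>grad\<close> is meaningful off the element boundaries,
  which form a null set.\<close>

definition grad_product :: "pt set \<Rightarrow> (pt \<Rightarrow> real) \<Rightarrow> (pt \<Rightarrow> real) \<Rightarrow> real" where
  "grad_product T u v = (LINT x|lebesgue_on T. grad u x \<bullet> grad v x)"


section \<open>The scaled form\<close>

text \<open>In the rest of the theory \<open>M\<close> is the macro mesh, \<open>N\<close> a refinement of it, and \<open>k T\<close>
  the continuous extension of the coefficient from the interior of the macro element \<open>T\<close> to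
  \<open>T\<close>. The coefficients of \<open>v\<close> and \<open>w\<close> in the nodal basis are their nodal values. If \<open>x\<close> or
  \<open>y\<close> is not in \<open>T\<close>, then the gradient integral vanishes, so the scaling factor is irrelevant.\<close>

definition scaled_form ::
    "(pt set \<Rightarrow> pt \<Rightarrow> pt \<Rightarrow> real) \<Rightarrow> mesh \<Rightarrow> mesh \<Rightarrow> (pt \<Rightarrow> real) \<Rightarrow> (pt \<Rightarrow> real) \<Rightarrow> real" where
  "scaled_form \<kappa> M N v w =
     1/2 * (\<Sum>T\<in>M. \<Sum>x\<in>nodes N. \<Sum>y\<in>nodes N - {x}.
       \<kappa> T x y * (v x - v y) * (w y - w x) * grad_product T (nodal_basis N x) (nodal_basis N y))"

definition k_edge :: "(pt set \<Rightarrow> pt \<Rightarrow> real) \<Rightarrow> pt set \<Rightarrow> pt \<Rightarrow> pt \<Rightarrow> real" where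
  "k_edge k T x y = (k T x + k T y) / 2"

definition a_h :: "(pt set \<Rightarrow> pt \<Rightarrow> real) \<Rightarrow> mesh \<Rightarrow> mesh \<Rightarrow> (pt \<Rightarrow> real) \<Rightarrow> (pt \<Rightarrow> real) \<Rightarrow> real" where
  "a_h k = scaled_form (k_edge k)"


section \<open>The modification\<close>

definition vector_angle :: "'a::real_inner \<Rightarrow> 'a \<Rightarrow> real" where
  "vector_angle u v = arccos (u \<bullet> v / (norm u * norm v))"

text \<open>The index arithmetic is modulo 3: \<open>p (i + 1)\<close> and \<open>p (i + 2)\<close> are the other two vertices.\<close>

definition interior_angle :: "(3 \<Rightarrow> pt) \<Rightarrow> 3 \<Rightarrow> real" where
  "interior_angle p i = vector_angle (p (i + 1) - p i) (p (i + 2) - p i)"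

text \<open>The choice below is not unique, but the modified form does not depend on it: it is used
  only if \<open>T\<close> is obtuse, where local node 3 is determined and the remaining freedom swaps 1 and 2.\<close>

definition local_nodes :: "pt set \<Rightarrow> 3 \<Rightarrow> pt" where
  "local_nodes T = (SOME p. inj p \<and> range p = vertices T \<and>
     (\<forall>i. interior_angle p i \<le> interior_angle p 3))"

definition has_obtuse_angle :: "pt set \<Rightarrow> bool" where
  "has_obtuse_angle T \<longleftrightarrow> (\<exists>i. interior_angle (local_nodes T) i > pi / 2)"

definition local_stiffness :: "pt set \<Rightarrow> real^3^3" where
  "local_stiffness T = (\<chi> i j. grad_product T
     (nodal_basis {T} (local_nodes T i)) (nodal_basis {T} (local_nodes T j)))"

definition reference_matrix :: "real^3^3" where
  "reference_matrix = vector [vector [2, -1, -1], vector [-1, 2, -1], vector [-1, -1, 2]]"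

text \<open>Vectors in the common kernel satisfy the eigenvalue equation for every \<open>\<mu>\<close>; the condition
  \<open>reference_matrix *v z \<noteq> 0\<close> excludes these degenerate solutions.\<close>

definition lambda_min :: "pt set \<Rightarrow> real" where
  "lambda_min T = (LEAST \<mu>. \<mu> \<noteq> 0 \<and>
     (\<exists>z. reference_matrix *v z \<noteq> 0 \<and>
        local_stiffness T *v z = \<mu> *\<^sub>R (reference_matrix *v z)))"

definition gray_edge :: "mesh \<Rightarrow> pt set \<Rightarrow> pt \<Rightarrow> pt \<Rightarrow> bool" where
  "gray_edge N T x y \<longleftrightarrow> has_obtuse_angle T \<and>
     closed_segment x y \<in> mesh_edges N \<and> closed_segment x y \<subseteq> T \<and>
     (\<exists>c. y - x = c *\<^sub>R (local_nodes T 2 - local_nodes T 1))"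

definition edge_patch :: "mesh \<Rightarrow> pt set \<Rightarrow> pt set \<Rightarrow> pt set" where
  "edge_patch N T e = \<Union>{t\<in>N. t \<subseteq> T \<and> e \<subseteq> frontier t}"

definition k_edge_min :: "(pt set \<Rightarrow> pt \<Rightarrow> real) \<Rightarrow> mesh \<Rightarrow> pt set \<Rightarrow> pt \<Rightarrow> pt \<Rightarrow> real" where
  "k_edge_min k N T x y = Min {k_edge k T x' y' |x' y'.
     closed_segment x' y' \<in> mesh_edges N \<and>
     closed_segment x' y' \<subseteq> edge_patch N T (closed_segment x y)}"

definition k_edge_mod :: "(pt set \<Rightarrow> pt \<Rightarrow> real) \<Rightarrow> mesh \<Rightarrow> pt set \<Rightarrow> pt \<Rightarrow> pt \<Rightarrow> real" where
  "k_edge_mod k N T x y =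
     (let a12 = local_stiffness T $ 1 $ 2; km = k_edge_min k N T x y in
      if gray_edge N T x y \<and> (k_edge k T x y - km) * a12 > km * lambda_min T
      then km * (1 + lambda_min T / a12)
      else k_edge k T x y)"

definition a_h_mod ::
    "(pt set \<Rightarrow> pt \<Rightarrow> real) \<Rightarrow> mesh \<Rightarrow> mesh \<Rightarrow> (pt \<Rightarrow> real) \<Rightarrow> (pt \<Rightarrow> real) \<Rightarrow> real" where
  "a_h_mod k M N = scaled_form (k_edge_mod k N) M N"

end

theory Submission
  imports Defs "HOL-Computational_Algebra.Polynomial"
begin

text \<open>Every element of a refined mesh is the image of its macro element under a homothety, and the
  stiffness matrix of a triangle is invariant under homotheties in two dimensions. Hence the modified
  form splits into energies \<open>- \<Sum> k\<^sub>i\<^sub>j a\<^sub>i\<^sub>j (v\<^sub>i - v\<^sub>j)\<^sup>2\<close> of the fine elements, all with the stiffness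
  matrix \<open>a\<close> of the macro element. Only an obtuse triangle has a positive off-diagonal entry
  \<open>a\<^sub>1\<^sub>2\<close>; there the modification guarantees \<open>k\<^sub>1\<^sub>2 a\<^sub>1\<^sub>2 \<le> m (a\<^sub>1\<^sub>2 + \<lambda>)\<close>, where \<open>m\<close> is a lower bound for
  the coefficients on the element and \<open>\<lambda>\<close> is the smallest eigenvalue, and the negative term is absorbed
  by the Rayleigh bound for \<open>\<lambda>\<close>, leaving \<open>m \<lambda> ((v\<^sub>1 - v\<^sub>3)\<^sup>2 + (v\<^sub>2 - v\<^sub>3)\<^sup>2)\<close>. This bounds the Dirichlet energy of the
  element with a constant that depends on the macro element only, and the Poincare inequality does the
  rest. The weak gradient is identified with the piecewise gradient by its uniqueness in the interior
  of each element.\<close>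

section \<open>Smooth functions\<close>

text \<open>\<open>nodal_basis\<close> and \<open>weak_grad\<close> are choices, so an existence or
  uniqueness proof must precede every computation with them. For the hat functions, conformity of
  the refined meshes is bypassed: hats of \<open>refine M\<close> are written as piecewise linear
  expressions in hats of \<open>M\<close>, so conformity enters only for the macro mesh. For the
  weak gradient, \<open>H1_0\<close> provides existence, while uniqueness rests on the fundamental
  lemma of the calculus of variations, hence on a supply of smooth bump functions. The bound
  \<open>m\<close> of the absorption step is \<open>k_edge_min\<close>: a fine element lies in the
  patch of its own gray edge, so \<open>m\<close> also bounds the coefficients of its two other
  edges, which are never gray. On an obtuse element \<open>T\<close> the coercivity factor is
  \<open>\<kappa>\<^sub>0 * lambda_min T / (1 - a13 - a23)\<close>, with \<open>a13\<close> and
  \<open>a23\<close> the stiffness entries of \<open>T\<close>. It is fixed before the mesh level,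
  and finiteness of the macro mesh gives a common factor \<open>c\<close>. With the Poincare
  constant \<open>C\<close> the final constant is \<open>c / (C + 1)\<close>.\<close>

lemma GDERIV_unique:
  assumes "GDERIV f x :> D" "GDERIV f x :> D'"
  shows "D = D'"
proof -
  have "(\<lambda>h. h \<bullet> D) = (\<lambda>h. h \<bullet> D')"
    using assms unfolding gderiv_def by (rule has_derivative_unique)
  then have "h \<bullet> D = h \<bullet> D'" for h
    by (rule fun_cong)
  from this[of "D - D'"] have "(D - D') \<bullet> (D - D') = 0"
    by (simp add: inner_diff_right)
  then show ?thesis
    by simp
qed

lemma grad_eqI:
  assumes "GDERIV f x :> D"
  shows "grad f x = D"
  unfolding grad_def
proof (rule some_equality, rule assms)
  show "E = D" if "GDERIV f x :> E" for E
    by (rule GDERIV_unique[OF that assms])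
qed

text \<open>Riesz representation: a linear functional is the inner product with the image of 1 under
  its adjoint.\<close>

lemma differentiable_GDERIV_grad:
  fixes f :: "'a::euclidean_space \<Rightarrow> real"
  assumes "f differentiable (at x)"
  shows "GDERIV f x :> grad f x"
proof -
  obtain f' where f': "(f has_derivative f') (at x)"
    using assms by (auto simp: differentiable_def)
  then have lin: "linear f'"
    by (rule has_derivative_linear)
  have "f' h = h \<bullet> adjoint f' 1" for h
    using adjoint_works[OF lin, of h 1] by simp
  then have "f' = (\<lambda>h. h \<bullet> adjoint f' 1)"
    by (rule ext)
  with f' have "GDERIV f x :> adjoint f' 1"
    unfolding gderiv_def by simp
  then show ?thesis
    unfolding grad_eqI[OF \<open>GDERIV f x :> adjoint f' 1\<close>] .
qed

lemma GDERIV_imp_differentiable: "GDERIV f x :> D \<Longrightarrow> f differentiable (at x)"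
  unfolding gderiv_def differentiable_def by (rule exI)

lemma C_k_SucI:
  fixes f :: "'a::euclidean_space \<Rightarrow> real"
  assumes f: "\<And>x. GDERIV f x :> g x" and g: "\<And>b. b \<in> Basis \<Longrightarrow> C_k n (\<lambda>x. g x \<bullet> b)"
  shows "C_k (Suc n) f"
proof -
  have "grad f = g"
    by (rule ext) (rule grad_eqI[OF f])
  then show ?thesis
    using g GDERIV_imp_differentiable[OF f] by simp
qed

lemma C_k_Suc_GDERIV: "C_k (Suc n) f \<Longrightarrow> GDERIV f x :> grad f x"
  by (rule differentiable_GDERIV_grad) simp

lemma C_k_Suc_imp: "C_k (Suc n) f \<Longrightarrow> C_k n f"
proof (induction n arbitrary: f)
  case 0
  then have "\<forall>x. f differentiable (at x)" by simp
  then show ?case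
    by (meson C_k.simps(1) continuous_at_imp_continuous_on differentiable_imp_continuous_within)
next
  case (Suc n)
  then show ?case by (subst C_k.simps(2)) (auto simp del: C_k.simps, simp_all)
qed

lemma C_k_continuous: "C_k n f \<Longrightarrow> continuous_on UNIV f"
proof (induction n)
  case 0
  then show ?case by simp
next
  case (Suc n)
  then show ?case using C_k_Suc_imp by blast
qed

lemma C_k_continuous_grad:
  fixes f :: "'a::euclidean_space \<Rightarrow> real"
  assumes "C_k (Suc n) f"
  shows "continuous_on UNIV (grad f)"
proof -
  have "continuous_on UNIV (\<lambda>x. \<Sum>b\<in>Basis. (grad f x \<bullet> b) *\<^sub>R b)"
    using assms by (intro continuous_on_sum continuous_on_scaleR continuous_on_const) (auto intro: C_k_continuous)
  then show ?thesis
    by (simp add: euclidean_representation)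
qed

lemma C_k_const: "C_k n (\<lambda>x::'a::euclidean_space. c)"
proof (induction n arbitrary: c)
  case 0
  then show ?case by simp
next
  case (Suc n)
  show ?case
    by (rule C_k_SucI[OF GDERIV_const]) (simp add: Suc)
qed

lemma C_k_add: "C_k n f \<Longrightarrow> C_k n g \<Longrightarrow> C_k n (\<lambda>x. f x + g x)"
proof (induction n arbitrary: f g)
  case 0
  then show ?case by (simp add: continuous_on_add)
next
  case (Suc n)
  show ?case
  proof (rule C_k_SucI)
    show "GDERIV (\<lambda>x. f x + g x) x :> grad f x + grad g x" for x
      using Suc.prems by (intro GDERIV_add C_k_Suc_GDERIV)
    show "C_k n (\<lambda>x. (grad f x + grad g x) \<bullet> b)" if "b \<in> Basis" for b
      using Suc that by (simp add: inner_add_left)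
  qed
qed

lemma C_k_mult: "C_k n f \<Longrightarrow> C_k n g \<Longrightarrow> C_k n (\<lambda>x. f x * g x)"
proof (induction n arbitrary: f g)
  case 0
  then show ?case by (simp add: continuous_on_mult)
next
  case (Suc n)
  show ?case
  proof (rule C_k_SucI)
    show "GDERIV (\<lambda>x. f x * g x) x :> f x *\<^sub>R grad g x + g x *\<^sub>R grad f x" for x
      using Suc.prems by (intro GDERIV_mult C_k_Suc_GDERIV)
    show "C_k n (\<lambda>x. (f x *\<^sub>R grad g x + g x *\<^sub>R grad f x) \<bullet> b)" if "b \<in> Basis" for b
      unfolding inner_add_left inner_scaleR_left
    proof (intro C_k_add Suc.IH)
      show "C_k n f" "C_k n g"
        using Suc.prems by (blast dest: C_k_Suc_imp)+
      show "C_k n (\<lambda>x. grad f x \<bullet> b)" "C_k n (\<lambda>x. grad g x \<bullet> b)"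
        using Suc.prems that by simp_all
    qed
  qed
qed

lemma GDERIV_affine: "GDERIV (\<lambda>x. a \<bullet> x + c) x :> a"
  unfolding gderiv_def by (auto intro!: derivative_eq_intros simp: inner_commute)

lemma C_k_affine: "C_k n (\<lambda>x::'a::euclidean_space. a \<bullet> x + c)"
proof (cases n)
  case 0
  then show ?thesis by (auto intro!: continuous_intros)
next
  case (Suc m)
  show ?thesis
    unfolding Suc by (rule C_k_SucI[OF GDERIV_affine C_k_const])
qed

lemma C_k_prod:
  assumes "finite A" "\<And>i. i \<in> A \<Longrightarrow> C_k n (f i)"
  shows "C_k n (\<lambda>x::'a::euclidean_space. \<Prod>i\<in>A. f i x)"
  using assms by (induction A) (auto intro: C_k_const C_k_mult)

text \<open>\<open>bump n\<close> is the \<open>n\<close>-th derivative of \<open>exp (- 1 / x)\<close>, extended by \<open>0\<close> to \<open>x \<le> 0\<close>.\<close>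

fun bump_poly :: "nat \<Rightarrow> real poly" where
  "bump_poly 0 = 1"
| "bump_poly (Suc n) = [:0, 0, 1:] * (bump_poly n - pderiv (bump_poly n))"

definition bump :: "nat \<Rightarrow> real \<Rightarrow> real" where
  "bump n x = (if x > 0 then poly (bump_poly n) (1 / x) * exp (- (1 / x)) else 0)"

lemma tendsto_poly_times_exp_minus: "((\<lambda>y::real. poly p y * exp (- y)) \<longlongrightarrow> 0) at_top"
proof -
  have "((\<lambda>y. \<Sum>i\<le>degree p. coeff p i * (y ^ i / exp y)) \<longlongrightarrow> (\<Sum>i\<le>degree p. coeff p i * 0)) at_top"
    by (intro tendsto_intros tendsto_power_div_exp_0)
  then show ?thesis
    by (simp add: poly_altdef sum_distrib_right exp_minus divide_inverse mult.assoc)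
qed

text \<open>With y = 1/x, the chain rule turns P(y) exp(-y) into y^2 (P(y) - P'(y)) exp(-y), which
  is the recursion of \<open>bump_poly\<close>. At 0 both one-sided difference quotients tend to
  0.\<close>

lemma bump_has_derivative: "(bump n has_real_derivative bump (Suc n) x) (at x)"
proof (cases x "0::real" rule: linorder_cases)
  case greater
  have "((\<lambda>x. poly (bump_poly n) (1 / x) * exp (- (1 / x))) has_real_derivative bump (Suc n) x) (at x)"
    using greater by (auto intro!: derivative_eq_intros DERIV_chain2[OF poly_DERIV] simp: bump_def field_simps power2_eq_square)
  moreover have "\<forall>\<^sub>F y in nhds x. bump n y = poly (bump_poly n) (1 / y) * exp (- (1 / y))"
    using eventually_nhds_in_open[of "{0<..}" x] greater
    by (auto elim!: eventually_mono simp: bump_def)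
  ultimately show ?thesis
    by (simp only: DERIV_cong_ev[OF refl _ refl])
next
  case less
  have "\<forall>\<^sub>F y in nhds x. bump n y = 0"
    using eventually_nhds_in_open[of "{..<0}" x] less
    by (auto elim!: eventually_mono simp: bump_def)
  moreover have "((\<lambda>x. 0) has_real_derivative bump (Suc n) x) (at x)"
    using less by (simp add: bump_def)
  ultimately show ?thesis
    by (simp only: DERIV_cong_ev[OF refl _ refl])
next
  case equal
  have "((\<lambda>h. bump n h / h) \<longlongrightarrow> 0) (at 0)"
  proof (rule filterlim_split_at)
    have "\<forall>\<^sub>F h in at_left 0. bump n h / h = 0"
      by (auto simp: eventually_at_filter bump_def)
    then show "((\<lambda>h. bump n h / h) \<longlongrightarrow> 0) (at_left 0)"
      by (simp add: tendsto_eventually)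
    \<comment> \<open>Dividing by \<open>h\<close> multiplies the polynomial in \<open>1 / h\<close>
      by its variable, which is what \<open>pCons 0\<close> does; the exponential beats this
      polynomial too.\<close>
    have "((\<lambda>h. poly (pCons 0 (bump_poly n)) (inverse h) * exp (- inverse h)) \<longlongrightarrow> 0) (at_right 0)"
      using filterlim_compose[OF tendsto_poly_times_exp_minus filterlim_inverse_at_top_right] .
    then show "((\<lambda>h. bump n h / h) \<longlongrightarrow> 0) (at_right 0)"
      by (rule Lim_transform_eventually)
         (auto simp: eventually_at_filter bump_def divide_inverse)
  qed
  then show ?thesis
    by (simp add: equal has_field_derivative_iff bump_def)
qed

text \<open>The induction keeps \<open>n\<close> arbitrary because every derivative moves from
  \<open>bump n\<close> to \<open>bump (Suc n)\<close>.\<close>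

lemma C_k_bump: "C_k m (\<lambda>x::'a::euclidean_space. bump n (a \<bullet> x + c))"
proof (induction m arbitrary: n)
  case 0
  have "continuous_on UNIV (bump n)"
    by (meson DERIV_isCont bump_has_derivative continuous_at_imp_continuous_on)
  then have "continuous_on UNIV (bump n \<circ> (\<lambda>x::'a. a \<bullet> x + c))"
    by (intro continuous_on_compose continuous_intros) (auto elim: continuous_on_subset)
  then show ?case
    by (simp add: o_def)
next
  case (Suc m)
  show ?case
  proof (rule C_k_SucI)
    show "GDERIV (\<lambda>x. bump n (a \<bullet> x + c)) x :> bump (Suc n) (a \<bullet> x + c) *\<^sub>R a" for x
      by (rule GDERIV_DERIV_compose[OF GDERIV_affine bump_has_derivative])
    show "C_k m (\<lambda>x. (bump (Suc n) (a \<bullet> x + c) *\<^sub>R a) \<bullet> b)" for b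
      unfolding inner_scaleR_left by (intro C_k_mult Suc C_k_const)
  qed
qed

lemma bump_0_nonneg: "0 \<le> bump 0 x" and bump_0_le: "bump 0 x \<le> 1"
  and bump_0_eq_0_iff: "bump 0 x = 0 \<longleftrightarrow> x \<le> 0"
  by (auto simp: bump_def)

lemma tendsto_bump_0:
  assumes "x > 0"
  shows "(\<lambda>n. bump 0 (real n * x)) \<longlonglongrightarrow> 1"
proof -
  \<comment> \<open>The sequence is shifted by one because at index 0 the argument of
    \<open>bump 0\<close> is 0, where the exponential formula does not apply.\<close>
  have "(\<lambda>n. exp (- (inverse (real (Suc n)) * (1 / x)))) \<longlonglongrightarrow> exp (- (0 * (1 / x)))"
    by (intro tendsto_intros LIMSEQ_inverse_real_of_nat)
  then have "(\<lambda>n. bump 0 (real (Suc n) * x)) \<longlonglongrightarrow> 1"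
    using assms by (simp add: bump_def divide_inverse)
  then show ?thesis
    by (rule LIMSEQ_imp_Suc)
qed

section \<open>Compactly supported functions and integration by parts\<close>

abbreviation supp :: "('a::topological_space \<Rightarrow> real) \<Rightarrow> 'a set" where
  "supp f \<equiv> closure {x. f x \<noteq> 0}"

lemma grad_eq_0_outside_supp:
  fixes f :: "'a::euclidean_space \<Rightarrow> real"
  assumes "x \<notin> supp f"
  shows "grad f x = 0"
proof (rule grad_eqI, unfold gderiv_def, rule has_derivative_transform_within_open)
  show "((\<lambda>y. 0) has_derivative (\<lambda>h. h \<bullet> 0)) (at x)"
    by simp
  show "open (- supp f)" "x \<in> - supp f"
    using assms by auto
  show "0 = f y" if "y \<in> - supp f" for y
    using that closure_subset[of "{x. f x \<noteq> 0}"] by auto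
qed

lemma integrable_continuous_compact_support:
  fixes f :: "'a::euclidean_space \<Rightarrow> 'b::euclidean_space"
  assumes "continuous_on UNIV f" "compact K" "\<And>x. x \<notin> K \<Longrightarrow> f x = 0"
  shows "integrable lborel f"
proof -
  have "integrable lborel (\<lambda>x. indicator K x *\<^sub>R f x)"
    using assms(1,2) continuous_on_subset by (intro borel_integrable_compact) auto
  also have "(\<lambda>x. indicator K x *\<^sub>R f x) = f"
    using assms(3) by (auto simp: indicator_def fun_eq_iff)
  finally show ?thesis .
qed

text \<open>Mean value inequality; it bounds difference quotients uniformly, as dominated
  convergence requires.\<close>

lemma C_k_1_lipschitz:
  fixes \<psi> :: "'a::euclidean_space \<Rightarrow> real"
  assumes "C_k (Suc 0) \<psi>" "\<And>x. norm (grad \<psi> x) \<le> B"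
  shows "\<bar>\<psi> x - \<psi> y\<bar> \<le> B * norm (x - y)"
proof -
  have "norm (\<psi> x - \<psi> y) \<le> B * norm (x - y)"
  proof (rule differentiable_bound[of UNIV \<psi> "\<lambda>x h. h \<bullet> grad \<psi> x"])
    show "(\<psi> has_derivative (\<lambda>h. h \<bullet> grad \<psi> x)) (at x within UNIV)" for x
      using C_k_Suc_GDERIV[OF assms(1)] by (simp add: gderiv_def)
    show "onorm (\<lambda>h. h \<bullet> grad \<psi> x) \<le> B" for x
    proof (rule onorm_le)
      show "norm (h \<bullet> grad \<psi> x) \<le> B * norm h" for h
        using Cauchy_Schwarz_ineq2[of h "grad \<psi> x"] mult_right_mono[OF assms(2)[of x] norm_ge_zero[of h]]
        by (simp add: mult.commute)
    qed
  qed auto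
  then show ?thesis
    by simp
qed

lemma compact_support_bounded:
  fixes f :: "'a::euclidean_space \<Rightarrow> 'b::euclidean_space"
  assumes "continuous_on UNIV f" "compact K" "\<And>x. x \<notin> K \<Longrightarrow> f x = 0"
  obtains B where "B > 0" "\<And>x. norm (f x) \<le> B"
proof -
  have "compact (f ` K)"
    using assms(1,2) compact_continuous_image continuous_on_subset by blast
  then obtain B where "B > 0" "\<And>y. y \<in> f ` K \<Longrightarrow> norm y \<le> B"
    by (metis compact_imp_bounded bounded_pos)
  then have "norm (f x) \<le> B" for x
    using assms(3)[of x] by (cases "x \<in> K") auto
  then show ?thesis
    by (rule that[OF \<open>B > 0\<close>])
qed

lemma lborel_integral_shift:
  fixes f :: "'a::euclidean_space \<Rightarrow> real"
  assumes "f \<in> borel_measurable borel"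
  shows "(LINT x|lborel. f (x + c)) = (LINT x|lborel. f x)"
proof -
  have "(LINT x|lborel. f x) = (LINT x|distr lborel borel ((+) c). f x)"
    by (simp add: lborel_distr_plus)
  also have "\<dots> = (LINT x|lborel. f (c + x))"
    using assms by (intro integral_distr) auto
  finally show ?thesis
    by (simp add: add.commute)
qed

text \<open>By translation invariance the difference quotients of \<open>\<psi>\<close> have integral zero; pass to the
  limit by dominated convergence.\<close>

lemma integral_grad_component_eq_0:
  fixes \<psi> :: "'a::euclidean_space \<Rightarrow> real"
  assumes \<psi>: "C_k (Suc 0) \<psi>" and K: "compact (supp \<psi>)" and b: "b \<in> Basis"
  shows "(LINT x|lborel. grad \<psi> x \<bullet> b) = 0"
proof -
  have cont: "continuous_on UNIV \<psi>" and cont': "continuous_on UNIV (grad \<psi>)"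
    using \<psi> C_k_continuous C_k_continuous_grad by blast+
  obtain B where B: "B > 0" "\<And>x. norm (grad \<psi> x) \<le> B"
    using compact_support_bounded[OF cont' K grad_eq_0_outside_supp] by blast
  obtain R where R: "R > 0" "\<And>x. x \<in> supp \<psi> \<Longrightarrow> norm x \<le> R"
    using compact_imp_bounded[OF K] by (auto simp: bounded_pos)
  have R0: "\<psi> x = 0" if "norm x > R" for x
    using that R(2)[of x] closure_subset[of "{x. \<psi> x \<noteq> 0}"] by force
  have int: "integrable lborel \<psi>"
    by (rule integrable_continuous_compact_support[OF cont K]) (use closure_subset[of "{x. \<psi> x \<noteq> 0}"] in auto)
  have meas[measurable]: "\<psi> \<in> borel_measurable borel" "grad \<psi> \<in> borel_measurable borel"
    using cont cont' by (simp_all add: borel_measurable_continuous_onI)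
  define h where "h n = 1 / real (Suc n)" for n
  have h: "0 < h n" "h n \<le> 1" for n
    by (auto simp: h_def)
  have h0: "h \<longlonglongrightarrow> 0"
    unfolding h_def using LIMSEQ_Suc lim_1_over_n by blast
  define D where "D n x = (\<psi> (x + h n *\<^sub>R b) - \<psi> x) / h n" for n x
  have D0: "(LINT x|lborel. D n x) = 0" for n
  proof -
    have "integrable (distr lborel borel ((+) (h n *\<^sub>R b))) \<psi>"
      using int by (simp add: lborel_distr_plus)
    then have "integrable lborel (\<lambda>x. \<psi> (h n *\<^sub>R b + x))"
      by (rule integrable_distr[rotated]) simp
    then have "integrable lborel (\<lambda>x. \<psi> (x + h n *\<^sub>R b))"
      by (simp add: add.commute)
    with int show ?thesis
      by (simp add: D_def lborel_integral_shift)
  qed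
  have "(\<lambda>n. LINT x|lborel. D n x) \<longlonglongrightarrow> (LINT x|lborel. grad \<psi> x \<bullet> b)"
  proof (rule integral_dominated_convergence)
    \<comment> \<open>Shifts have length \<open>h n\<close>, at most 1, so all difference quotients
      vanish outside the ball of radius \<open>R + 1\<close>; inside, the Lipschitz constant
      \<open>B\<close> dominates.\<close>
    show "integrable lborel (\<lambda>x. indicator (cball (0::'a) (R + 1)) x *\<^sub>R B)"
      by (rule borel_integrable_compact) auto
    show "(\<lambda>x. grad \<psi> x \<bullet> b) \<in> borel_measurable lborel"
      by simp
    show "D n \<in> borel_measurable lborel" for n
      unfolding D_def by simp
    show "AE x in lborel. (\<lambda>n. D n x) \<longlonglongrightarrow> grad \<psi> x \<bullet> b"
    proof (rule AE_I2)
      fix x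
      have "((\<lambda>t. \<psi> (x + t *\<^sub>R b)) has_derivative (\<lambda>t. (t *\<^sub>R b) \<bullet> grad \<psi> (x + 0 *\<^sub>R b))) (at 0)"
        using C_k_Suc_GDERIV[OF \<psi>, of "x + 0 *\<^sub>R b"] unfolding gderiv_def
        by (rule has_derivative_compose[rotated]) (auto intro!: derivative_eq_intros)
      then have "((\<lambda>t. \<psi> (x + t *\<^sub>R b)) has_real_derivative (grad \<psi> x \<bullet> b)) (at 0)"
        unfolding has_field_derivative_def
        by (rule has_derivative_eq_rhs) (simp add: fun_eq_iff inner_commute)
      then have "((\<lambda>t. (\<psi> (x + t *\<^sub>R b) - \<psi> x) / t) \<longlongrightarrow> grad \<psi> x \<bullet> b) (at 0)"
        by (simp add: has_field_derivative_iff)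
      moreover have "filterlim h (at 0) sequentially"
        using h0 h(1) by (auto simp: filterlim_at less_imp_neq[symmetric])
      ultimately show "(\<lambda>n. D n x) \<longlonglongrightarrow> grad \<psi> x \<bullet> b"
        unfolding D_def by (rule filterlim_compose)
    qed
    show "AE x in lborel. norm (D n x) \<le> indicator (cball (0::'a) (R + 1)) x *\<^sub>R B" for n
    proof (rule AE_I2)
      fix x
      show "norm (D n x) \<le> indicator (cball (0::'a) (R + 1)) x *\<^sub>R B"
      proof (cases "norm x \<le> R + 1")
        case True
        have "\<bar>\<psi> (x + h n *\<^sub>R b) - \<psi> x\<bar> \<le> B * h n"
          using C_k_1_lipschitz[OF \<psi> B(2), of "x + h n *\<^sub>R b" x] b h[of n] by simp
        then show ?thesis
          using True h[of n] by (simp add: D_def field_simps)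
      next
        case False
        have "norm x \<le> norm (x + h n *\<^sub>R b) + norm (h n *\<^sub>R b)"
          using norm_triangle_ineq4[of "x + h n *\<^sub>R b" "h n *\<^sub>R b"] by simp
        then have "norm (x + h n *\<^sub>R b) > R"
          using False h[of n] b by simp
        then show ?thesis
          using False R0[of x] R0[of "x + h n *\<^sub>R b"] by (simp add: D_def)
      qed
    qed
  qed
  then have "(\<lambda>n. 0) \<longlonglongrightarrow> (LINT x|lborel. grad \<psi> x \<bullet> b)"
    by (simp add: D0)
  then show ?thesis
    by (simp add: LIMSEQ_const_iff)
qed

lemma grad_mult:
  assumes "C_k (Suc 0) u" "C_k (Suc 0) v"
  shows "grad (\<lambda>x. u x * v x) x = u x *\<^sub>R grad v x + v x *\<^sub>R grad u x"
  using assms by (intro grad_eqI GDERIV_mult C_k_Suc_GDERIV)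

lemma lebesgue_on_integral_eq_lborel:
  fixes f :: "'a::euclidean_space \<Rightarrow> 'b::euclidean_space"
  assumes "open U" "f \<in> borel_measurable borel" "\<And>x. x \<notin> U \<Longrightarrow> f x = 0"
  shows "(LINT x|lebesgue_on U. f x) = (LINT x|lborel. f x)"
proof -
  have "(LINT x|lebesgue_on U. f x) = (LINT x|lebesgue. indicator U x *\<^sub>R f x)"
    using assms(1) by (intro integral_restrict_space) auto
  also have "(\<lambda>x. indicator U x *\<^sub>R f x) = f"
    using assms(3) by (auto simp: indicator_def fun_eq_iff)
  also have "(LINT x|lebesgue. f x) = (LINT x|lborel. f x)"
    using assms(2) by (intro integral_completion) auto
  finally show ?thesis .
qed

text \<open>The product \<open>u * \<phi>\<close> inherits compact support from
  \<open>\<phi>\<close> alone, so each component of its gradient integrates to 0; the product rule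
  splits that integral.\<close>

lemma integral_by_parts_compact_support:
  fixes u \<phi> :: "'a::euclidean_space \<Rightarrow> real"
  assumes u: "C_k (Suc 0) u" and \<phi>: "C_k (Suc 0) \<phi>"
    and K: "compact (supp \<phi>)" "supp \<phi> \<subseteq> U" and U: "open U"
  shows "(LINT x|lebesgue_on U. u x *\<^sub>R grad \<phi> x) = - (LINT x|lebesgue_on U. \<phi> x *\<^sub>R grad u x)"
proof -
  have out: "\<phi> x = 0" "grad \<phi> x = 0" if "x \<notin> supp \<phi>" for x
    using that grad_eq_0_outside_supp[OF that] closure_subset[of "{x. \<phi> x \<noteq> 0}"] by auto
  note c = u[THEN C_k_continuous] \<phi>[THEN C_k_continuous] u[THEN C_k_continuous_grad] \<phi>[THEN C_k_continuous_grad]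
  have c1: "continuous_on UNIV (\<lambda>x. u x *\<^sub>R grad \<phi> x)" and c2: "continuous_on UNIV (\<lambda>x. \<phi> x *\<^sub>R grad u x)"
    using c by (auto intro: continuous_on_scaleR)
  have i1: "integrable lborel (\<lambda>x. u x *\<^sub>R grad \<phi> x)"
    by (rule integrable_continuous_compact_support[OF c1 K(1)]) (drule out(2), simp)
  have i2: "integrable lborel (\<lambda>x. \<phi> x *\<^sub>R grad u x)"
    by (rule integrable_continuous_compact_support[OF c2 K(1)]) (drule out(1), simp)
  have "(LINT x|lborel. u x *\<^sub>R grad \<phi> x) + (LINT x|lborel. \<phi> x *\<^sub>R grad u x) = 0"
  proof (rule euclidean_eqI)
    fix b :: 'a assume b: "b \<in> Basis"
    have s: "supp (\<lambda>x. u x * \<phi> x) \<subseteq> supp \<phi>"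
      by (intro closure_mono) auto
    have "compact (supp (\<lambda>x. u x * \<phi> x))"
      using compact_Int_closed[OF K(1) closed_closure, of "{x. u x * \<phi> x \<noteq> 0}"] s
      by (simp add: Int_absorb1)
    then have "(LINT x|lborel. grad (\<lambda>x. u x * \<phi> x) x \<bullet> b) = 0"
      using C_k_mult[OF u \<phi>] b by (intro integral_grad_component_eq_0)
    moreover have "(\<lambda>x. grad (\<lambda>x. u x * \<phi> x) x \<bullet> b) = (\<lambda>x. (u x *\<^sub>R grad \<phi> x + \<phi> x *\<^sub>R grad u x) \<bullet> b)"
      using u \<phi> by (simp only: grad_mult)
    ultimately have "(LINT x|lborel. (u x *\<^sub>R grad \<phi> x + \<phi> x *\<^sub>R grad u x) \<bullet> b) = 0"
      by simp
    then have "(LINT x|lborel. (u x *\<^sub>R grad \<phi> x + \<phi> x *\<^sub>R grad u x)) \<bullet> b = 0"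
      using i1 i2 by (subst (asm) integral_inner_left) auto
    then show "((LINT x|lborel. u x *\<^sub>R grad \<phi> x) + (LINT x|lborel. \<phi> x *\<^sub>R grad u x)) \<bullet> b = 0 \<bullet> b"
      using i1 i2 by simp
  qed
  moreover have "(LINT x|lebesgue_on U. u x *\<^sub>R grad \<phi> x) = (LINT x|lborel. u x *\<^sub>R grad \<phi> x)"
  proof (rule lebesgue_on_integral_eq_lborel[OF U borel_measurable_continuous_onI[OF c1]])
    show "u x *\<^sub>R grad \<phi> x = 0" if "x \<notin> U" for x
      using out(2)[of x] K(2) that by auto
  qed
  moreover have "(LINT x|lebesgue_on U. \<phi> x *\<^sub>R grad u x) = (LINT x|lborel. \<phi> x *\<^sub>R grad u x)"
  proof (rule lebesgue_on_integral_eq_lborel[OF U borel_measurable_continuous_onI[OF c2]])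
    show "\<phi> x *\<^sub>R grad u x = 0" if "x \<notin> U" for x
      using out(1)[of x] K(2) that by auto
  qed
  ultimately show ?thesis
    by (simp add: eq_neg_iff_add_eq_0)
qed

section \<open>The fundamental lemma of the calculus of variations\<close>

lemma test_functionD:
  assumes "\<phi> \<in> test_functions U"
  shows "C_k n \<phi>" "continuous_on UNIV \<phi>" "compact (supp \<phi>)" "supp \<phi> \<subseteq> U"
  using assms C_k.simps(1) by (auto simp: test_functions_def simp del: C_k.simps)

lemma not_in_supp: "x \<notin> supp f \<Longrightarrow> f x = 0"
  using closure_subset[of "{x. f x \<noteq> 0}"] by auto

lemma test_functions_mono: "S \<subseteq> U \<Longrightarrow> test_functions S \<subseteq> test_functions U"
  by (auto simp: test_functions_def)

lemma locally_integrable_subset: "locally_integrable U f \<Longrightarrow> S \<subseteq> U \<Longrightarrow> locally_integrable S f"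
  unfolding locally_integrable_def by (meson order_trans)

lemma locally_integrable_diff:
  assumes "locally_integrable U f" "locally_integrable U g"
  shows "locally_integrable U (\<lambda>x. f x - g x)"
  using assms unfolding locally_integrable_def by (intro allI impI Bochner_Integration.integrable_diff) auto

lemma locally_integrable_continuous:
  fixes f :: "'a::euclidean_space \<Rightarrow> 'b::euclidean_space"
  assumes "continuous_on UNIV f"
  shows "locally_integrable U f"
  unfolding locally_integrable_def
proof (intro allI impI)
  fix K assume K: "compact K \<and> K \<subseteq> U"
  have "integrable lborel (\<lambda>x. indicator K x *\<^sub>R f x)"
    using K assms continuous_on_subset by (intro borel_integrable_compact) auto
  then have "integrable lebesgue (\<lambda>x. indicator K x *\<^sub>R f x)"
    by (subst integrable_completion) (auto intro: borel_measurable_integrable)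
  then show "integrable (lebesgue_on K) f"
    using K by (subst integrable_restrict_space) (auto intro: lmeasurable_compact fmeasurableD)
qed

lemma locally_integrable_cong:
  assumes "\<And>x. x \<in> U \<Longrightarrow> f x = g x"
  shows "locally_integrable U f \<longleftrightarrow> locally_integrable U g"
  unfolding locally_integrable_def
proof (intro all_cong1 imp_cong refl)
  fix K assume "compact K \<and> K \<subseteq> U"
  then show "integrable (lebesgue_on K) f = integrable (lebesgue_on K) g"
    using assms by (intro Bochner_Integration.integrable_cong) auto
qed

text \<open>The multiplier is merely Borel and bounded so that the result serves both test functions
  and indicators of boxes.\<close>

lemma integrable_bounded_compact_support_scaleR:
  fixes h :: "'a::euclidean_space \<Rightarrow> 'b::euclidean_space" and \<phi> :: "'a \<Rightarrow> real"
  assumes h: "locally_integrable U h" and U: "open U" and K: "compact K" "K \<subseteq> U"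
    and \<phi>: "\<phi> \<in> borel_measurable borel" "\<And>x. x \<notin> K \<Longrightarrow> \<phi> x = 0" "\<And>x. \<bar>\<phi> x\<bar> \<le> B"
  shows "integrable (lebesgue_on U) (\<lambda>x. \<phi> x *\<^sub>R h x)"
proof -
  have "integrable (lebesgue_on K) h"
    using h K by (auto simp: locally_integrable_def)
  then have i: "integrable lebesgue (\<lambda>x. indicator K x *\<^sub>R h x)"
    using K by (subst (asm) integrable_restrict_space) (auto intro: lmeasurable_compact fmeasurableD)
  have "\<phi> \<in> borel_measurable lebesgue"
    using \<phi>(1) by (simp add: measurable_completion)
  then have "(\<lambda>x. \<phi> x *\<^sub>R (indicator K x *\<^sub>R h x)) \<in> borel_measurable lebesgue"
    using borel_measurable_integrable[OF i] by (rule borel_measurable_scaleR)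
  moreover have "norm (\<phi> x *\<^sub>R (indicator K x *\<^sub>R h x)) \<le> norm (B *\<^sub>R (indicator K x *\<^sub>R h x))" for x
    unfolding norm_scaleR
    using order_trans[OF \<phi>(3)[of x] abs_ge_self[of B]] by (intro mult_right_mono) auto
  ultimately have "integrable lebesgue (\<lambda>x. \<phi> x *\<^sub>R (indicator K x *\<^sub>R h x))"
    by (intro Bochner_Integration.integrable_bound[OF integrable_scaleR_right[OF i, of B]] AE_I2)
  also have "(\<lambda>x. \<phi> x *\<^sub>R (indicator K x *\<^sub>R h x)) = (\<lambda>x. indicator U x *\<^sub>R (\<phi> x *\<^sub>R h x))"
  proof (rule ext)
    show "\<phi> x *\<^sub>R (indicator K x *\<^sub>R h x) = indicator U x *\<^sub>R (\<phi> x *\<^sub>R h x)" for x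
      using \<phi>(2)[of x] K(2) by (cases "x \<in> K") auto
  qed
  finally show ?thesis
    using U by (subst integrable_restrict_space) auto
qed

lemma integrable_test_function_scaleR:
  fixes h :: "'a::euclidean_space \<Rightarrow> 'b::euclidean_space"
  assumes "locally_integrable U h" "open U" "\<phi> \<in> test_functions U"
  shows "integrable (lebesgue_on U) (\<lambda>x. \<phi> x *\<^sub>R h x)"
proof -
  note \<phi> = test_functionD[OF assms(3)]
  obtain B where "\<And>x. norm (\<phi> x) \<le> B"
    by (rule compact_support_bounded[OF \<phi>(2,3)]) (erule not_in_supp, blast)
  then have B: "\<bar>\<phi> x\<bar> \<le> B" for x
    by simp
  show ?thesis
  proof (rule integrable_bounded_compact_support_scaleR[OF assms(1,2) \<phi>(3,4)
        borel_measurable_continuous_onI[OF \<phi>(2)] _ B])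
    show "\<phi> x = 0" if "x \<notin> supp \<phi>" for x
      using that by (rule not_in_supp)
  qed
qed

text \<open>Each factor vanishes beyond one face of the box and tends to 1 strictly inside that face
  as \<open>n\<close> grows, so the products approximate the indicator of the open box from below by
  smooth functions.\<close>

definition box_bump :: "'a::euclidean_space \<Rightarrow> 'a \<Rightarrow> nat \<Rightarrow> 'a \<Rightarrow> real" where
  "box_bump a b n x = (\<Prod>i\<in>Basis. bump 0 (real n * (x \<bullet> i - a \<bullet> i)) * bump 0 (real n * (b \<bullet> i - x \<bullet> i)))"

lemma box_bump_eq_0: "x \<notin> box a b \<Longrightarrow> box_bump a b n x = 0"
  by (auto simp: box_bump_def mem_box bump_0_eq_0_iff mult_le_0_iff not_less)

lemma box_bump_bounds: "0 \<le> box_bump a b n x" "box_bump a b n x \<le> 1"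
  unfolding box_bump_def
  by (auto intro!: prod_nonneg prod_le_1 mult_nonneg_nonneg mult_le_one simp: bump_0_nonneg bump_0_le)

lemma tendsto_box_bump: "(\<lambda>n. box_bump a b n x) \<longlonglongrightarrow> indicator (box a b) x"
proof (cases "x \<in> box a b")
  case True
  have "(\<lambda>n. \<Prod>i\<in>Basis. bump 0 (real n * (x \<bullet> i - a \<bullet> i)) * bump 0 (real n * (b \<bullet> i - x \<bullet> i)))
      \<longlonglongrightarrow> (\<Prod>i\<in>(Basis::'a set). 1 * 1)"
    using True by (intro tendsto_prod tendsto_mult tendsto_bump_0) (auto simp: mem_box)
  then show ?thesis
    using True by (simp add: box_bump_def)
next
  case False
  then show ?thesis
    by (simp add: box_bump_eq_0)
qed

lemma box_bump_in_test_functions: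
  assumes "cbox a b \<subseteq> U"
  shows "box_bump a b n \<in> test_functions U"
proof -
  have "C_k m (\<lambda>x. \<Prod>i\<in>Basis. bump 0 ((real n *\<^sub>R i) \<bullet> x + - (real n * (a \<bullet> i))) *
      bump 0 ((- real n *\<^sub>R i) \<bullet> x + real n * (b \<bullet> i)))" for m
    by (intro C_k_prod C_k_mult C_k_bump) simp
  moreover have "(\<lambda>x. \<Prod>i\<in>Basis. bump 0 ((real n *\<^sub>R i) \<bullet> x + - (real n * (a \<bullet> i))) *
      bump 0 ((- real n *\<^sub>R i) \<bullet> x + real n * (b \<bullet> i))) = box_bump a b n"
    unfolding box_bump_def
    by (intro ext prod.cong refl) (simp add: inner_commute right_diff_distrib)
  ultimately have "C_k m (box_bump a b n)" for m
    by simp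
  moreover have s: "supp (box_bump a b n) \<subseteq> cbox a b"
    proof (rule closure_minimal)
    show "{x. box_bump a b n x \<noteq> 0} \<subseteq> cbox a b"
      using box_bump_eq_0[of _ a b n] box_subset_cbox[of a b] by blast
  qed (rule closed_cbox)
  moreover from s have "compact (supp (box_bump a b n))"
    using compact_Int_closed[OF compact_cbox[of a b] closed_closure, of "{x. box_bump a b n x \<noteq> 0}"]
    by (simp add: Int_absorb1)
  ultimately show ?thesis
    using assms by (auto simp: test_functions_def)
qed

text \<open>Open boxes form an intersection-stable generator of the Borel sets, so Dynkin's argument
  carries the vanishing integrals over to all Borel sets. Its complement step needs the total
  integral to be 0, which comes from exhausting the space by growing boxes.\<close>

lemma AE_eq_0_if_box_integrals_eq_0:
  fixes f :: "'a::euclidean_space \<Rightarrow> real"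
  assumes f: "integrable lborel f" and box: "\<And>a b. (LINT x:box a b|lborel. f x) = 0"
  shows "AE x in lborel. f x = 0"
proof -
  have set_int: "set_integrable lborel A f" if "A \<in> sets borel" for A
    using f that unfolding set_integrable_def by (intro integrable_mult_indicator) auto
  have UN: "(\<Union>n. box (- (real n *\<^sub>R One)) (real n *\<^sub>R One)) = (UNIV :: 'a set)"
    by (rule UN_box_eq_UNIV)
  have "(\<lambda>n. LINT x:box (- (real n *\<^sub>R One)) (real n *\<^sub>R One)|lborel. f x)
      \<longlonglongrightarrow> (LINT x:(UNIV :: 'a set)|lborel. f x)"
    unfolding UN[symmetric]
  proof (rule set_integral_cont_up)
    show "incseq (\<lambda>n. box (- (real n *\<^sub>R One)) (real n *\<^sub>R One :: 'a))"
      by (auto simp: incseq_def mem_box intro: less_le_trans)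
         (meson le_less_trans less_le_trans neg_le_iff_le of_nat_le_iff)+
  qed (auto simp: set_int UN)
  then have total: "(LINT x|lborel. f x) = 0"
    unfolding box by (simp add: set_lebesgue_integral_def LIMSEQ_const_iff)
  have "(LINT x:A|lborel. f x) = 0" if "A \<in> sets borel" for A
  proof -
    have "Int_stable (range (\<lambda>(a, b). box a b :: 'a set))"
      by (auto simp: Int_stable_def box_Int_box)
    moreover have "range (\<lambda>(a, b). box a b :: 'a set) \<subseteq> Pow UNIV"
      by simp
    moreover have "A \<in> sigma_sets UNIV (range (\<lambda>(a, b). box a b :: 'a set))"
      using that by (simp add: borel_eq_box)
    ultimately show ?thesis
    proof (induction rule: sigma_sets_induct_disjoint[consumes 3])
      case (compl A)
      have A: "A \<in> sets borel"
        using compl(1) by (simp add: borel_eq_box)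
      have "(LINT x:A \<union> (UNIV - A)|lborel. f x) = (LINT x:A|lborel. f x) + (LINT x:UNIV - A|lborel. f x)"
        using A by (intro set_integral_Un set_int) auto
      then show ?case
        using compl total by (simp add: set_lebesgue_integral_def)
    next
      case (union A)
      have "A i \<in> sets borel" for i
        using union(2) by (auto simp: borel_eq_box)
      then have "(LINT x:(\<Union>i. A i)|lborel. f x) = (\<Sum>i. LINT x:A i|lborel. f x)"
        using union(1) by (intro lebesgue_integral_countable_add set_int) (auto simp: disjoint_family_on_def)
      then show ?case
        using union by simp
    next
      case (basic A)
      then show ?case
        using box by auto
    qed (simp add: set_lebesgue_integral_def)
  qed
  then have "AE x in lborel. f x = (\<lambda>x. 0) x"
    using f by (intro density_unique_real) (auto simp: set_lebesgue_integral_def)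
  then show ?thesis
    by simp
qed

lemma box_integral_eq_0_if_test_integrals_eq_0:
  fixes h :: "'a::euclidean_space \<Rightarrow> 'b::euclidean_space"
  assumes U: "open U" and h: "locally_integrable U h"
    and test: "\<And>\<phi>. \<phi> \<in> test_functions U \<Longrightarrow> (LINT x|lebesgue_on U. \<phi> x *\<^sub>R h x) = 0"
    and ab: "cbox a b \<subseteq> U"
  shows "(LINT x|lebesgue_on U. indicator (box a b) x *\<^sub>R h x) = 0"
proof -
  have bi: "integrable (lebesgue_on U) (\<lambda>x. indicator (box a b) x *\<^sub>R h x)"
    using box_subset_cbox[of a b]
    by (intro integrable_bounded_compact_support_scaleR[OF h U compact_cbox ab, of _ 1]) (auto simp: indicator_def)
  have "(\<lambda>n. LINT x|lebesgue_on U. box_bump a b n x *\<^sub>R h x)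
      \<longlonglongrightarrow> (LINT x|lebesgue_on U. indicator (box a b) x *\<^sub>R h x)"
  proof (rule integral_dominated_convergence)
    show "(\<lambda>x. indicator (box a b) x *\<^sub>R h x) \<in> borel_measurable (lebesgue_on U)"
      using bi by (rule borel_measurable_integrable)
    show "(\<lambda>x. box_bump a b n x *\<^sub>R h x) \<in> borel_measurable (lebesgue_on U)" for n
      using integrable_test_function_scaleR[OF h U box_bump_in_test_functions[OF ab]]
      by (rule borel_measurable_integrable)
    show "integrable (lebesgue_on U) (\<lambda>x. norm (indicator (box a b) x *\<^sub>R h x))"
      using bi by (rule integrable_norm)
    show "AE x in lebesgue_on U. (\<lambda>n. box_bump a b n x *\<^sub>R h x) \<longlonglongrightarrow> indicator (box a b) x *\<^sub>R h x"
      by (intro AE_I2 tendsto_scaleR tendsto_box_bump tendsto_const)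
    show "AE x in lebesgue_on U. norm (box_bump a b n x *\<^sub>R h x) \<le> norm (indicator (box a b) x *\<^sub>R h x)" for n
    proof (rule AE_I2)
      show "norm (box_bump a b n x *\<^sub>R h x) \<le> norm (indicator (box a b) x *\<^sub>R h x)" for x
        using box_bump_bounds[of a b n x] box_bump_eq_0[of x a b n]
        by (cases "x \<in> box a b") (auto simp: mult_left_le_one_le)
    qed
  qed
  then show ?thesis
    by (simp add: test[OF box_bump_in_test_functions[OF ab]] LIMSEQ_const_iff)
qed

text \<open>Cut-off functions turn the hypothesis into vanishing integrals over all boxes inside a
  fixed closed box in \<open>U\<close>, so \<open>h\<close> is 0 almost everywhere there; countably
  many closed boxes exhaust \<open>U\<close>.\<close>

lemma fundamental_lemma_real:
  fixes h :: "'a::euclidean_space \<Rightarrow> real"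
  assumes U: "open U" and h: "locally_integrable U h"
    and test: "\<And>\<phi>. \<phi> \<in> test_functions U \<Longrightarrow> (LINT x|lebesgue_on U. \<phi> x * h x) = 0"
  shows "AE x in lebesgue_on U. h x = 0"
proof -
  have on_cbox: "AE x in lebesgue. x \<in> cbox a b \<longrightarrow> h x = 0" if ab: "cbox a b \<subseteq> U" for a b
  proof -
    define f where "f x = indicator (box a b) x * h x" for x
    have "integrable (lebesgue_on U) (\<lambda>x. indicator (box a b) x *\<^sub>R h x)"
      using box_subset_cbox[of a b]
      by (intro integrable_bounded_compact_support_scaleR[OF h U compact_cbox ab, of _ 1]) (auto simp: indicator_def)
    then have "integrable lebesgue (\<lambda>x. indicator U x *\<^sub>R (indicator (box a b) x *\<^sub>R h x))"
      using U by (subst (asm) integrable_restrict_space) auto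
    also have "(\<lambda>x. indicator U x *\<^sub>R (indicator (box a b) x *\<^sub>R h x)) = f"
      using ab box_subset_cbox[of a b] by (auto simp: f_def indicator_def fun_eq_iff)
    finally have f: "integrable lebesgue f" .
    \<comment> \<open>\<open>f\<close> is only Lebesgue measurable, while the argument with boxes
      lives in \<open>lborel\<close>; a Borel representative bridges the two.\<close>
    then obtain f' where f'[measurable]: "f' \<in> borel_measurable lborel" and ae: "AE x in lborel. f x = f' x"
      using completion_ex_borel_measurable_real[of f lborel] by auto
    have ae': "AE x in lebesgue. f x = f' x"
      using ae by (rule AE_completion)
    have "integrable lebesgue f'"
      using f ae' f' by (subst integrable_cong_AE[of f' lebesgue f]) (auto simp: measurable_completion)
    then have f'_int: "integrable lborel f'"
      by (simp add: integrable_completion)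
    have "AE x in lborel. f' x = 0"
    proof (rule AE_eq_0_if_box_integrals_eq_0[OF f'_int])
      fix c d :: 'a
      obtain p q where pq: "box c d \<inter> box a b = box p q"
        by (auto simp: box_Int_box)
      have "(LINT x:box c d|lborel. f' x) = (LINT x|lebesgue. indicator (box c d) x *\<^sub>R f' x)"
        unfolding set_lebesgue_integral_def by (intro integral_completion[symmetric]) simp
      also have "\<dots> = (LINT x|lebesgue. indicator (box c d) x *\<^sub>R f x)"
      proof (rule integral_cong_AE)
        show "(\<lambda>x. indicator (box c d) x *\<^sub>R f' x) \<in> borel_measurable lebesgue"
          by (intro measurable_completion) simp
        have "(\<lambda>x. indicator (box c d) x :: real) \<in> borel_measurable lebesgue"
          by (intro measurable_completion) simp
        then show "(\<lambda>x. indicator (box c d) x *\<^sub>R f x) \<in> borel_measurable lebesgue"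
          using borel_measurable_integrable[OF f] by (rule borel_measurable_scaleR)
        show "AE x in lebesgue. indicator (box c d) x *\<^sub>R f' x = indicator (box c d) x *\<^sub>R f x"
          using ae' by (rule AE_mp) simp
      qed
      also have "(\<lambda>x. indicator (box c d) x *\<^sub>R f x) = (\<lambda>x. indicator U x *\<^sub>R (indicator (box p q) x *\<^sub>R h x))"
        using ab box_subset_cbox[of a b] pq[symmetric]
        by (auto simp: f_def indicator_def fun_eq_iff)
      also have "(LINT x|lebesgue. indicator U x *\<^sub>R (indicator (box p q) x *\<^sub>R h x))
          = (LINT x|lebesgue_on U. indicator (box p q) x *\<^sub>R h x)"
        using U by (intro integral_restrict_space[symmetric]) auto
      also have "\<dots> = 0"
      \<comment> \<open>An empty box says nothing about the position of \<open>p\<close> and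
        \<open>q\<close>. Only a nonempty one has \<open>cbox p q\<close> as its closure, which then
        lies in \<open>cbox a b\<close> and hence in \<open>U\<close>.\<close>
      proof (cases "box p q = {}")
        case False
        have "cbox p q = closure (box p q)"
          using False by (simp add: closure_box)
        also have "\<dots> \<subseteq> cbox a b"
          using pq box_subset_cbox[of a b] by (intro closure_minimal) auto
        finally have "cbox p q \<subseteq> U"
          using ab by blast
        then show ?thesis
          using U h test by (intro box_integral_eq_0_if_test_integrals_eq_0) auto
      qed simp
      finally show "(LINT x:box c d|lborel. f' x) = 0" .
    qed
    then have "AE x in lebesgue. f' x = 0"
      by (rule AE_completion)
    with ae' have "AE x in lebesgue. f x = 0"
      by eventually_elim simp
    moreover have "AE x in lebesgue. x \<notin> cbox a b - box a b"
      using negligible_frontier_interval[of a b] by (intro AE_not_in) (simp add: negligible_iff_null_sets)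
    ultimately show ?thesis
      by eventually_elim (auto simp: f_def indicator_def split: if_splits)
  qed
  obtain \<D> where \<D>: "countable \<D>" "\<D> \<subseteq> Pow U" "\<And>X. X \<in> \<D> \<Longrightarrow> \<exists>a b. X = cbox a b" "\<Union>\<D> = U"
    using open_countable_Union_open_cbox[OF U] by metis
  have "AE x in lebesgue. \<forall>X\<in>\<D>. x \<in> X \<longrightarrow> h x = 0"
    using \<D>(1)
  proof (rule AE_ball_countable[THEN iffD2], intro ballI)
    fix X assume "X \<in> \<D>"
    with \<D>(2,3) obtain a b where "X = cbox a b" "cbox a b \<subseteq> U"
      by blast
    then show "AE x in lebesgue. x \<in> X \<longrightarrow> h x = 0"
      using on_cbox by simp
  qed
  then have "AE x in lebesgue. x \<in> U \<longrightarrow> h x = 0"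
    by (rule AE_mp) (use \<D>(4) in auto)
  then show ?thesis
    using U by (subst AE_restrict_space_iff) auto
qed

section \<open>Weak gradients and the Poincare inequality\<close>

lemma fundamental_lemma:
  fixes h :: "'a::euclidean_space \<Rightarrow> 'b::euclidean_space"
  assumes U: "open U" and h: "locally_integrable U h"
    and test: "\<And>\<phi>. \<phi> \<in> test_functions U \<Longrightarrow> (LINT x|lebesgue_on U. \<phi> x *\<^sub>R h x) = 0"
  shows "AE x in lebesgue_on U. h x = 0"
proof -
  have "AE x in lebesgue_on U. h x \<bullet> b = 0" if "b \<in> Basis" for b
  proof (rule fundamental_lemma_real[OF U])
    show "locally_integrable U (\<lambda>x. h x \<bullet> b)"
      using h by (auto simp: locally_integrable_def)
    show "(LINT x|lebesgue_on U. \<phi> x * (h x \<bullet> b)) = 0" if "\<phi> \<in> test_functions U" for \<phi>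
    proof -
      have "(LINT x|lebesgue_on U. (\<phi> x *\<^sub>R h x) \<bullet> b) = (LINT x|lebesgue_on U. \<phi> x *\<^sub>R h x) \<bullet> b"
        using integrable_test_function_scaleR[OF h U that] by (intro integral_inner_left)
      then show ?thesis
        using test[OF that] by simp
    qed
  qed
  then have "AE x in lebesgue_on U. \<forall>b\<in>Basis. h x \<bullet> b = 0"
    by (intro AE_ball_countable[THEN iffD2] ballI) (simp_all add: countable_finite)
  then show ?thesis
    by (rule AE_mp) (auto simp: euclidean_all_zero_iff)
qed

text \<open>This makes the choice in \<open>weak_grad\<close> harmless: every weak gradient can
  replace the chosen one under an integral.\<close>

lemma weak_grad_unique_AE:
  fixes v :: "'a::euclidean_space \<Rightarrow> real"
  assumes U: "open U" and g: "is_weak_grad U v g" "is_weak_grad U v g'"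
  shows "AE x in lebesgue_on U. g x = g' x"
proof -
  have loc: "locally_integrable U g" "locally_integrable U g'"
    using g by (auto simp: is_weak_grad_def)
  have "AE x in lebesgue_on U. g x - g' x = 0"
  proof (rule fundamental_lemma[OF U locally_integrable_diff[OF loc]])
    fix \<phi> :: "'a \<Rightarrow> real" assume \<phi>: "\<phi> \<in> test_functions U"
    have "(LINT x|lebesgue_on U. \<phi> x *\<^sub>R (g x - g' x))
        = (LINT x|lebesgue_on U. \<phi> x *\<^sub>R g x) - (LINT x|lebesgue_on U. \<phi> x *\<^sub>R g' x)"
      using integrable_test_function_scaleR[OF loc(1) U \<phi>] integrable_test_function_scaleR[OF loc(2) U \<phi>]
      by (simp add: scaleR_diff_right)
    also have "\<dots> = 0"
    proof -
      have "- (LINT x|lebesgue_on U. \<phi> x *\<^sub>R g x) = - (LINT x|lebesgue_on U. \<phi> x *\<^sub>R g' x)"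
        using g \<phi> unfolding is_weak_grad_def by metis
      then show ?thesis
        by simp
    qed
    finally show "(LINT x|lebesgue_on U. \<phi> x *\<^sub>R (g x - g' x)) = 0" .
  qed
  then show ?thesis
    by simp
qed

lemma is_weak_grad_weak_grad: "is_weak_grad U v g \<Longrightarrow> is_weak_grad U v (weak_grad U v)"
  unfolding weak_grad_def by (rule someI[where P = "is_weak_grad U v"])

lemma lebesgue_on_integral_subset:
  fixes f :: "'a::euclidean_space \<Rightarrow> 'b::euclidean_space"
  assumes "open U" "open S" "S \<subseteq> U" "\<And>x. x \<in> U - S \<Longrightarrow> f x = 0"
  shows "(LINT x|lebesgue_on U. f x) = (LINT x|lebesgue_on S. f x)"
proof -
  have "(LINT x|lebesgue. indicator U x *\<^sub>R f x) = (LINT x|lebesgue. indicator S x *\<^sub>R f x)"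
    using assms(3,4) by (intro Bochner_Integration.integral_cong refl) (auto simp: indicator_def)
  then show ?thesis
    using assms(1,2) by (subst (1 2) integral_restrict_space) auto
qed

lemma is_weak_grad_subset:
  fixes v :: "'a::euclidean_space \<Rightarrow> real"
  assumes v: "is_weak_grad U v g" and U: "open U" "open S" "S \<subseteq> U"
  shows "is_weak_grad S v g"
  unfolding is_weak_grad_def
proof (intro conjI ballI)
  show "locally_integrable S v" "locally_integrable S g"
    using v U(3) by (auto simp: is_weak_grad_def intro: locally_integrable_subset)
  fix \<phi> :: "'a \<Rightarrow> real" assume \<phi>: "\<phi> \<in> test_functions S"
  have *: "\<phi> x = 0" "grad \<phi> x = 0" if "x \<notin> S" for x
    using test_functionD(4)[OF \<phi>] that not_in_supp[of x \<phi>] grad_eq_0_outside_supp[of x \<phi>] by auto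
  have "(LINT x|lebesgue_on U. v x *\<^sub>R grad \<phi> x) = - (LINT x|lebesgue_on U. \<phi> x *\<^sub>R g x)"
    using v \<phi> test_functions_mono[OF U(3)] by (auto simp: is_weak_grad_def)
  moreover have "(LINT x|lebesgue_on U. v x *\<^sub>R grad \<phi> x) = (LINT x|lebesgue_on S. v x *\<^sub>R grad \<phi> x)"
    using * by (intro lebesgue_on_integral_subset[OF U]) simp
  moreover have "(LINT x|lebesgue_on U. \<phi> x *\<^sub>R g x) = (LINT x|lebesgue_on S. \<phi> x *\<^sub>R g x)"
    using * by (intro lebesgue_on_integral_subset[OF U]) simp
  ultimately show "(LINT x|lebesgue_on S. v x *\<^sub>R grad \<phi> x) = - (LINT x|lebesgue_on S. \<phi> x *\<^sub>R g x)"
    by simp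
qed

lemma is_weak_grad_C_k:
  fixes u :: "'a::euclidean_space \<Rightarrow> real"
  assumes U: "open U" and u: "C_k (Suc 0) u"
  shows "is_weak_grad U u (grad u)"
  unfolding is_weak_grad_def
proof (intro conjI ballI)
  show "locally_integrable U u" "locally_integrable U (grad u)"
    using u by (intro locally_integrable_continuous C_k_continuous C_k_continuous_grad; assumption)+
  fix \<phi> :: "'a \<Rightarrow> real" assume "\<phi> \<in> test_functions U"
  from test_functionD[OF this] u U
  show "(LINT x|lebesgue_on U. u x *\<^sub>R grad \<phi> x) = - (LINT x|lebesgue_on U. \<phi> x *\<^sub>R grad u x)"
    by (intro integral_by_parts_compact_support)
qed

lemma is_weak_grad_cong:
  fixes v :: "'a::euclidean_space \<Rightarrow> real"
  assumes "\<And>x. x \<in> U \<Longrightarrow> v x = w x"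
  shows "is_weak_grad U v g \<longleftrightarrow> is_weak_grad U w g"
proof -
  have "(LINT x|lebesgue_on U. v x *\<^sub>R grad \<phi> x) = (LINT x|lebesgue_on U. w x *\<^sub>R grad \<phi> x)" for \<phi>
    using assms by (intro Bochner_Integration.integral_cong refl) auto
  moreover have "locally_integrable U v = locally_integrable U w"
    using assms by (rule locally_integrable_cong)
  ultimately show ?thesis
    by (simp add: is_weak_grad_def)
qed

lemma is_weak_grad_affine:
  fixes v :: "'a::euclidean_space \<Rightarrow> real"
  assumes "open U" "\<And>x. x \<in> U \<Longrightarrow> v x = a \<bullet> x + c"
  shows "is_weak_grad U v (\<lambda>x. a)"
proof -
  have "is_weak_grad U (\<lambda>x. a \<bullet> x + c) (grad (\<lambda>x. a \<bullet> x + c))"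
    using assms(1) C_k_affine by (rule is_weak_grad_C_k)
  also have "grad (\<lambda>x. a \<bullet> x + c) = (\<lambda>x. a)"
    by (rule ext) (rule grad_eqI[OF GDERIV_affine])
  finally show ?thesis
    using is_weak_grad_cong[of U v, OF assms(2)] by simp
qed

text \<open>Existence of a weak gradient on \<open>U\<close> is a hypothesis, supplied later by
  membership in \<open>H1\<close>. Restricted to \<open>S\<close> it competes with the constant
  \<open>a\<close>, and uniqueness decides.\<close>

lemma weak_grad_affine_AE:
  fixes v :: "'a::euclidean_space \<Rightarrow> real"
  assumes "is_weak_grad U v g" "open U" "open S" "S \<subseteq> U" "\<And>x. x \<in> S \<Longrightarrow> v x = a \<bullet> x + c"
  shows "AE x in lebesgue_on S. weak_grad U v x = a"
  using weak_grad_unique_AE[OF assms(3) is_weak_grad_subset[OF is_weak_grad_weak_grad[OF assms(1)] assms(2-4)]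
      is_weak_grad_affine[OF assms(3,5)]] .

lemma integrable_lebesgue_on_compact_support:
  fixes f :: "'a::euclidean_space \<Rightarrow> 'b::euclidean_space"
  assumes "continuous_on UNIV f" "compact K" "\<And>x. x \<notin> K \<Longrightarrow> f x = 0" "open U"
  shows "integrable (lebesgue_on U) f"
proof -
  have "integrable lborel f"
    using assms(1-3) by (rule integrable_continuous_compact_support)
  then have "integrable lebesgue f"
    by (subst integrable_completion) (auto intro: borel_measurable_integrable)
  then have "integrable lebesgue (\<lambda>x. indicator U x *\<^sub>R f x)"
    using assms(4) by (intro integrable_mult_indicator) auto
  then show ?thesis
    using assms(4) by (subst integrable_restrict_space) auto
qed

lemma is_weak_grad_diff:
  fixes v :: "'a::euclidean_space \<Rightarrow> real"
  assumes v: "is_weak_grad U v g" and w: "is_weak_grad U w h" and U: "open U"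
  shows "is_weak_grad U (\<lambda>x. v x - w x) (\<lambda>x. g x - h x)"
  unfolding is_weak_grad_def
proof (intro conjI ballI)
  note loc = v[unfolded is_weak_grad_def, THEN conjunct1] w[unfolded is_weak_grad_def, THEN conjunct1]
    v[unfolded is_weak_grad_def, THEN conjunct2, THEN conjunct1]
    w[unfolded is_weak_grad_def, THEN conjunct2, THEN conjunct1]
  show "locally_integrable U (\<lambda>x. v x - w x)" "locally_integrable U (\<lambda>x. g x - h x)"
    using loc by (auto intro: locally_integrable_diff)
  fix \<phi> :: "'a \<Rightarrow> real" assume \<phi>: "\<phi> \<in> test_functions U"
  \<comment> \<open>Integrability is needed to split the integral of a difference. The lemma on
    bounded multipliers takes a scalar multiplier, so it is applied to each component of
    \<open>grad \<phi>\<close>.\<close>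
  have int: "integrable (lebesgue_on U) (\<lambda>x. u x *\<^sub>R grad \<phi> x)" if u: "locally_integrable U u" for u
  proof -
    have "integrable (lebesgue_on U) (\<lambda>x. (grad \<phi> x \<bullet> b) *\<^sub>R u x)" if "b \<in> Basis" for b
    proof -
      have c: "continuous_on UNIV (\<lambda>x. grad \<phi> x \<bullet> b)"
        using C_k_continuous_grad[OF test_functionD(1)[OF \<phi>]] by (intro continuous_intros)
      have z: "grad \<phi> x \<bullet> b = 0" if "x \<notin> supp \<phi>" for x
        using grad_eq_0_outside_supp[OF that] by simp
      obtain B where "\<And>x. norm (grad \<phi> x \<bullet> b) \<le> B"
        by (rule compact_support_bounded[OF c test_functionD(3)[OF \<phi>]]) (erule z, blast)
      then have B: "\<bar>grad \<phi> x \<bullet> b\<bar> \<le> B" for x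
        by simp
      show ?thesis
        by (rule integrable_bounded_compact_support_scaleR[OF u U test_functionD(3,4)[OF \<phi>]
              borel_measurable_continuous_onI[OF c] _ B]) (erule z)
    qed
    then have "integrable (lebesgue_on U) (\<lambda>x. \<Sum>b\<in>Basis. ((grad \<phi> x \<bullet> b) *\<^sub>R u x) *\<^sub>R b)"
      by (intro Bochner_Integration.integrable_sum integrable_scaleR_left) auto
    moreover have "(\<Sum>b\<in>Basis. ((grad \<phi> x \<bullet> b) *\<^sub>R u x) *\<^sub>R b) = u x *\<^sub>R grad \<phi> x" for x
    proof -
      have "u x *\<^sub>R grad \<phi> x = u x *\<^sub>R (\<Sum>b\<in>Basis. (grad \<phi> x \<bullet> b) *\<^sub>R b)"
        by (simp add: euclidean_representation)
      then show ?thesis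
        by (simp add: scaleR_sum_right mult.commute)
    qed
    ultimately show ?thesis
      by simp
  qed
  have "(LINT x|lebesgue_on U. v x *\<^sub>R grad \<phi> x) = - (LINT x|lebesgue_on U. \<phi> x *\<^sub>R g x)"
    "(LINT x|lebesgue_on U. w x *\<^sub>R grad \<phi> x) = - (LINT x|lebesgue_on U. \<phi> x *\<^sub>R h x)"
    using v w \<phi> by (auto simp: is_weak_grad_def)
  then show "(LINT x|lebesgue_on U. (v x - w x) *\<^sub>R grad \<phi> x) = - (LINT x|lebesgue_on U. \<phi> x *\<^sub>R (g x - h x))"
    using int[OF loc(1)] int[OF loc(2)]
      integrable_test_function_scaleR[OF loc(3) U \<phi>] integrable_test_function_scaleR[OF loc(4) U \<phi>]
    by (simp add: scaleR_diff_right scaleR_diff_left)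
qed

text \<open>\<open>is_weak_grad\<close> promises local integrability only, whereas \<open>L2\<close>
  asks for measurability on all of \<open>U\<close>; countably many closed boxes close the
  gap.\<close>

lemma locally_integrable_imp_measurable:
  fixes f :: "'a::euclidean_space \<Rightarrow> 'b::euclidean_space"
  assumes U: "open U" and f: "locally_integrable U f"
  shows "f \<in> borel_measurable (lebesgue_on U)"
proof -
  obtain \<D> where \<D>: "countable \<D>" "\<D> \<subseteq> Pow U" "\<And>X. X \<in> \<D> \<Longrightarrow> \<exists>a b. X = cbox a b" "\<Union>\<D> = U"
    using open_countable_Union_open_cbox[OF U] by metis
  show ?thesis
  proof (rule measurable_piecewise_restrict[OF \<D>(1)])
    show "space (lebesgue_on U) \<subseteq> \<Union>\<D>"
      using \<D>(4) by simp
    fix X assume "X \<in> \<D>"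
    with \<D>(2,3) obtain a b where X: "X = cbox a b" "cbox a b \<subseteq> U"
      by blast
    then have "f \<in> borel_measurable (lebesgue_on (cbox a b))"
      using f by (auto simp: locally_integrable_def intro: borel_measurable_integrable)
    then show "f \<in> borel_measurable (restrict_space (lebesgue_on U) X)"
      using X U by (simp add: restrict_restrict_space Int_absorb1)
    show "X \<inter> space (lebesgue_on U) \<in> sets (lebesgue_on U)"
      using X U by (auto simp: sets_restrict_space)
  qed
qed

section \<open>Square-integrable functions and the Poincare inequality\<close>

lemma L2_add:
  fixes f g :: "'a::euclidean_space \<Rightarrow> 'b::euclidean_space"
  assumes "L2 U f" "L2 U g"
  shows "L2 U (\<lambda>x. f x + g x)"
    "(LINT x|lebesgue_on U. (norm (f x + g x))\<^sup>2)
      \<le> 2 * (LINT x|lebesgue_on U. (norm (f x))\<^sup>2) + 2 * (LINT x|lebesgue_on U. (norm (g x))\<^sup>2)"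
proof -
  have i: "integrable (lebesgue_on U) (\<lambda>x. 2 * (norm (f x))\<^sup>2 + 2 * (norm (g x))\<^sup>2)"
    using assms by (auto simp: L2_def)
  have le: "(norm (f x + g x))\<^sup>2 \<le> 2 * (norm (f x))\<^sup>2 + 2 * (norm (g x))\<^sup>2" for x
  proof -
    have "(norm (f x + g x))\<^sup>2 \<le> (norm (f x) + norm (g x))\<^sup>2"
      by (intro power_mono norm_triangle_ineq) simp
    also have "\<dots> \<le> 2 * (norm (f x))\<^sup>2 + 2 * (norm (g x))\<^sup>2"
      using sum_squares_bound[of "norm (f x)" "norm (g x)"] by (simp add: power2_sum)
    finally show ?thesis .
  qed
  have m: "(\<lambda>x. f x + g x) \<in> borel_measurable (lebesgue_on U)"
    using assms by (auto simp: L2_def)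
  have i': "integrable (lebesgue_on U) (\<lambda>x. (norm (f x + g x))\<^sup>2)"
  proof (rule Bochner_Integration.integrable_bound[OF i])
    show "(\<lambda>x. (norm (f x + g x))\<^sup>2) \<in> borel_measurable (lebesgue_on U)"
      using m by measurable
    show "AE x in lebesgue_on U. norm ((norm (f x + g x))\<^sup>2) \<le> norm (2 * (norm (f x))\<^sup>2 + 2 * (norm (g x))\<^sup>2)"
      using le by (intro AE_I2) simp
  qed
  show "L2 U (\<lambda>x. f x + g x)"
    using m i' by (simp add: L2_def)
  have "(LINT x|lebesgue_on U. (norm (f x + g x))\<^sup>2) \<le> (LINT x|lebesgue_on U. 2 * (norm (f x))\<^sup>2 + 2 * (norm (g x))\<^sup>2)"
    using i' i le by (rule integral_mono)
  then show "(LINT x|lebesgue_on U. (norm (f x + g x))\<^sup>2)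
      \<le> 2 * (LINT x|lebesgue_on U. (norm (f x))\<^sup>2) + 2 * (LINT x|lebesgue_on U. (norm (g x))\<^sup>2)"
    using assms by (simp add: L2_def)
qed

lemma L2_minus: "L2 U f \<Longrightarrow> L2 U (\<lambda>x. - f x)"
  by (simp add: L2_def)

lemma L2_diff:
  fixes f g :: "'a::euclidean_space \<Rightarrow> 'b::euclidean_space"
  assumes "L2 U f" "L2 U g"
  shows "L2 U (\<lambda>x. f x - g x)"
  using L2_add(1)[OF assms(1) L2_minus[OF assms(2)]] by simp

lemma L2_compact_support:
  fixes f :: "'a::euclidean_space \<Rightarrow> 'b::euclidean_space"
  assumes f: "continuous_on UNIV f" "compact K" "\<And>x. x \<notin> K \<Longrightarrow> f x = 0" and U: "open U"
  shows "L2 U f"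
proof -
  have "continuous_on UNIV (\<lambda>x. (norm (f x))\<^sup>2)"
    using f(1) by (intro continuous_intros)
  then have "integrable (lebesgue_on U) (\<lambda>x. (norm (f x))\<^sup>2)"
    using f(2) by (rule integrable_lebesgue_on_compact_support) (use f(3) U in auto)
  moreover have "integrable (lebesgue_on U) f"
    using f U by (rule integrable_lebesgue_on_compact_support)
  ultimately show ?thesis
    by (simp add: L2_def borel_measurable_integrable)
qed

lemma L2_test_function:
  assumes "\<phi> \<in> test_functions U" "open U"
  shows "L2 U \<phi>" "L2 U (grad \<phi>)"
proof -
  note \<phi> = test_functionD[OF assms(1)]
  show "L2 U \<phi>"
    by (rule L2_compact_support[OF \<phi>(2,3) _ assms(2)]) (erule not_in_supp)
  show "L2 U (grad \<phi>)"
    by (rule L2_compact_support[OF C_k_continuous_grad[OF \<phi>(1)] \<phi>(3) _ assms(2)])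
       (erule grad_eq_0_outside_supp)
qed

text \<open>Integrate \<open>\<phi>\<^sup>2 \<partial>\<^sub>b (b \<bullet> x)\<close> by parts and absorb one factor \<open>\<phi>\<close>.\<close>

lemma poincare_test_functions:
  fixes U :: "'a::euclidean_space set"
  assumes U: "open U" "bounded U"
  obtains C where "C \<ge> 0" "\<And>\<phi>. \<phi> \<in> test_functions U \<Longrightarrow>
    (LINT x|lebesgue_on U. (\<phi> x)\<^sup>2) \<le> C * (LINT x|lebesgue_on U. (norm (grad \<phi> x))\<^sup>2)"
proof -
  obtain R where R: "R > 0" "\<And>x. x \<in> U \<Longrightarrow> norm x \<le> R"
    using U(2) by (auto simp: bounded_pos)
  obtain b :: 'a where b: "b \<in> Basis"
    using nonempty_Basis by blast
  have main: "(LINT x|lebesgue_on U. (\<phi> x)\<^sup>2) \<le> (4 * R\<^sup>2) * (LINT x|lebesgue_on U. (norm (grad \<phi> x))\<^sup>2)"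
    if "\<phi> \<in> test_functions U" for \<phi>
  proof -
    note \<phi> = test_functionD[OF that]
    note L2 = L2_test_function[OF that U(1)]
    define u where "u x = b \<bullet> x + 0" for x :: 'a
    have u: "C_k (Suc 0) u"
      unfolding u_def by (rule C_k_affine)
    have gu: "grad u x = b" for x
      unfolding u_def by (rule grad_eqI[OF GDERIV_affine])
    have \<phi>\<phi>: "C_k (Suc 0) (\<lambda>x. \<phi> x * \<phi> x)"
      using \<phi>(1) by (intro C_k_mult)
    have s: "supp (\<lambda>x. \<phi> x * \<phi> x) = supp \<phi>"
      by simp
    have g\<phi>\<phi>: "grad (\<lambda>x. \<phi> x * \<phi> x) x = (2 * \<phi> x) *\<^sub>R grad \<phi> x" for x
      using grad_mult[OF \<phi>(1) \<phi>(1)] by (simp add: scaleR_2[symmetric])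
    have parts: "(LINT x|lebesgue_on U. u x *\<^sub>R ((2 * \<phi> x) *\<^sub>R grad \<phi> x)) = - (LINT x|lebesgue_on U. (\<phi> x * \<phi> x) *\<^sub>R b)"
      using integral_by_parts_compact_support[OF u \<phi>\<phi>, of U] \<phi>(3,4) U(1) unfolding s g\<phi>\<phi> gu by simp
    have c1: "continuous_on UNIV (\<lambda>x. u x *\<^sub>R ((2 * \<phi> x) *\<^sub>R grad \<phi> x))"
      using C_k_continuous[OF u] \<phi>(2) C_k_continuous_grad[OF \<phi>(1)] by (intro continuous_intros)
    have i1: "integrable (lebesgue_on U) (\<lambda>x. u x *\<^sub>R ((2 * \<phi> x) *\<^sub>R grad \<phi> x))"
      by (rule integrable_lebesgue_on_compact_support[OF c1 \<phi>(3) _ U(1)]) (drule not_in_supp, simp)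
    have i2: "integrable (lebesgue_on U) (\<lambda>x. (\<phi> x)\<^sup>2)"
      using L2(1) by (simp add: L2_def)
    have i3: "integrable (lebesgue_on U) (\<lambda>x. (norm (grad \<phi> x))\<^sup>2)"
      using L2(2) by (simp add: L2_def)
    have "(LINT x|lebesgue_on U. (\<phi> x)\<^sup>2) = (LINT x|lebesgue_on U. (\<phi> x * \<phi> x) *\<^sub>R b) \<bullet> b"
      using i2 b by (simp add: power2_eq_square inner_Basis)
    also have "\<dots> = (LINT x|lebesgue_on U. - ((u x *\<^sub>R ((2 * \<phi> x) *\<^sub>R grad \<phi> x)) \<bullet> b))"
      using parts i1 by (subst Bochner_Integration.integral_minus) (simp add: integral_inner_left del: inner_scaleR_left)
    also have "\<dots> \<le> (LINT x|lebesgue_on U. 1/2 * (\<phi> x)\<^sup>2 + (2 * R\<^sup>2) * (norm (grad \<phi> x))\<^sup>2)"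
    proof (rule integral_mono)
      show "integrable (lebesgue_on U) (\<lambda>x. - ((u x *\<^sub>R ((2 * \<phi> x) *\<^sub>R grad \<phi> x)) \<bullet> b))"
        using i1 by (intro integrable_minus integrable_inner_left)
      show "integrable (lebesgue_on U) (\<lambda>x. 1/2 * (\<phi> x)\<^sup>2 + (2 * R\<^sup>2) * (norm (grad \<phi> x))\<^sup>2)"
        using i2 i3 by (intro Bochner_Integration.integrable_add integrable_mult_right)
      fix x assume "x \<in> space (lebesgue_on U)"
      then have "norm x \<le> R"
        using R(2) by simp
      then have "\<bar>u x\<bar> \<le> R"
        using Basis_le_norm[OF b, of x] by (simp add: u_def inner_commute)
      moreover have "\<bar>grad \<phi> x \<bullet> b\<bar> \<le> norm (grad \<phi> x)"
        using b by (rule Basis_le_norm)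
      ultimately have "\<bar>u x\<bar> * \<bar>grad \<phi> x \<bullet> b\<bar> \<le> R * norm (grad \<phi> x)"
        using R(1) by (intro mult_mono) auto
      then have sq: "(u x * (grad \<phi> x \<bullet> b))\<^sup>2 \<le> (R * norm (grad \<phi> x))\<^sup>2"
        using R(1) by (intro power2_le_iff_abs_le[THEN iffD2]) (auto simp: abs_mult)
      \<comment> \<open>Young's inequality as a completed square. The half of
        \<open>(\<phi> x)\<^sup>2\<close> is moved to the left at the end, which doubles
        \<open>2 * R\<^sup>2\<close> to \<open>4 * R\<^sup>2\<close>.\<close>
      have "0 \<le> 1/2 * (\<phi> x + 2 * (u x * (grad \<phi> x \<bullet> b)))\<^sup>2"
        by simp
      also have "\<dots> = 1/2 * (\<phi> x)\<^sup>2 + 2 * \<phi> x * (u x * (grad \<phi> x \<bullet> b)) + 2 * (u x * (grad \<phi> x \<bullet> b))\<^sup>2"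
        by (simp add: power2_eq_square algebra_simps)
      finally show "- ((u x *\<^sub>R ((2 * \<phi> x) *\<^sub>R grad \<phi> x)) \<bullet> b) \<le> 1/2 * (\<phi> x)\<^sup>2 + (2 * R\<^sup>2) * (norm (grad \<phi> x))\<^sup>2"
        using sq by (simp add: power_mult_distrib algebra_simps)
    qed
    also have "\<dots> = 1/2 * (LINT x|lebesgue_on U. (\<phi> x)\<^sup>2) + (2 * R\<^sup>2) * (LINT x|lebesgue_on U. (norm (grad \<phi> x))\<^sup>2)"
      using i2 i3 by simp
    finally show ?thesis
      by simp
  qed
  show ?thesis
    by (rule that[OF _ main]) auto
qed

lemma L2_weak_grad:
  fixes v :: "'a::euclidean_space \<Rightarrow> real"
  assumes U: "open U" and v: "is_weak_grad U v g" and g: "L2 U g"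
  shows "L2 U (weak_grad U v)"
    "(LINT x|lebesgue_on U. (norm (weak_grad U v x))\<^sup>2) = (LINT x|lebesgue_on U. (norm (g x))\<^sup>2)"
proof -
  note w = is_weak_grad_weak_grad[OF v]
  have m: "weak_grad U v \<in> borel_measurable (lebesgue_on U)"
    using w U by (intro locally_integrable_imp_measurable) (simp_all add: is_weak_grad_def)
  have ae: "AE x in lebesgue_on U. (norm (g x))\<^sup>2 = (norm (weak_grad U v x))\<^sup>2"
    using weak_grad_unique_AE[OF U v w] by eventually_elim simp
  have m': "(\<lambda>x. (norm (weak_grad U v x))\<^sup>2) \<in> borel_measurable (lebesgue_on U)"
    "(\<lambda>x. (norm (g x))\<^sup>2) \<in> borel_measurable (lebesgue_on U)"
    using m g by (auto simp: L2_def)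
  have "integrable (lebesgue_on U) (\<lambda>x. (norm (weak_grad U v x))\<^sup>2)"
    using g by (intro integrable_cong_AE_imp[OF _ m'(1) ae]) (simp add: L2_def)
  with m show "L2 U (weak_grad U v)"
    by (simp add: L2_def)
  show "(LINT x|lebesgue_on U. (norm (weak_grad U v x))\<^sup>2) = (LINT x|lebesgue_on U. (norm (g x))\<^sup>2)"
    using integral_cong_AE[OF m'(2,1) ae] by simp
qed

lemma H1_norm_squared: "(H1_norm U v)\<^sup>2 =
    (LINT x|lebesgue_on U. (v x)\<^sup>2) + (LINT x|lebesgue_on U. (norm (weak_grad U v x))\<^sup>2)"
  unfolding H1_norm_def by (intro real_sqrt_pow2 add_nonneg_nonneg integral_nonneg_AE AE_I2) auto

text \<open>Density: the inequality for the approximating test functions survives the limit, the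
  error being controlled by the norm of \<open>v - \<phi> m\<close> in \<open>H1\<close>.\<close>

lemma poincare_H1_0:
  fixes U :: "'a::euclidean_space set"
  assumes U: "open U" "bounded U"
  obtains C where "C \<ge> 0" "\<And>v. v \<in> H1_0 U \<Longrightarrow>
    (LINT x|lebesgue_on U. (v x)\<^sup>2) \<le> C * (LINT x|lebesgue_on U. (norm (weak_grad U v x))\<^sup>2)"
proof -
  obtain C where C: "C \<ge> 0" "\<And>\<phi>. \<phi> \<in> test_functions U \<Longrightarrow>
    (LINT x|lebesgue_on U. (\<phi> x)\<^sup>2) \<le> C * (LINT x|lebesgue_on U. (norm (grad \<phi> x))\<^sup>2)"
    by (rule poincare_test_functions[OF U]) blast
  have main: "(LINT x|lebesgue_on U. (v x)\<^sup>2) \<le> (4 * C) * (LINT x|lebesgue_on U. (norm (weak_grad U v x))\<^sup>2)"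
    if "v \<in> H1_0 U" for v
  proof -
    from that obtain g \<phi> where v: "L2 U v" "is_weak_grad U v g" "L2 U g"
      and \<phi>: "\<And>m. \<phi> m \<in> test_functions U" "(\<lambda>m. H1_norm U (\<lambda>x. v x - \<phi> m x)) \<longlonglongrightarrow> 0"
      by (auto simp: H1_0_def H1_def)
    let ?G = "weak_grad U v"
    have G: "is_weak_grad U v ?G" "L2 U ?G"
      using is_weak_grad_weak_grad[OF v(2)] L2_weak_grad(1)[OF U(1) v(2,3)] .
    define e where "e m = (H1_norm U (\<lambda>x. v x - \<phi> m x))\<^sup>2" for m
    have e: "e \<longlonglongrightarrow> 0"
      using tendsto_power[OF \<phi>(2), of 2] by (simp add: e_def[abs_def])
    \<comment> \<open>Two splittings, of \<open>v\<close> and of \<open>grad (\<phi> m)\<close>,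
      cost a factor 2 each: the bound is 2a + 2C(2b + 2G), where a and b are the two parts of
      \<open>e m\<close> and G is the squared gradient norm of \<open>v\<close>.\<close>
    have "(LINT x|lebesgue_on U. (v x)\<^sup>2) \<le> (2 + 4 * C) * e m + (4 * C) * (LINT x|lebesgue_on U. (norm (?G x))\<^sup>2)" for m
    proof -
      note t = test_functionD[OF \<phi>(1)[of m]]
      note L = L2_test_function[OF \<phi>(1)[of m] U(1)]
      have w: "is_weak_grad U (\<lambda>x. v x - \<phi> m x) (\<lambda>x. ?G x - grad (\<phi> m) x)"
        by (intro is_weak_grad_diff G U is_weak_grad_C_k t)
      have Ld: "L2 U (\<lambda>x. ?G x - grad (\<phi> m) x)" "L2 U (\<lambda>x. v x - \<phi> m x)"
        using G v(1) L by (auto intro: L2_diff)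
      let ?a = "LINT x|lebesgue_on U. (v x - \<phi> m x)\<^sup>2"
      let ?b = "LINT x|lebesgue_on U. (norm (?G x - grad (\<phi> m) x))\<^sup>2"
      have em: "e m = ?a + ?b"
        unfolding e_def H1_norm_squared L2_weak_grad(2)[OF U(1) w Ld(1)] ..
      have ab: "0 \<le> ?a" "0 \<le> ?b"
        by (auto intro: integral_nonneg_AE)
      have "(LINT x|lebesgue_on U. (v x)\<^sup>2) \<le> 2 * ?a + 2 * (LINT x|lebesgue_on U. (\<phi> m x)\<^sup>2)"
        using L2_add(2)[OF Ld(2) L(1)] by simp
      also have "(LINT x|lebesgue_on U. (\<phi> m x)\<^sup>2) \<le> C * (LINT x|lebesgue_on U. (norm (grad (\<phi> m) x))\<^sup>2)"
        by (rule C(2)[OF \<phi>(1)])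
      also have "(LINT x|lebesgue_on U. (norm (grad (\<phi> m) x))\<^sup>2) \<le> 2 * ?b + 2 * (LINT x|lebesgue_on U. (norm (?G x))\<^sup>2)"
        using L2_add(2)[OF L2_minus[OF Ld(1)] G(2)] by (simp add: norm_minus_commute)
      finally have "(LINT x|lebesgue_on U. (v x)\<^sup>2)
          \<le> 2 * ?a + 2 * (C * (2 * ?b + 2 * (LINT x|lebesgue_on U. (norm (?G x))\<^sup>2)))"
        using C(1) by (simp add: mult_left_mono)
      moreover have "C * ?b \<le> C * e m" "?a \<le> e m"
        using ab C(1) em by (auto intro: mult_left_mono)
      ultimately show ?thesis
        by (simp add: algebra_simps)
    qed
    moreover have "(\<lambda>m. (2 + 4 * C) * e m + (4 * C) * (LINT x|lebesgue_on U. (norm (?G x))\<^sup>2))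
        \<longlonglongrightarrow> (2 + 4 * C) * 0 + (4 * C) * (LINT x|lebesgue_on U. (norm (?G x))\<^sup>2)"
      by (intro tendsto_intros e)
    ultimately show ?thesis
      by (intro LIMSEQ_le_const[of _ "(4 * C) * (LINT x|lebesgue_on U. (norm (?G x))\<^sup>2)"]) auto
  qed
  show ?thesis
    by (rule that[OF _ main]) (use C(1) in auto)
qed

section \<open>Triangles and barycentric coordinates\<close>

text \<open>Twice the signed area of the triangle.\<close>

definition tri_det :: "(3 \<Rightarrow> pt) \<Rightarrow> real" where
  "tri_det p = (p 1 $ 1 - p 3 $ 1) * (p 2 $ 2 - p 3 $ 2) - (p 1 $ 2 - p 3 $ 2) * (p 2 $ 1 - p 3 $ 1)"

definition tri :: "(3 \<Rightarrow> pt) \<Rightarrow> pt set" where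
  "tri p = convex hull (range p)"

text \<open>Cramer's rule: the side opposite to vertex \<open>i\<close>, turned by a right angle and
  divided by twice the signed area.\<close>

definition bary_grad :: "(3 \<Rightarrow> pt) \<Rightarrow> 3 \<Rightarrow> pt" where
  "bary_grad p i = (1 / tri_det p) *\<^sub>R
     (if i = 1 then vector [p 2 $ 2 - p 3 $ 2, p 3 $ 1 - p 2 $ 1]
      else if i = 2 then vector [p 3 $ 2 - p 1 $ 2, p 1 $ 1 - p 3 $ 1]
      else vector [p 1 $ 2 - p 2 $ 2, p 2 $ 1 - p 1 $ 1])"

definition bary :: "(3 \<Rightarrow> pt) \<Rightarrow> 3 \<Rightarrow> pt \<Rightarrow> real" where
  "bary p i x = bary_grad p i \<bullet> (x - p 3) + (if i = 3 then 1 else 0)"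

lemma three_neq: "(1::3) \<noteq> 2" "(1::3) \<noteq> 3" "(2::3) \<noteq> 3" "(2::3) \<noteq> 1" "(3::3) \<noteq> 1" "(3::3) \<noteq> 2"
  by simp_all

lemma range_3: "range (p :: 3 \<Rightarrow> 'a) = {p 1, p 2, p 3}"
  by (simp add: UNIV_3)

lemma bary_affine: "bary p i x = bary_grad p i \<bullet> x + (bary p i 0)"
  by (simp add: bary_def inner_diff_right)

lemma bary_at_vertex: "tri_det p \<noteq> 0 \<Longrightarrow> bary p i (p j) = (if i = j then 1 else 0)"
  using exhaust_3[of i] exhaust_3[of j]
  by (auto simp: bary_def bary_grad_def inner_vec_def sum_2 field_simps) (auto simp: tri_det_def algebra_simps)

lemma sum_bary: "tri_det p \<noteq> 0 \<Longrightarrow> (\<Sum>i\<in>UNIV. bary p i x) = 1"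
  by (simp add: sum_3 bary_def bary_grad_def inner_vec_def sum_2 field_simps)

lemma bary_repr:
  assumes "tri_det p \<noteq> 0"
  shows "(\<Sum>i\<in>UNIV. bary p i x *\<^sub>R p i) = x"
proof -
  let ?D = "tri_det p"
  have b: "?D * bary p 1 x = (p 2 $ 2 - p 3 $ 2) * (x $ 1 - p 3 $ 1) + (p 3 $ 1 - p 2 $ 1) * (x $ 2 - p 3 $ 2)"
    "?D * bary p 2 x = (p 3 $ 2 - p 1 $ 2) * (x $ 1 - p 3 $ 1) + (p 1 $ 1 - p 3 $ 1) * (x $ 2 - p 3 $ 2)"
    using assms by (simp_all add: bary_def bary_grad_def inner_vec_def sum_2 distrib_left)
  have b3: "bary p 3 x = 1 - bary p 1 x - bary p 2 x"
    using sum_bary[OF assms, of x] by (simp add: sum_3)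
  have r: "(\<Sum>i\<in>UNIV. bary p i x *\<^sub>R p i) = p 3 + bary p 1 x *\<^sub>R (p 1 - p 3) + bary p 2 x *\<^sub>R (p 2 - p 3)"
    unfolding sum_3 b3 by (simp add: algebra_simps)
  have "?D * (p 3 + bary p 1 x *\<^sub>R (p 1 - p 3) + bary p 2 x *\<^sub>R (p 2 - p 3)) $ k
      = ?D * p 3 $ k + (?D * bary p 1 x) * (p 1 - p 3) $ k + (?D * bary p 2 x) * (p 2 - p 3) $ k" for k
    by (simp add: distrib_left)
  moreover have "?D * p 3 $ k + (?D * bary p 1 x) * (p 1 - p 3) $ k + (?D * bary p 2 x) * (p 2 - p 3) $ k
      = ?D * x $ k" for k
    unfolding b using exhaust_2[of k] by (auto simp: tri_det_def algebra_simps)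
  ultimately have "?D * (\<Sum>i\<in>UNIV. bary p i x *\<^sub>R p i) $ k = ?D * x $ k" for k
    unfolding r by simp
  then show ?thesis
    using assms by (simp add: vec_eq_iff)
qed

lemma sum_bary_grad: "(\<Sum>i\<in>UNIV. bary_grad p i) = 0"
  by (simp add: vec_eq_iff forall_2 sum_3 bary_grad_def diff_divide_distrib)

lemma tri_det_imp_inj: "tri_det p \<noteq> 0 \<Longrightarrow> inj p"
  by (rule injI) (metis bary_at_vertex zero_neq_one)

lemma tri_det_eq_0_iff_collinear: "tri_det p = 0 \<longleftrightarrow> collinear (range p)"
proof -
  let ?u = "p 1 - p 3" and ?w = "p 2 - p 3"
  have "range p = {p 1, p 3, p 2}"
    by (auto simp: range_3)
  then have "collinear (range p) \<longleftrightarrow> collinear {0, ?u, ?w}"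
    using collinear_3[of "p 1" "p 3" "p 2"] by simp
  also have "\<dots> \<longleftrightarrow> tri_det p = 0"
  proof
    assume 0: "tri_det p = 0"
    have "\<exists>c. ?w = c *\<^sub>R ?u" if u: "?u \<noteq> 0"
    proof -
      consider "?u $ 1 \<noteq> 0" | "?u $ 2 \<noteq> 0"
        using u unfolding vec_eq_iff[of ?u] forall_2 by auto
      then show ?thesis
      proof cases
        case 1
        have "?w $ 2 = ?w $ 1 / ?u $ 1 * ?u $ 2"
          using 0 1 by (simp add: tri_det_def eq_divide_eq mult.commute)
        then have "?w = (?w $ 1 / ?u $ 1) *\<^sub>R ?u"
          using 1 by (simp add: vec_eq_iff forall_2)
        then show ?thesis ..
      next
        case 2
        have "?w $ 1 = ?w $ 2 / ?u $ 2 * ?u $ 1"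
          using 0 2 by (simp add: tri_det_def eq_divide_eq mult.commute)
        then have "?w = (?w $ 2 / ?u $ 2) *\<^sub>R ?u"
          using 2 by (simp add: vec_eq_iff forall_2)
        then show ?thesis ..
      qed
    qed
    then show "collinear {0, ?u, ?w}"
      unfolding collinear_lemma by blast
  next
    assume "collinear {0, ?u, ?w}"
    then consider "?u = 0" | "?w = 0" | c where "?w = c *\<^sub>R ?u"
      unfolding collinear_lemma by blast
    then show "tri_det p = 0"
    proof cases
      case 3
      then have "p 2 $ 1 - p 3 $ 1 = c * (p 1 $ 1 - p 3 $ 1)" "p 2 $ 2 - p 3 $ 2 = c * (p 1 $ 2 - p 3 $ 2)"
        by (simp_all add: vec_eq_iff)
      then show ?thesis
        by (simp add: tri_det_def)
    qed (simp_all add: tri_det_def)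
  qed
  finally show ?thesis ..
qed

lemma tri_det_neq_0_iff: "tri_det p \<noteq> 0 \<longleftrightarrow> inj p \<and> \<not> affine_dependent (range p)"
proof -
  have "inj p \<longleftrightarrow> p 1 \<noteq> p 2 \<and> p 1 \<noteq> p 3 \<and> p 2 \<noteq> p 3"
    by (auto simp: inj_def forall_3)
  then show ?thesis
    using collinear_3_eq_affine_dependent[of "p 1" "p 2" "p 3"]
    unfolding tri_det_eq_0_iff_collinear range_3 by blast
qed

lemma simplex_2_imp_tri:
  assumes "2 simplex T"
  obtains p where "tri_det p \<noteq> 0" "T = tri p"
proof -
  obtain C where C: "\<not> affine_dependent C" "card C = 3" "T = convex hull C"
    using assms by (auto simp: simplex_def)
  then obtain a b c where abc: "C = {a, b, c}" "a \<noteq> b" "a \<noteq> c" "b \<noteq> c"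
    by (auto simp: card_3_iff)
  define p where "p i = (if i = 1 then a else if i = 2 then b else c)" for i :: 3
  have r: "range p = C"
    unfolding range_3 by (simp add: p_def abc)
  have "inj p"
    using abc(2-4) by (auto simp: inj_def forall_3 p_def)
  then have "tri_det p \<noteq> 0"
    using C(1) r by (simp add: tri_det_neq_0_iff)
  then show ?thesis
    using that C(3) r by (simp add: tri_def)
qed

lemma vertices_tri: "tri_det p \<noteq> 0 \<Longrightarrow> vertices (tri p) = range p"
  unfolding vertices_def tri_def tri_det_neq_0_iff
  using extreme_point_of_convex_hull_affine_independent[of "range p"] by auto

text \<open>Each half-plane is convex and contains the vertices, hence their hull; conversely,
  nonnegative coordinates make \<open>bary_repr\<close> a convex combination.\<close>

lemma tri_eq_bary:
  assumes "tri_det p \<noteq> 0"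
  shows "tri p = {x. \<forall>i. 0 \<le> bary p i x}"
proof (intro equalityI subsetI CollectI allI)
  fix x i assume x: "x \<in> tri p"
  have "tri p \<subseteq> {x. 0 \<le> bary p i x}"
    unfolding tri_def
  proof (rule hull_minimal)
    show "range p \<subseteq> {x. 0 \<le> bary p i x}"
      using assms by (auto simp: bary_at_vertex)
    have "{x. 0 \<le> bary p i x} = {x. bary_grad p i \<bullet> x \<ge> - bary p i 0}"
      by (subst bary_affine) auto
    then show "convex {x. 0 \<le> bary p i x}"
      by (simp add: convex_halfspace_ge)
  qed
  with x show "0 \<le> bary p i x"
    by auto
next
  fix x assume "x \<in> {x. \<forall>i. 0 \<le> bary p i x}"
  then have "(\<Sum>i\<in>UNIV. bary p i x *\<^sub>R p i) \<in> convex hull (range p)"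
    using sum_bary[OF assms, of x]
    by (intro convex_sum) (auto intro: hull_inc)
  then show "x \<in> tri p"
    by (simp add: bary_repr[OF assms] tri_def)
qed

lemma convex_tri: "convex (tri p)" and compact_tri: "compact (tri p)"
  by (simp_all add: tri_def finite_imp_compact_convex_hull)

lemma affine_on_tri:
  assumes p: "tri_det p \<noteq> 0" and v: "\<And>x. x \<in> tri p \<Longrightarrow> v x = g \<bullet> x + c" and x: "x \<in> tri p"
  shows "v x = (\<Sum>i\<in>UNIV. v (p i) * bary p i x)"
proof -
  have "p i \<in> tri p" for i
    by (auto simp: tri_def intro: hull_inc)
  then have "(\<Sum>i\<in>UNIV. v (p i) * bary p i x) = (\<Sum>i\<in>UNIV. g \<bullet> (bary p i x *\<^sub>R p i) + c * bary p i x)"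
    by (intro sum.cong refl) (simp add: v algebra_simps)
  also have "\<dots> = g \<bullet> (\<Sum>i\<in>UNIV. bary p i x *\<^sub>R p i) + c * (\<Sum>i\<in>UNIV. bary p i x)"
    by (simp add: sum.distrib inner_sum_right sum_distrib_left)
  also have "\<dots> = v x"
    using p x v by (simp add: bary_repr sum_bary)
  finally show ?thesis ..
qed

section \<open>Homotheties and the refinement of one triangle\<close>

definition homothety :: "real \<Rightarrow> pt \<Rightarrow> pt \<Rightarrow> pt" where
  "homothety s w x = s *\<^sub>R x + w"

lemma homothety_comp: "homothety s w (homothety s' w' x) = homothety (s * s') (s *\<^sub>R w' + w) x"
  by (simp add: homothety_def scaleR_add_right)

lemma tri_det_homothety: "tri_det (homothety s w \<circ> p) = s\<^sup>2 * tri_det p"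
  by (simp add: tri_det_def homothety_def power2_eq_square algebra_simps)

lemma bary_grad_homothety: "s \<noteq> 0 \<Longrightarrow> bary_grad (homothety s w \<circ> p) i = (1 / s) *\<^sub>R bary_grad p i"
  unfolding bary_grad_def tri_det_homothety
  \<comment> \<open>For a degenerate triangle both sides are 0, since division by zero gives
    0.\<close>
  by (cases "tri_det p = 0") (auto simp: vec_eq_iff forall_2 homothety_def power2_eq_square field_simps)

lemma tri_homothety: "tri (homothety s w \<circ> p) = homothety s w ` tri p"
proof -
  have "homothety s w = (\<lambda>x. w + s *\<^sub>R x)"
    by (auto simp: homothety_def)
  then show ?thesis
    using convex_hull_affinity[of w s "range p"] by (simp add: tri_def image_comp)
qed

lemma measure_tri_homothety: "measure lebesgue (tri (homothety s w \<circ> p)) = s\<^sup>2 * measure lebesgue (tri p)"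
  using measure_lebesgue_affine[of s w "tri p"] unfolding tri_homothety by (simp add: homothety_def[abs_def])

text \<open>The midpoint of the side opposite to \<open>p i\<close> is half of the vertex sum minus
  half of \<open>p i\<close>, so the middle child is a point-reflected copy with ratio -1/2; the
  corner children have ratio 1/2. Composing with \<open>p\<close> keeps the vertex order of the
  parent.\<close>

lemma refine_triangle_tri:
  assumes p: "tri_det p \<noteq> 0"
  shows "refine_triangle (tri p) =
    insert (tri (homothety (-1/2) ((1/2) *\<^sub>R (\<Sum>i\<in>UNIV. p i)) \<circ> p))
      ((\<lambda>i. tri (homothety (1/2) ((1/2) *\<^sub>R p i) \<circ> p)) ` UNIV)"
proof -
  have inj: "p 1 \<noteq> p 2" "p 1 \<noteq> p 3" "p 2 \<noteq> p 3"
    using tri_det_imp_inj[OF p] by (auto simp: inj_eq)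
  have "{midpoint a b |a b. a \<in> range p \<and> b \<in> range p \<and> a \<noteq> b}
      = {midpoint (p 2) (p 3), midpoint (p 1) (p 3), midpoint (p 1) (p 2)}"
    unfolding range_3 using inj by (auto simp: midpoint_sym[of "p 3"] midpoint_sym[of "p 2" "p 1"])
  also have "\<dots> = range (homothety (-1/2) ((1/2) *\<^sub>R (\<Sum>i\<in>UNIV. p i)) \<circ> p)"
  proof -
    have "midpoint (p 2) (p 3) = homothety (-1/2) ((1/2) *\<^sub>R (\<Sum>i\<in>UNIV. p i)) (p 1)"
      "midpoint (p 1) (p 3) = homothety (-1/2) ((1/2) *\<^sub>R (\<Sum>i\<in>UNIV. p i)) (p 2)"
      "midpoint (p 1) (p 2) = homothety (-1/2) ((1/2) *\<^sub>R (\<Sum>i\<in>UNIV. p i)) (p 3)"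
      by (simp_all add: homothety_def midpoint_def sum_3 vec_eq_iff field_simps)
    then show ?thesis
      by (simp only: range_3 o_apply)
  qed
  finally have 1: "convex hull {midpoint a b |a b. a \<in> range p \<and> b \<in> range p \<and> a \<noteq> b}
      = tri (homothety (-1/2) ((1/2) *\<^sub>R (\<Sum>i\<in>UNIV. p i)) \<circ> p)"
    by (simp add: tri_def)
  have "midpoint a = homothety (1/2) ((1/2) *\<^sub>R a)" for a
    by (rule ext) (simp add: homothety_def midpoint_def scaleR_add_right add.commute)
  then have 2: "convex hull (midpoint (p i) ` range p) = tri (homothety (1/2) ((1/2) *\<^sub>R p i) \<circ> p)" for i
    unfolding tri_def image_comp by simp
  have "(\<lambda>a. convex hull (midpoint a ` range p)) ` range p
      = (\<lambda>i. tri (homothety (1/2) ((1/2) *\<^sub>R p i) \<circ> p)) ` UNIV"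
    unfolding image_image[of "\<lambda>a. convex hull (midpoint a ` range p)" p UNIV] 2 ..
  with 1 show ?thesis
    unfolding refine_triangle_def vertices_tri[OF p] by (simp only:)
qed

text \<open>A point with some barycentric coordinate at least 1/2 lies in the corner child of that
  vertex; if all are below 1/2 it lies in the middle child. The points \<open>y\<close> are
  preimages under the corresponding homothety.\<close>

lemma tri_covered_by_refinement:
  assumes p: "tri_det p \<noteq> 0"
  shows "\<Union>(refine_triangle (tri p)) = tri p"
proof (intro equalityI subsetI)
  fix x assume "x \<in> \<Union>(refine_triangle (tri p))"
  then consider i where "x \<in> homothety (1/2) ((1/2) *\<^sub>R p i) ` tri p"
    | "x \<in> homothety (-1/2) ((1/2) *\<^sub>R (\<Sum>i\<in>UNIV. p i)) ` tri p"
    by (auto simp: refine_triangle_tri[OF p] tri_homothety)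
  then show "x \<in> tri p"
  proof cases
    case 1
    then obtain y where y: "y \<in> tri p" "x = homothety (1/2) ((1/2) *\<^sub>R p i) y"
      by auto
    have "p i \<in> tri p"
      by (auto simp: tri_def intro: hull_inc)
    then have "(1/2) *\<^sub>R y + (1/2) *\<^sub>R p i \<in> tri p"
      using y(1) by (intro convexD[OF convex_tri]) auto
    then show ?thesis
      using y(2) by (simp add: homothety_def)
  next
    case 2
    then obtain y where y: "y \<in> tri p" "x = homothety (-1/2) ((1/2) *\<^sub>R (\<Sum>i\<in>UNIV. p i)) y"
      by auto
    have "0 \<le> bary p i x" for i
    proof -
      have "bary p i y \<le> (\<Sum>i\<in>UNIV. bary p i y)"
        using y(1) p by (intro member_le_sum) (auto simp: tri_eq_bary)
      then have "bary p i y \<le> 1"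
        using p by (simp add: sum_bary)
      moreover have "bary p i x = 1/2 - 1/2 * bary p i y"
      proof -
        have *: "(\<Sum>j\<in>UNIV. bary p i (p j)) = 1"
          by (simp add: bary_at_vertex[OF p])
        show ?thesis
          using * unfolding y(2) sum_3
          by (simp add: bary_def homothety_def sum_3 inner_add_right inner_diff_right algebra_simps split: if_splits)
      qed
      ultimately show ?thesis
        by simp
    qed
    then show ?thesis
      using p by (simp add: tri_eq_bary)
  qed
next
  fix x assume x: "x \<in> tri p"
  then have b: "0 \<le> bary p i x" for i
    using p by (auto simp: tri_eq_bary)
  show "x \<in> \<Union>(refine_triangle (tri p))"
  proof (cases "\<exists>i. 1/2 \<le> bary p i x")
    case True
    then obtain i where i: "1/2 \<le> bary p i x" ..
    define y where "y = 2 *\<^sub>R x - p i"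
    have "bary p j y = 2 * bary p j x - bary p j (p i)" for j
      by (simp add: y_def bary_def inner_diff_right)
    then have "y \<in> tri p"
      using i b p by (auto simp: tri_eq_bary bary_at_vertex)
    moreover have "x = homothety (1/2) ((1/2) *\<^sub>R p i) y"
      by (simp add: homothety_def y_def scaleR_diff_right)
    ultimately show ?thesis
      unfolding refine_triangle_tri[OF p] tri_homothety by blast
  next
    case False
    define y where "y = (\<Sum>i\<in>UNIV. p i) - 2 *\<^sub>R x"
    have "bary p j y = 1 - 2 * bary p j x" for j
    proof -
      have *: "(\<Sum>i\<in>UNIV. bary p j (p i)) = 1"
        by (simp add: bary_at_vertex[OF p])
      show ?thesis
        using * unfolding y_def sum_3
        by (simp add: bary_def inner_diff_right inner_add_right split: if_splits)
    qed
    moreover have "bary p j x < 1/2" for j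
      using False by (meson not_le)
    ultimately have "0 \<le> bary p j y" for j
      by (smt (verit) field_sum_of_halves)
    then have "y \<in> tri p"
      using p by (simp add: tri_eq_bary)
    moreover have "x = homothety (-1/2) ((1/2) *\<^sub>R (\<Sum>i\<in>UNIV. p i)) y"
      by (simp add: homothety_def y_def scaleR_diff_right)
    ultimately show ?thesis
      unfolding refine_triangle_tri[OF p] tri_homothety by blast
  qed
qed

section \<open>Refined meshes\<close>

lemma refined_mesh_0: "refined_mesh M 0 = M" and refined_mesh_Suc: "refined_mesh M (Suc n) = refine (refined_mesh M n)"
  by (simp_all add: refined_mesh_def)

lemma refined_mesh_UN: "refined_mesh M n = (\<Union>T\<in>M. refined_mesh {T} n)"
  by (induction n) (auto simp: refined_mesh_0 refined_mesh_Suc refine_def)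

lemma refine_triangle_homothety:
  assumes p: "tri_det p \<noteq> 0" and t: "t \<in> refine_triangle (tri p)"
  obtains s w where "\<bar>s\<bar> = 1/2" "t = tri (homothety s w \<circ> p)"
  using t unfolding refine_triangle_tri[OF p] by (auto intro: that[of "-1/2"] that[of "1/2"])

text \<open>Homotheties compose. Only the absolute value of the ratio is fixed by the level, since
  each passage to a middle child flips its sign.\<close>

lemma refined_mesh_homothety:
  assumes p: "tri_det p \<noteq> 0" and t: "t \<in> refined_mesh {tri p} n"
  shows "\<exists>s w. \<bar>s\<bar> = 1 / 2 ^ n \<and> t = tri (homothety s w \<circ> p)"
  using t
proof (induction n arbitrary: t)
  case 0
  have "p = homothety 1 0 \<circ> p"
    by (simp add: homothety_def o_def)
  with 0 show ?case
    by (intro exI[of _ 1] exI[of _ 0]) (simp add: refined_mesh_0)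
next
  case (Suc n)
  then obtain t' where t': "t' \<in> refined_mesh {tri p} n" "t \<in> refine_triangle t'"
    by (auto simp: refined_mesh_Suc refine_def)
  with Suc.IH obtain s w where s: "\<bar>s\<bar> = 1 / 2 ^ n" "t' = tri (homothety s w \<circ> p)"
    by blast
  then have "tri_det (homothety s w \<circ> p) \<noteq> 0"
    using p by (auto simp: tri_det_homothety)
  from refine_triangle_homothety[OF this] t'(2) s(2)
  obtain s' w' where s': "\<bar>s'\<bar> = 1/2" "t = tri (homothety s' w' \<circ> (homothety s w \<circ> p))"
    by metis
  have "homothety s' w' \<circ> (homothety s w \<circ> p) = homothety (s' * s) (s' *\<^sub>R w + w') \<circ> p"
    by (simp add: fun_eq_iff homothety_comp)
  with s' have "t = tri (homothety (s' * s) (s' *\<^sub>R w + w') \<circ> p)"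
    by (simp only:)
  moreover have "\<bar>s' * s\<bar> = 1 / 2 ^ Suc n"
    unfolding abs_mult s(1) s'(1) by simp
  ultimately show ?case
    by blast
qed

lemma refined_mesh_tri:
  assumes p: "tri_det p \<noteq> 0" and t: "t \<in> refined_mesh {tri p} n"
  obtains s w where "s \<noteq> 0" "s\<^sup>2 = 1 / 4 ^ n" "t = tri (homothety s w \<circ> p)" "tri_det (homothety s w \<circ> p) \<noteq> 0"
proof -
  obtain s w where s: "\<bar>s\<bar> = 1 / 2 ^ n" "t = tri (homothety s w \<circ> p)"
    using refined_mesh_homothety[OF assms] by blast
  have "s \<noteq> 0"
    using s(1) by auto
  moreover have "s\<^sup>2 = 1 / 4 ^ n"
    using arg_cong[OF s(1), of "\<lambda>x. x\<^sup>2"] by (simp add: power_divide power_mult[symmetric] mult.commute[of n] power_mult)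
  ultimately show ?thesis
    using that s(2) p by (simp add: tri_det_homothety)
qed

text \<open>The upper bound on the number of elements is what the area count in
  \<open>refined_mesh_partition_AE\<close> relies on.\<close>

lemma refined_mesh_finite_card:
  assumes p: "tri_det p \<noteq> 0"
  shows "finite (refined_mesh {tri p} n)" "card (refined_mesh {tri p} n) \<le> 4 ^ n"
proof -
  have "finite (refined_mesh {tri p} n) \<and> card (refined_mesh {tri p} n) \<le> 4 ^ n"
  proof (induction n)
    case (Suc n)
    have t: "finite (refine_triangle t) \<and> card (refine_triangle t) \<le> 4" if t: "t \<in> refined_mesh {tri p} n" for t
    proof -
      obtain s w where q: "t = tri (homothety s w \<circ> p)" "tri_det (homothety s w \<circ> p) \<noteq> 0"
        using refined_mesh_tri[OF p t] by metis
      show ?thesis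
        unfolding q(1) refine_triangle_tri[OF q(2)]
        by (intro conjI order.trans[OF card_insert_le_m1] order.trans[OF card_image_le]) auto
    qed
    have "card (\<Union>t\<in>refined_mesh {tri p} n. refine_triangle t) \<le> (\<Sum>t\<in>refined_mesh {tri p} n. card (refine_triangle t))"
      using Suc by (intro card_UN_le) auto
    also have "\<dots> \<le> card (refined_mesh {tri p} n) * 4"
      using t sum_bounded_above[of "refined_mesh {tri p} n" "\<lambda>t. card (refine_triangle t)" 4] by simp
    also have "\<dots> \<le> 4 ^ Suc n"
      using Suc by simp
    finally show ?case
      using Suc t by (simp add: refined_mesh_Suc refine_def)
  qed (simp add: refined_mesh_0)
  then show "finite (refined_mesh {tri p} n)" "card (refined_mesh {tri p} n) \<le> 4 ^ n"
    by auto
qed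

lemma refined_mesh_cover:
  assumes p: "tri_det p \<noteq> 0"
  shows "\<Union>(refined_mesh {tri p} n) = tri p"
proof (induction n)
  case (Suc n)
  have t: "\<Union>(refine_triangle t) = t" if t: "t \<in> refined_mesh {tri p} n" for t
    using refined_mesh_tri[OF p t] tri_covered_by_refinement by metis
  have "\<Union>(refined_mesh {tri p} (Suc n)) = (\<Union>t\<in>refined_mesh {tri p} n. \<Union>(refine_triangle t))"
    by (auto simp: refined_mesh_Suc refine_def)
  also have "\<dots> = \<Union>(refined_mesh {tri p} n)"
    using t by simp
  finally show ?case
    using Suc by simp
qed (simp add: refined_mesh_0)

lemma lmeasurable_tri: "tri p \<in> lmeasurable"
  by (intro lmeasurable_compact compact_tri)

lemma measure_refined:
  assumes p: "tri_det p \<noteq> 0" and t: "t \<in> refined_mesh {tri p} n"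
  shows "measure lebesgue t = measure lebesgue (tri p) / 4 ^ n"
  using refined_mesh_tri[OF assms] measure_tri_homothety by (metis divide_inverse inverse_eq_divide mult.commute)

lemma lmeasurable_refined:
  assumes p: "tri_det p \<noteq> 0" and t: "t \<in> refined_mesh {tri p} n"
  shows "t \<in> lmeasurable"
  using refined_mesh_tri[OF assms] lmeasurable_tri by metis

text \<open>The elements cover \<open>T\<close>, and there are at most \<open>4 ^ n\<close> of them, each of area
  \<open>\<bar>T\<bar> / 4 ^ n\<close>, so there is no room for overlaps of positive measure.\<close>

lemma refined_mesh_partition_AE:
  assumes p: "tri_det p \<noteq> 0"
  shows "AE x in lebesgue_on (tri p). (\<Sum>t\<in>refined_mesh {tri p} n. indicator t x) = (1::real)"
proof -
  let ?R = "refined_mesh {tri p} n" and ?L = "lebesgue_on (tri p)"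
  note fin = refined_mesh_finite_card[OF p, of n]
  have sub: "t \<subseteq> tri p" if "t \<in> ?R" for t
    using refined_mesh_cover[OF p, of n] that by blast
  have T: "tri p \<in> sets lebesgue"
    using lmeasurable_tri by (rule fmeasurableD)
  have int: "integrable ?L (\<lambda>x. indicator t x :: real)"
    and meas: "(LINT x|?L. indicator t x :: real) = measure lebesgue t" if t: "t \<in> ?R" for t
  proof -
    have i: "(\<lambda>x. indicator (tri p) x *\<^sub>R (indicator t x :: real)) = indicator t"
    proof (rule ext)
      show "indicator (tri p) x *\<^sub>R (indicator t x :: real) = indicator t x" for x
        using sub[OF t] by (cases "x \<in> t") auto
    qed
    show "integrable ?L (\<lambda>x. indicator t x :: real)"
      using lmeasurable_refined[OF p t] T i
      by (subst integrable_restrict_space) (auto simp only: lmeasurable_iff_integrable[symmetric] Int_UNIV_right space_completion space_lborel space_borel)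
    show "(LINT x|?L. indicator t x :: real) = measure lebesgue t"
      using lmeasurable_refined[OF p t] T i
      by (subst integral_restrict_space) (auto simp only: Bochner_Integration.integral_indicator Int_UNIV_right space_completion space_lborel space_borel)
  qed
  have one: "integrable ?L (\<lambda>x. 1 :: real)" "(LINT x|?L. (1::real)) = measure lebesgue (tri p)"
    using lmeasurable_tri[of p] T
    by (auto simp: lmeasurable_iff_integrable integrable_restrict_space measure_restrict_space)
  let ?f = "\<lambda>x. (\<Sum>t\<in>?R. indicator t x) - (1::real)"
  have f: "integrable ?L ?f"
    using int one by (intro Bochner_Integration.integrable_diff Bochner_Integration.integrable_sum) auto
  have ge: "0 \<le> ?f x" if x: "x \<in> tri p" for x
  proof -
    obtain t where "t \<in> ?R" "x \<in> t"
      using x refined_mesh_cover[OF p, of n] by blast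
    then have "indicator t x \<le> (\<Sum>t\<in>?R. indicator t x :: real)"
      using fin by (intro member_le_sum) auto
    then show ?thesis
      using \<open>x \<in> t\<close> by simp
  qed
  have "(LINT x|?L. ?f x) = (\<Sum>t\<in>?R. measure lebesgue t) - measure lebesgue (tri p)"
    using int one
    by (subst Bochner_Integration.integral_diff)
       (auto simp: Bochner_Integration.integral_sum meas simp del: Bochner_Integration.integral_indicator lebesgue_integral_const)
  also have "(\<Sum>t\<in>?R. measure lebesgue t) = card ?R * (measure lebesgue (tri p) / 4 ^ n)"
    using measure_refined[OF p] by simp
  also have "\<dots> \<le> 4 ^ n * (measure lebesgue (tri p) / 4 ^ n)"
    using of_nat_mono[OF fin(2), where ?'a = real] by (intro mult_right_mono) simp_all
  finally have "(LINT x|?L. ?f x) \<le> 0"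
    by simp
  moreover have "0 \<le> (LINT x|?L. ?f x)"
    using ge by (intro integral_nonneg_AE AE_I2) simp
  ultimately have "AE x in ?L. ?f x = 0"
    using f ge by (subst integral_nonneg_eq_0_iff_AE[symmetric]) auto
  then show ?thesis
    by eventually_elim simp
qed

text \<open>The property from which \<open>nodal_basis\<close> chooses; as a predicate it can be
  studied before any such function is known to exist.\<close>

definition nodal :: "mesh \<Rightarrow> pt \<Rightarrow> (pt \<Rightarrow> real) \<Rightarrow> bool" where
  "nodal M x \<phi> \<longleftrightarrow> \<phi> \<in> P1_space M \<and> \<phi> x = 1 \<and> (\<forall>y\<in>nodes M - {x}. \<phi> y = 0)"

text \<open>Conformity is left out on purpose: this weaker property passes to refinements through
  the homotheties alone.\<close>

definition nondegenerate :: "mesh \<Rightarrow> bool" where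
  "nondegenerate M \<longleftrightarrow> finite M \<and> (\<forall>T\<in>M. \<exists>p. tri_det p \<noteq> 0 \<and> T = tri p)"

lemma nondegenerate_refined_mesh:
  assumes "nondegenerate M"
  shows "nondegenerate (refined_mesh M n)"
proof -
  have "finite (refined_mesh {T} n)" if "T \<in> M" for T
    using assms that refined_mesh_finite_card(1) unfolding nondegenerate_def by metis
  moreover have "\<exists>p. tri_det p \<noteq> 0 \<and> t = tri p" if T: "T \<in> M" "t \<in> refined_mesh {T} n" for t T
  proof -
    obtain p where p: "tri_det p \<noteq> 0" "T = tri p"
      using assms T by (auto simp: nondegenerate_def)
    show ?thesis
      using refined_mesh_tri[OF p(1), of t n] T(2) p(2) by metis
  qed
  ultimately show ?thesis
    using assms unfolding nondegenerate_def refined_mesh_UN[of M] by blast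
qed

section \<open>Hat functions on a conforming triangulation\<close>

lemma tri_vertex_in: "p i \<in> tri p"
  by (auto simp: tri_def intro: hull_inc)

lemma tri_vertex_in_nodes: "tri p \<in> M \<Longrightarrow> tri_det p \<noteq> 0 \<Longrightarrow> p i \<in> nodes M"
  unfolding nodes_def using vertices_tri[of p] by blast

lemma finite_nodes:
  assumes "nondegenerate M"
  shows "finite (nodes M)"
proof -
  have "finite (vertices T)" if "T \<in> M" for T
    using assms that vertices_tri unfolding nondegenerate_def by (metis finite finite_imageI)
  then show ?thesis
    using assms by (simp add: nodes_def nondegenerate_def)
qed

lemma P1_on_tri:
  assumes "v \<in> P1_space M" "tri p \<in> M" "tri_det p \<noteq> 0" "x \<in> tri p"
  shows "v x = (\<Sum>i\<in>UNIV. v (p i) * bary p i x)"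
proof -
  obtain g c where "\<And>x. x \<in> tri p \<Longrightarrow> v x = g \<bullet> x + c"
    using assms(1,2) unfolding P1_space_def by blast
  then show ?thesis
    using assms by (intro affine_on_tri) auto
qed

lemma nodal_on_tri:
  assumes "nodal M z \<phi>" "tri p \<in> M" "tri_det p \<noteq> 0" "x \<in> tri p"
  shows "\<phi> x = (\<Sum>i\<in>UNIV. of_bool (p i = z) * bary p i x)"
proof -
  have "\<phi> (p i) = of_bool (p i = z)" for i
    using assms(1) tri_vertex_in_nodes[OF assms(2,3), of i] by (auto simp: nodal_def)
  then show ?thesis
    using assms P1_on_tri[of \<phi> M p x] by (simp add: nodal_def)
qed

text \<open>Continuity comes for free: one function that is affine on each of finitely many closed
  triangles is continuous on their union by the pasting lemma.\<close>

lemma P1_spaceI: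
  assumes M: "nondegenerate M" and v: "\<And>t. t \<in> M \<Longrightarrow> \<exists>g c. \<forall>x\<in>t. v x = g \<bullet> x + c"
  shows "v \<in> P1_space M"
proof -
  have "continuous_on t v" if t: "t \<in> M" for t
  proof -
    obtain g c where "\<And>x. x \<in> t \<Longrightarrow> v x = g \<bullet> x + c"
      using v[OF t] by blast
    then show ?thesis
      by (subst continuous_on_cong[OF refl]) (auto intro!: continuous_intros)
  qed
  moreover have "closed t" if "t \<in> M" for t
    using M that compact_tri compact_imp_closed unfolding nondegenerate_def by metis
  ultimately have "continuous_on (\<Union>t\<in>M. id t) v"
    using M by (intro continuous_on_closed_Union) (auto simp: nondegenerate_def)
  then show ?thesis
    using v by (simp add: P1_space_def)
qed

lemma sum_bary_is_affine: "\<exists>g c. \<forall>x. (\<Sum>i\<in>UNIV. a i * bary p i x) = g \<bullet> x + c"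
proof (intro exI allI)
  fix x
  have "a i * bary p i x = (a i *\<^sub>R bary_grad p i) \<bullet> x + a i * bary p i 0" for i
    by (subst bary_affine) (simp add: distrib_left)
  then show "(\<Sum>i\<in>UNIV. a i * bary p i x)
      = (\<Sum>i\<in>UNIV. a i *\<^sub>R bary_grad p i) \<bullet> x + (\<Sum>i\<in>UNIV. a i * bary p i 0)"
    by (simp add: inner_sum_left sum.distrib)
qed

text \<open>Extreme points of the common face are vertices of both triangles, where both sums equal
  1 or 0 according to whether the vertex is \<open>z\<close>. The face is the hull of its extreme
  points, and an affine function that vanishes there vanishes on the hull.\<close>

lemma bary_agree_on_common_face:
  assumes p: "tri_det p \<noteq> 0" and q: "tri_det q \<noteq> 0"
    and face: "(tri p \<inter> tri q) face_of tri p" "(tri p \<inter> tri q) face_of tri q"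
    and x: "x \<in> tri p \<inter> tri q"
  shows "(\<Sum>i\<in>UNIV. of_bool (p i = z) * bary p i x) = (\<Sum>i\<in>UNIV. of_bool (q i = z) * bary q i x)"
proof -
  define F where "F = tri p \<inter> tri q"
  define d where "d x = (\<Sum>i\<in>UNIV. of_bool (p i = z) * bary p i x) - (\<Sum>i\<in>UNIV. of_bool (q i = z) * bary q i x)" for x
  obtain g c g' c' where "\<And>x. (\<Sum>i\<in>UNIV. of_bool (p i = z) * bary p i x) = g \<bullet> x + c"
    "\<And>x. (\<Sum>i\<in>UNIV. of_bool (q i = z) * bary q i x) = g' \<bullet> x + c'"
    using sum_bary_is_affine[of "\<lambda>i. of_bool (p i = z)" p] sum_bary_is_affine[of "\<lambda>i. of_bool (q i = z)" q] by blast
  then have d: "d x = (g - g') \<bullet> x + (c - c')" for x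
    by (simp add: d_def inner_diff_left)
  have F: "convex F" "compact F"
    by (auto simp: F_def intro: convex_Int compact_Int convex_tri compact_tri)
  have vtx: "d y = 0" if y: "y extreme_point_of F" for y
  proof -
    have val: "(\<Sum>i\<in>UNIV. of_bool (r i = z) * bary r i y) = of_bool (y = z)"
      if r: "tri_det r \<noteq> 0" "F face_of tri r" for r
    proof -
      have "y extreme_point_of tri r"
        using y r(2) extreme_point_of_face by blast
      then obtain j where j: "y = r j"
        using vertices_tri[OF r(1)] by (auto simp: vertices_def)
      have "(\<Sum>i\<in>UNIV. of_bool (r i = z) * bary r i y) = (\<Sum>i\<in>UNIV. if i = j then of_bool (r i = z) else 0)"
        by (intro sum.cong refl) (simp add: j bary_at_vertex[OF r(1)])
      then show ?thesis
        by (simp add: j)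
    qed
    show ?thesis
      using val[OF p] val[OF q] face by (simp add: d_def F_def)
  qed
  have "F = convex hull {y. y extreme_point_of F}"
    using F(2,1) by (rule Krein_Milman_Minkowski)
  also have "\<dots> \<subseteq> {y. d y = 0}"
  proof (rule hull_minimal)
    have "{y. d y = 0} = {y. (g - g') \<bullet> y = c' - c}"
      by (auto simp: d)
    then show "convex {y. d y = 0}"
      by (simp add: convex_hyperplane)
  qed (use vtx in auto)
  finally show ?thesis
    using x by (auto simp: F_def d_def)
qed

text \<open>Conformity of the macro mesh enters here: it makes the value of \<open>\<phi>\<close> at
  \<open>x\<close> independent of which element containing \<open>x\<close> is chosen.\<close>

lemma nodal_exists_triangulation:
  assumes M: "triangulation M" "nondegenerate M" and z: "z \<in> nodes M"
  shows "\<exists>\<phi>. nodal M z \<phi>"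
proof -
  have "\<exists>p. \<forall>T\<in>M. tri_det (p T) \<noteq> 0 \<and> tri (p T) = T"
    using M(2) unfolding nondegenerate_def by (intro bchoice) metis
  then obtain p where p: "\<And>T. T \<in> M \<Longrightarrow> tri_det (p T) \<noteq> 0" "\<And>T. T \<in> M \<Longrightarrow> tri (p T) = T"
    by blast
  define h where "h T x = (\<Sum>i\<in>UNIV. of_bool (p T i = z) * bary (p T) i x)" for T x
  define \<phi> where "\<phi> x = h (SOME T. T \<in> M \<and> x \<in> T) x" for x
  have eq: "\<phi> x = h T x" if "T \<in> M" "x \<in> T" for T x
  proof -
    define S where "S = (SOME T. T \<in> M \<and> x \<in> T)"
    have S: "S \<in> M" "x \<in> S"
      using someI[of "\<lambda>T. T \<in> M \<and> x \<in> T" T] that by (auto simp: S_def)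
    have "(T \<inter> S) face_of T" "(T \<inter> S) face_of S"
      using M(1) S(1) that(1) unfolding triangulation_def by (metis Int_commute)+
    then have "h T x = h S x"
      unfolding h_def using p[OF S(1)] p[OF that(1)] S(2) that(2)
      by (intro bary_agree_on_common_face) auto
    then show ?thesis
      by (simp add: \<phi>_def S_def)
  qed
  have val: "\<phi> y = of_bool (y = z)" if y: "y \<in> nodes M" for y
  proof -
    obtain T where T: "T \<in> M" "y \<in> vertices T"
      using y by (auto simp: nodes_def)
    then obtain j where j: "y = p T j"
      using vertices_tri[OF p(1)[OF T(1)]] p(2)[OF T(1)] by auto
    have "y \<in> T"
      using tri_vertex_in[of "p T" j] p(2)[OF T(1)] j by simp
    then have "\<phi> y = (\<Sum>i\<in>UNIV. if i = j then of_bool (p T i = z) else 0)"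
      unfolding eq[OF T(1) \<open>y \<in> T\<close>] h_def
      by (intro sum.cong refl) (simp add: j bary_at_vertex[OF p(1)[OF T(1)]])
    then show ?thesis
      by (simp add: j)
  qed
  have "\<phi> \<in> P1_space M"
  proof (rule P1_spaceI[OF M(2)])
    fix T assume T: "T \<in> M"
    show "\<exists>g c. \<forall>x\<in>T. \<phi> x = g \<bullet> x + c"
      using sum_bary_is_affine[of "\<lambda>i. of_bool (p T i = z)" "p T"] eq[OF T] unfolding h_def by metis
  qed
  then show ?thesis
    using val z unfolding nodal_def by (intro exI[of _ \<phi>]) auto
qed

section \<open>Nodal bases of refined meshes\<close>

lemma bary_on_tri_bounds:
  assumes p: "tri_det p \<noteq> 0" and x: "x \<in> tri p"
  shows "0 \<le> bary p i x" "bary p 1 x + bary p 2 x + bary p 3 x = 1"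
  using assms sum_bary[OF p, of x] by (auto simp: tri_eq_bary sum_3)

lemma bary_on_corner:
  assumes p: "tri_det p \<noteq> 0" and x: "x \<in> tri (homothety (1/2) ((1/2) *\<^sub>R p i) \<circ> p)"
  shows "1/2 \<le> bary p i x"
proof -
  obtain y where y: "y \<in> tri p" "x = homothety (1/2) ((1/2) *\<^sub>R p i) y"
    using x by (auto simp: tri_homothety)
  have "2 * bary p i x = bary p i y + bary p i (p i)"
    by (simp add: y(2) bary_def homothety_def inner_diff_right inner_add_right)
  then show ?thesis
    using bary_on_tri_bounds(1)[OF p y(1), of i] p by (simp add: bary_at_vertex)
qed

lemma bary_on_middle:
  assumes p: "tri_det p \<noteq> 0" and x: "x \<in> tri (homothety (-1/2) ((1/2) *\<^sub>R (\<Sum>i\<in>UNIV. p i)) \<circ> p)"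
  shows "bary p i x \<le> 1/2"
proof -
  obtain y where y: "y \<in> tri p" "x = homothety (-1/2) ((1/2) *\<^sub>R (\<Sum>i\<in>UNIV. p i)) y"
    using x by (auto simp: tri_homothety)
  have "2 * bary p i x = (bary p i (p 1) + bary p i (p 2) + bary p i (p 3)) - bary p i y"
    by (simp add: y(2) bary_def homothety_def inner_diff_right inner_add_right sum_3)
  also have "bary p i (p 1) + bary p i (p 2) + bary p i (p 3) = 1"
    using exhaust_3[of i] p by (auto simp: bary_at_vertex)
  finally show ?thesis
    using bary_on_tri_bounds(1)[OF p y(1), of i] by simp
qed

text \<open>Hat functions of the refined mesh in terms of those of the coarse mesh: for an old node and for
  the midpoint of an old edge.\<close>

definition vertex_hat :: "real \<Rightarrow> real" where
  "vertex_hat a = max 0 (2 * a - 1)"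

definition midpoint_hat :: "real \<Rightarrow> real \<Rightarrow> real" where
  "midpoint_hat a b = max 0 (min (min (2 * a) (2 * b)) (2 * a + 2 * b - 1))"

text \<open>Relative to the parent, the kinks of \<open>vertex_hat\<close> and
  \<open>midpoint_hat\<close> lie on lines where a barycentric coordinate equals 1/2, and no child
  crosses such a line.\<close>

lemma affine_on_refined:
  assumes M: "nondegenerate M" and T: "T \<in> M" and t: "t \<in> refine_triangle T"
  obtains p where "tri_det p \<noteq> 0" "T = tri p" "t \<subseteq> T" "(\<exists>i. \<forall>x\<in>t. 1/2 \<le> bary p i x) \<or> (\<forall>i. \<forall>x\<in>t. bary p i x \<le> 1/2)"
proof -
  obtain p where p: "tri_det p \<noteq> 0" "T = tri p"
    using M T by (auto simp: nondegenerate_def)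
  have "t \<subseteq> T"
    using t tri_covered_by_refinement[OF p(1)] p(2) by blast
  moreover have "(\<exists>i. \<forall>x\<in>t. 1/2 \<le> bary p i x) \<or> (\<forall>i. \<forall>x\<in>t. bary p i x \<le> 1/2)"
    using t unfolding p(2) refine_triangle_tri[OF p(1)]
    using bary_on_corner[OF p(1)] bary_on_middle[OF p(1)] by blast
  ultimately show ?thesis
    using that p by blast
qed

lemma affine_cong:
  assumes "\<And>x. x \<in> t \<Longrightarrow> v x = w x" "\<exists>g c. \<forall>x\<in>t. w x = g \<bullet> x + c"
  shows "\<exists>g c. \<forall>x\<in>t. v x = g \<bullet> x + c"
  using assms by metis

lemma affine_lincomb:
  assumes "\<exists>g c. \<forall>x\<in>t. v x = g \<bullet> x + (c::real)" "\<exists>g c. \<forall>x\<in>t. w x = g \<bullet> x + (c::real)"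
  shows "\<exists>g c. \<forall>x\<in>t. a * v x + b * w x + d = g \<bullet> x + (c::real)"
proof -
  obtain g c g' c' where "\<forall>x\<in>t. v x = g \<bullet> x + c" "\<forall>x\<in>t. w x = g' \<bullet> x + c'"
    using assms by blast
  then have "\<forall>x\<in>t. a * v x + b * w x + d = (a *\<^sub>R g + b *\<^sub>R g') \<bullet> x + (a * c + b * c' + d)"
    by (simp add: inner_add_left algebra_simps)
  then show ?thesis
    by blast
qed

lemma affine_zero: "\<exists>g c. \<forall>x\<in>t. (0::real) = g \<bullet> x + c"
  by (rule exI[of _ 0], rule exI[of _ 0]) simp

lemma nodal_affine_on: "nodal M z \<phi> \<Longrightarrow> T \<in> M \<Longrightarrow> t \<subseteq> T \<Longrightarrow> \<exists>g c. \<forall>x\<in>t. \<phi> x = g \<bullet> x + c"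
  unfolding nodal_def P1_space_def by blast

lemma nodal_on_tri_cases:
  assumes \<phi>: "nodal M z \<phi>" and p: "tri_det p \<noteq> 0" "tri p \<in> M"
  shows "(\<exists>i. z = p i \<and> (\<forall>x\<in>tri p. \<phi> x = bary p i x)) \<or> (\<forall>x\<in>tri p. \<phi> x = 0)"
proof (cases "\<exists>i. z = p i")
  case True
  then obtain i where i: "z = p i" ..
  have "(\<Sum>j\<in>UNIV. of_bool (p j = z) * bary p j x) = (\<Sum>j\<in>UNIV. if j = i then bary p j x else 0)" for x
    using tri_det_imp_inj[OF p(1)] by (intro sum.cong refl) (auto simp: i inj_eq)
  then show ?thesis
    using nodal_on_tri[OF \<phi> p(2,1)] i by auto
next
  case False
  then have "\<phi> x = 0" if "x \<in> tri p" for x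
    using nodal_on_tri[OF \<phi> p(2,1) that] by (auto intro!: sum.neutral)
  then show ?thesis
    by blast
qed

text \<open>On the parent the coarse hat is 0 or a single barycentric coordinate. The new hat is
  \<open>2 * \<phi> x - 1\<close> on the corner child of that vertex and 0 on the other three; in a
  different corner another coordinate is at least 1/2, which leaves at most 1/2 for this
  one.\<close>

lemma vertex_hat_affine:
  assumes M: "nondegenerate M" and \<phi>: "nodal M z \<phi>" and t: "t \<in> refine M"
  shows "\<exists>g c. \<forall>x\<in>t. vertex_hat (\<phi> x) = g \<bullet> x + c"
proof -
  obtain T where T: "T \<in> M" "t \<in> refine_triangle T"
    using t by (auto simp: refine_def)
  obtain p where p: "tri_det p \<noteq> 0" "T = tri p" "t \<subseteq> T"
    and b: "(\<exists>i. \<forall>x\<in>t. 1/2 \<le> bary p i x) \<or> (\<forall>i. \<forall>x\<in>t. bary p i x \<le> 1/2)"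
    by (rule affine_on_refined[OF M T])
  note aff = nodal_affine_on[OF \<phi> T(1) p(3)]
  from nodal_on_tri_cases[OF \<phi> p(1)] T(1) p(2)
  consider i where "z = p i" "\<And>x. x \<in> T \<Longrightarrow> \<phi> x = bary p i x" | "\<And>x. x \<in> T \<Longrightarrow> \<phi> x = 0"
    by blast
  then show ?thesis
  proof cases
    case 1
    have "(\<forall>x\<in>t. 1/2 \<le> \<phi> x) \<or> (\<forall>x\<in>t. \<phi> x \<le> 1/2)"
      using b
    proof
      assume "\<exists>j. \<forall>x\<in>t. 1/2 \<le> bary p j x"
      then obtain j where j: "\<forall>x\<in>t. 1/2 \<le> bary p j x" ..
      show ?thesis
      proof (cases "j = i")
        case True
        have "1/2 \<le> \<phi> x" if "x \<in> t" for x
        proof -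
          have "x \<in> T" "1/2 \<le> bary p i x"
            using j p(3) that True by blast+
          then show ?thesis
            using 1(2) by simp
        qed
        then show ?thesis
          by blast
      next
        case False
        have "\<phi> x \<le> 1/2" if x: "x \<in> t" for x
        proof -
          have "x \<in> tri p"
            using x p by auto
          note bb = bary_on_tri_bounds[OF p(1) this]
          have "1/2 \<le> bary p j x"
            using j x by auto
          then have "bary p i x \<le> 1/2"
            using bb(2) bb(1)[of 1] bb(1)[of 2] bb(1)[of 3] False exhaust_3[of i] exhaust_3[of j]
            by (smt (verit) field_sum_of_halves)
          then show ?thesis
            using 1(2) x p(3) by auto
        qed
        then show ?thesis
          by blast
      qed
    next
      assume "\<forall>i. \<forall>x\<in>t. bary p i x \<le> 1/2"
      then have "\<phi> x \<le> 1/2" if "x \<in> t" for x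
        using 1(2)[of x] p(3) that by (metis subsetD)
      then show ?thesis
        by blast
    qed
    then show ?thesis
    proof
      assume "\<forall>x\<in>t. 1/2 \<le> \<phi> x"
      then show ?thesis
        by (intro affine_cong[OF _ affine_lincomb[OF aff aff, of 2 0 "-1"]]) (auto simp: vertex_hat_def)
    next
      assume "\<forall>x\<in>t. \<phi> x \<le> 1/2"
      then show ?thesis
        by (intro affine_cong[OF _ affine_zero]) (auto simp: vertex_hat_def)
    qed
  next
    case 2
    then show ?thesis
      using p(3) by (intro affine_cong[OF _ affine_zero]) (auto simp: vertex_hat_def)
  qed
qed

text \<open>If the two coarse hats are coordinates a and b on the parent and c is the third
  coordinate, the expression is 2b where a is at least 1/2, 2a where b is, 0 where c is, and 2a + 2b
  - 1 on the middle child. If one hat vanishes on the parent, so does the expression.\<close>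

lemma midpoint_hat_affine:
  assumes M: "nondegenerate M" and \<phi>: "nodal M z \<phi>" and \<psi>: "nodal M z' \<psi>" and neq: "z \<noteq> z'" and t: "t \<in> refine M"
  shows "\<exists>g c. \<forall>x\<in>t. midpoint_hat (\<phi> x) (\<psi> x) = g \<bullet> x + c"
proof -
  obtain T where T: "T \<in> M" "t \<in> refine_triangle T"
    using t by (auto simp: refine_def)
  obtain p where p: "tri_det p \<noteq> 0" "T = tri p" "t \<subseteq> T"
    and b: "(\<exists>i. \<forall>x\<in>t. 1/2 \<le> bary p i x) \<or> (\<forall>i. \<forall>x\<in>t. bary p i x \<le> 1/2)"
    by (rule affine_on_refined[OF M T])
  note aff = nodal_affine_on[OF \<phi> T(1) p(3)] nodal_affine_on[OF \<psi> T(1) p(3)]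
  have c: "(\<exists>i. z = p i \<and> (\<forall>x\<in>T. \<phi> x = bary p i x)) \<or> (\<forall>x\<in>T. \<phi> x = 0)"
    "(\<exists>i. z' = p i \<and> (\<forall>x\<in>T. \<psi> x = bary p i x)) \<or> (\<forall>x\<in>T. \<psi> x = 0)"
    using nodal_on_tri_cases[OF \<phi> p(1)] nodal_on_tri_cases[OF \<psi> p(1)] T(1) p(2) by blast+
  then consider i j where "i \<noteq> j" "\<forall>x\<in>T. \<phi> x = bary p i x" "\<forall>x\<in>T. \<psi> x = bary p j x"
    | "\<forall>x\<in>T. \<phi> x = 0" | "\<forall>x\<in>T. \<psi> x = 0"
    using neq by metis
  then show ?thesis
  proof cases
    case h: 1
    note 1 = h(1) h(2,3)[rule_format]
    obtain k where k: "k \<noteq> i" "k \<noteq> j"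
      using exhaust_3[of i] exhaust_3[of j] three_neq by metis
    have bb: "0 \<le> \<phi> x" "0 \<le> \<psi> x" "0 \<le> bary p k x" "\<phi> x + \<psi> x + bary p k x = 1" if x: "x \<in> t" for x
    proof -
      have x': "x \<in> T" "x \<in> tri p"
        using x p by auto
      show "0 \<le> \<phi> x" "0 \<le> \<psi> x" "0 \<le> bary p k x"
        using bary_on_tri_bounds(1)[OF p(1) x'(2)] 1(2,3)[OF x'(1)] by auto
      show "\<phi> x + \<psi> x + bary p k x = 1"
        using bary_on_tri_bounds(2)[OF p(1) x'(2)] 1(1) k exhaust_3[of i] exhaust_3[of j] exhaust_3[of k]
        unfolding 1(2,3)[OF x'(1)] by auto
    qed
    from b consider "\<And>x. x \<in> t \<Longrightarrow> 1/2 \<le> \<phi> x" | "\<And>x. x \<in> t \<Longrightarrow> 1/2 \<le> \<psi> x" | "\<And>x. x \<in> t \<Longrightarrow> 1/2 \<le> bary p k x"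
      | "\<And>x. x \<in> t \<Longrightarrow> \<phi> x \<le> 1/2 \<and> \<psi> x \<le> 1/2 \<and> bary p k x \<le> 1/2"
    proof (elim disjE exE)
      fix l assume l: "\<forall>x\<in>t. 1/2 \<le> bary p l x"
      have "l = i \<or> l = j \<or> l = k"
        using 1(1) k exhaust_3[of i] exhaust_3[of j] exhaust_3[of k] exhaust_3[of l] by metis
      then show thesis
        using l 1(2,3) p(3) that(1-3) by (metis subsetD)
    next
      assume l: "\<forall>i. \<forall>x\<in>t. bary p i x \<le> 1/2"
      show thesis
        using l 1(2,3) p(3) that(4) by (metis subsetD)
    qed
    then show ?thesis
    proof cases
      case 1
      have "midpoint_hat (\<phi> x) (\<psi> x) = 0 * \<phi> x + 2 * \<psi> x + 0" if "x \<in> t" for x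
        using bb[OF that] 1[OF that] by (auto simp: midpoint_hat_def)
      then show ?thesis
        by (rule affine_cong[OF _ affine_lincomb[OF aff]])
    next
      case 2
      have "midpoint_hat (\<phi> x) (\<psi> x) = 2 * \<phi> x + 0 * \<psi> x + 0" if "x \<in> t" for x
        using bb[OF that] 2[OF that] by (auto simp: midpoint_hat_def)
      then show ?thesis
        by (rule affine_cong[OF _ affine_lincomb[OF aff]])
    next
      case 3
      have "midpoint_hat (\<phi> x) (\<psi> x) = 0" if "x \<in> t" for x
        using bb[OF that] 3[OF that] by (auto simp: midpoint_hat_def)
      then show ?thesis
        by (rule affine_cong[OF _ affine_zero])
    next
      case 4
      have "midpoint_hat (\<phi> x) (\<psi> x) = 2 * \<phi> x + 2 * \<psi> x + -1" if "x \<in> t" for x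
        using bb[OF that] 4[OF that] by (auto simp: midpoint_hat_def)
      then show ?thesis
        by (rule affine_cong[OF _ affine_lincomb[OF aff]])
    qed
  next
    case 2
    then show ?thesis
      using p(3) by (intro affine_cong[OF _ affine_zero]) (auto simp: midpoint_hat_def)
  next
    case 3
    then show ?thesis
      using p(3) by (intro affine_cong[OF _ affine_zero]) (auto simp: midpoint_hat_def)
  qed
qed

lemma nondegenerate_refine: "nondegenerate M \<Longrightarrow> nondegenerate (refine M)"
  using nondegenerate_refined_mesh[of M 1] by (simp add: refined_mesh_def)

text \<open>\<open>a = b\<close> is allowed and accounts for the old nodes.\<close>

lemma nodes_refine:
  assumes M: "nondegenerate M" and z: "z \<in> nodes (refine M)"
  obtains T a b where "T \<in> M" "a \<in> vertices T" "b \<in> vertices T" "z = midpoint a b"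
proof -
  obtain T t where T: "T \<in> M" "t \<in> refine_triangle T" "z \<in> vertices t"
    using z by (auto simp: nodes_def refine_def)
  obtain p where p: "tri_det p \<noteq> 0" "T = tri p"
    using M T(1) by (auto simp: nondegenerate_def)
  have "vertices t \<subseteq> {x. \<exists>i j. x = midpoint (p i) (p j)}"
  proof -
    have d: "tri_det (homothety s w \<circ> p) \<noteq> 0" if "s \<noteq> 0" for s w
      using that p(1) by (simp add: tri_det_homothety)
    have c: "homothety (1/2) ((1/2) *\<^sub>R p i) (p j) = midpoint (p i) (p j)" for i j
      by (simp add: homothety_def midpoint_def scaleR_add_right add.commute)
    have "\<exists>j k. homothety (-1/2) ((1/2) *\<^sub>R (\<Sum>i\<in>UNIV. p i)) (p i) = midpoint (p j) (p k)" for i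
    proof -
      have "homothety (-1/2) ((1/2) *\<^sub>R (\<Sum>i\<in>UNIV. p i)) (p i) =
          (if i = 1 then midpoint (p 2) (p 3) else if i = 2 then midpoint (p 1) (p 3) else midpoint (p 1) (p 2))"
        using exhaust_3[of i] by (auto simp: homothety_def midpoint_def sum_3 vec_eq_iff field_simps)
      then show ?thesis
        by metis
    qed
    then show ?thesis
      using T(2) unfolding p(2) refine_triangle_tri[OF p(1)]
      by (auto simp: vertices_tri[OF d] c) blast
  qed
  then show ?thesis
    using that T p vertices_tri[OF p(1)] by blast
qed

text \<open>Coarse hats are linear on each parent, so at a new node they average two values from {0,
  1}. An average of 1 forces both end points to be the hat's node; both hats of an old edge being
  1/2 forces the end points of that edge. The two formulas are nonzero only then.\<close>

lemma nodal_exists_refine: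
  assumes M: "nondegenerate M" and ex: "\<And>z. z \<in> nodes M \<Longrightarrow> \<exists>\<phi>. nodal M z \<phi>"
    and z: "z \<in> nodes (refine M)"
  shows "\<exists>\<phi>. nodal (refine M) z \<phi>"
proof -
  obtain T a b where T: "T \<in> M" "a \<in> vertices T" "b \<in> vertices T" "z = midpoint a b"
    by (rule nodes_refine[OF M z])
  have nd: "a \<in> nodes M" "b \<in> nodes M"
    using T by (auto simp: nodes_def)
  obtain \<phi> \<psi> where \<phi>: "nodal M a \<phi>" and \<psi>: "nodal M b \<psi>"
    using ex nd by blast
  have mid: "u (midpoint c d) = (u c + u d) / 2" if u: "u \<in> P1_space M" and cd: "S \<in> M" "c \<in> vertices S" "d \<in> vertices S" for u c d S
  proof -
    obtain g e where ge: "\<And>x. x \<in> S \<Longrightarrow> u x = g \<bullet> x + e"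
      using u cd(1) unfolding P1_space_def by blast
    obtain p where p: "tri_det p \<noteq> 0" "S = tri p"
      using M cd(1) by (auto simp: nondegenerate_def)
    have S: "c \<in> S" "d \<in> S"
      using cd vertices_tri[OF p(1)] tri_vertex_in[of p] p(2) by auto
    then have "midpoint c d \<in> S"
      using closed_segment_subset[OF S convex_tri[of p, folded p(2)]] by auto
    then show ?thesis
      using S by (simp add: ge midpoint_def inner_add_right)
  qed
  have val: "u c \<in> {0, 1} \<and> (u c = 1 \<longleftrightarrow> c = w)" if "nodal M w u" "c \<in> nodes M" for u w c
    using that by (cases "c = w") (auto simp: nodal_def)
  have P1: "\<phi> \<in> P1_space M" "\<psi> \<in> P1_space M"
    using \<phi> \<psi> by (auto simp: nodal_def)
  show ?thesis
  proof (cases "a = b")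
    case True
    then have za: "z = a"
      using T(4) by simp
    have "nodal (refine M) z (\<lambda>x. vertex_hat (\<phi> x))"
      unfolding nodal_def
    proof (intro conjI ballI)
      show "(\<lambda>x. vertex_hat (\<phi> x)) \<in> P1_space (refine M)"
        using M \<phi> by (intro P1_spaceI nondegenerate_refine vertex_hat_affine)
      show "vertex_hat (\<phi> z) = 1"
        using \<phi> by (simp add: za nodal_def vertex_hat_def)
      fix y assume y: "y \<in> nodes (refine M) - {z}"
      then obtain S c d where S: "S \<in> M" "c \<in> vertices S" "d \<in> vertices S" "y = midpoint c d"
        using nodes_refine[OF M] by blast
      have "c \<in> nodes M" "d \<in> nodes M"
        using S by (auto simp: nodes_def)
      then have "\<phi> c \<in> {0, 1} \<and> (\<phi> c = 1 \<longleftrightarrow> c = a)" "\<phi> d \<in> {0, 1} \<and> (\<phi> d = 1 \<longleftrightarrow> d = a)"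
        using val[OF \<phi>] by blast+
      moreover have "\<not> (c = a \<and> d = a)"
        using y S(4) za by auto
      ultimately show "vertex_hat (\<phi> y) = 0"
        using mid[OF P1(1) S(1-3)] S(4) by (auto simp: vertex_hat_def)
    qed
    then show ?thesis
      by (rule exI[of _ "\<lambda>x. vertex_hat (\<phi> x)"])
  next
    case False
    have "nodal (refine M) z (\<lambda>x. midpoint_hat (\<phi> x) (\<psi> x))"
      unfolding nodal_def
    proof (intro conjI ballI)
      show "(\<lambda>x. midpoint_hat (\<phi> x) (\<psi> x)) \<in> P1_space (refine M)"
        using M \<phi> \<psi> False by (intro P1_spaceI nondegenerate_refine midpoint_hat_affine)
      have "\<phi> z = 1/2" "\<psi> z = 1/2"
        using mid[OF P1(1) T(1-3)] mid[OF P1(2) T(1-3)] \<phi> \<psi> nd False T(4) by (auto simp: nodal_def)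
      then show "midpoint_hat (\<phi> z) (\<psi> z) = 1"
        by (simp add: midpoint_hat_def)
      fix y assume y: "y \<in> nodes (refine M) - {z}"
      then obtain S c d where S: "S \<in> M" "c \<in> vertices S" "d \<in> vertices S" "y = midpoint c d"
        using nodes_refine[OF M] by blast
      have "c \<in> nodes M" "d \<in> nodes M"
        using S by (auto simp: nodes_def)
      then have "\<phi> c \<in> {0, 1} \<and> (\<phi> c = 1 \<longleftrightarrow> c = a)" "\<phi> d \<in> {0, 1} \<and> (\<phi> d = 1 \<longleftrightarrow> d = a)"
        "\<psi> c \<in> {0, 1} \<and> (\<psi> c = 1 \<longleftrightarrow> c = b)" "\<psi> d \<in> {0, 1} \<and> (\<psi> d = 1 \<longleftrightarrow> d = b)"
        using val[OF \<phi>] val[OF \<psi>] by blast+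
      moreover have "\<not> (c = a \<and> d = b)" "\<not> (c = b \<and> d = a)"
        using y S(4) T(4) by (auto simp: midpoint_sym)
      ultimately show "midpoint_hat (\<phi> y) (\<psi> y) = 0"
        using mid[OF P1(1) S(1-3)] mid[OF P1(2) S(1-3)] S(4) False by (auto simp: midpoint_hat_def)
    qed
    then show ?thesis
      by (rule exI[of _ "\<lambda>x. midpoint_hat (\<phi> x) (\<psi> x)"])
  qed
qed

lemma nodal_basis_nodal:
  assumes "triangulation M" "nondegenerate M" "z \<in> nodes (refined_mesh M n)"
  shows "nodal (refined_mesh M n) z (nodal_basis (refined_mesh M n) z)"
proof -
  have "\<exists>\<phi>. nodal (refined_mesh M n) z \<phi>" if "z \<in> nodes (refined_mesh M n)" for z
    using that
  proof (induction n arbitrary: z)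
    case 0
    then show ?case
      using nodal_exists_triangulation[OF assms(1,2)] by (simp add: refined_mesh_0)
  next
    case (Suc n)
    then show ?case
      using nodal_exists_refine[OF nondegenerate_refined_mesh[OF assms(2)]] by (simp add: refined_mesh_Suc)
  qed
  from someI_ex[OF this[OF assms(3)]] show ?thesis
    by (simp add: nodal_basis_def nodal_def)
qed

section \<open>Stiffness matrices and element energies\<close>

text \<open>The Laplacian stiffness entry in closed form, both gradients being constant;
  \<open>local_stiffness_eq\<close> ties it to the integral definition.\<close>

definition stiffness :: "(3 \<Rightarrow> pt) \<Rightarrow> 3 \<Rightarrow> 3 \<Rightarrow> real" where
  "stiffness p i j = measure lebesgue (tri p) * (bary_grad p i \<bullet> bary_grad p j)"

text \<open>The area gains the square of \<open>s\<close> and each of the two gradients loses one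
  factor \<open>s\<close>, for negative \<open>s\<close> as well.\<close>

lemma stiffness_homothety: "s \<noteq> 0 \<Longrightarrow> stiffness (homothety s w \<circ> p) i j = stiffness p i j"
  by (simp add: stiffness_def measure_tri_homothety bary_grad_homothety power2_eq_square)

lemma grad_affine_interior:
  fixes u :: "pt \<Rightarrow> real"
  assumes "x \<in> interior t" "\<And>y. y \<in> t \<Longrightarrow> u y = g \<bullet> y + c"
  shows "grad u x = g"
proof (rule grad_eqI, unfold gderiv_def, rule has_derivative_transform_within_open)
  show "((\<lambda>y. g \<bullet> y + c) has_derivative (\<lambda>h. h \<bullet> g)) (at x)"
    using GDERIV_affine by (simp add: gderiv_def)
  show "open (interior t)" "x \<in> interior t"
    using assms(1) by auto
  show "g \<bullet> y + c = u y" if "y \<in> interior t" for y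
    using that assms(2) interior_subset by force
qed

text \<open>\<open>grad\<close> is controlled only in the interiors of the fine elements. Their
  frontiers are null sets because the elements are convex, and almost every point is counted
  once.\<close>

lemma grad_product_refined:
  assumes p: "tri_det p \<noteq> 0"
    and u: "\<And>t x. t \<in> refined_mesh {tri p} n \<Longrightarrow> x \<in> t \<Longrightarrow> u x = gu t \<bullet> x + cu t"
    and v: "\<And>t x. t \<in> refined_mesh {tri p} n \<Longrightarrow> x \<in> t \<Longrightarrow> v x = gv t \<bullet> x + cv t"
  shows "grad_product (tri p) u v = (\<Sum>t\<in>refined_mesh {tri p} n. measure lebesgue t * (gu t \<bullet> gv t))"
proof -
  let ?R = "refined_mesh {tri p} n"
  let ?F = "\<lambda>x. indicator (tri p) x *\<^sub>R (grad u x \<bullet> grad v x)"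
  let ?G = "\<lambda>x. \<Sum>t\<in>?R. indicator t x * (gu t \<bullet> gv t)"
  have T: "tri p \<in> sets lebesgue"
    using lmeasurable_tri by (rule fmeasurableD)
  have fin: "finite ?R"
    using p by (rule refined_mesh_finite_card)
  have sub: "t \<subseteq> tri p" if "t \<in> ?R" for t
    using refined_mesh_cover[OF p, of n] that by blast
  have ind: "integrable lebesgue (\<lambda>x. indicator t x :: real)" if "t \<in> ?R" for t
    using lmeasurable_refined[OF p that] by (simp only: lmeasurable_iff_integrable[symmetric])
  have intG: "integrable lebesgue ?G"
    using ind by (intro Bochner_Integration.integrable_sum integrable_mult_left)
  have "AE x in lebesgue. \<forall>t\<in>?R. x \<notin> frontier t"
  proof (rule AE_ball_countable[THEN iffD2, OF countable_finite[OF fin]], rule ballI)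
    fix t assume "t \<in> ?R"
    then have "convex t"
      using refined_mesh_tri[OF p] convex_tri by metis
    then show "AE x in lebesgue. x \<notin> frontier t"
      using negligible_convex_frontier by (intro AE_not_in) (simp add: negligible_iff_null_sets)
  qed
  moreover have "AE x in lebesgue. x \<in> tri p \<longrightarrow> (\<Sum>t\<in>?R. indicator t x) = (1::real)"
    using refined_mesh_partition_AE[OF p, of n] T by (subst (asm) AE_restrict_space_iff) auto
  ultimately have ae: "AE x in lebesgue. ?G x = ?F x"
  proof eventually_elim
    case (elim x)
    show ?case
    proof (cases "x \<in> tri p")
      case True
      have "indicator t x * (gu t \<bullet> gv t) = indicator t x * (grad u x \<bullet> grad v x)" if t: "t \<in> ?R" for t
      proof (cases "x \<in> t")
        case True
        then have "x \<in> interior t"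
          using elim(1) t closure_subset[of t] by (auto simp: frontier_def)
        then show ?thesis
          using grad_affine_interior[of x t u] grad_affine_interior[of x t v] u[OF t] v[OF t] by metis
      qed simp
      then have "?G x = (\<Sum>t\<in>?R. indicator t x) * (grad u x \<bullet> grad v x)"
        unfolding sum_distrib_right by (rule sum.cong[OF refl])
      then show ?thesis
        using True elim(2) by simp
    next
      case False
      then have "indicator t x * (gu t \<bullet> gv t) = 0" if "t \<in> ?R" for t
        using sub[OF that] by (auto simp: indicator_def)
      then have "?G x = 0"
        by (intro sum.neutral ballI)
      then show ?thesis
        using False by simp
    qed
  qed
  have mG: "?G \<in> borel_measurable lebesgue"
    using intG by (rule borel_measurable_integrable)
  have "grad_product (tri p) u v = (LINT x|lebesgue. ?F x)"
    unfolding grad_product_def using T by (intro integral_restrict_space) simp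
  also have "\<dots> = (LINT x|lebesgue. ?G x)"
    \<comment> \<open>Measurability of the gradient product is inherited from the step function
      \<open>?G\<close>, Lebesgue measure being complete.\<close>
    using integral_cong_AE[OF mG borel_measurable_AE[OF mG ae] ae] by simp
  also have "\<dots> = (\<Sum>t\<in>?R. measure lebesgue t * (gu t \<bullet> gv t))"
    using ind by (subst Bochner_Integration.integral_sum) (auto simp: lmeasure_integral_UNIV)
  finally show ?thesis .
qed

text \<open>Fixes one enumeration of the vertices per fine element, in the order inherited from
  \<open>p\<close>, so that an index stands for the same angle in all of them.\<close>

lemma refined_mesh_vertices:
  assumes "tri_det p \<noteq> 0"
  obtains q where "\<And>t. t \<in> refined_mesh {tri p} n \<Longrightarrow> tri (q t) = t"
    "\<And>t. t \<in> refined_mesh {tri p} n \<Longrightarrow> tri_det (q t) \<noteq> 0"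
    "\<And>t. t \<in> refined_mesh {tri p} n \<Longrightarrow> \<exists>s w. s \<noteq> 0 \<and> q t = homothety s w \<circ> p"
proof -
  have "\<forall>t\<in>refined_mesh {tri p} n. \<exists>q. tri q = t \<and> tri_det q \<noteq> 0 \<and> (\<exists>s w. s \<noteq> 0 \<and> q = homothety s w \<circ> p)"
    using refined_mesh_tri[OF assms] by metis
  from bchoice[OF this] show ?thesis
    using that by blast
qed

lemma affine_from_vertices:
  assumes "tri_det q \<noteq> 0" "\<And>x. x \<in> tri q \<Longrightarrow> u x = (\<Sum>i\<in>UNIV. a i * bary q i x)" "x \<in> tri q"
  shows "u x = (\<Sum>i\<in>UNIV. a i *\<^sub>R bary_grad q i) \<bullet> x + (\<Sum>i\<in>UNIV. a i * bary q i 0)"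
proof -
  have "a i * bary q i x = (a i *\<^sub>R bary_grad q i) \<bullet> x + a i * bary q i 0" for i
    by (subst bary_affine) (simp add: distrib_left)
  then show ?thesis
    using assms(2,3) by (simp add: inner_sum_left sum.distrib)
qed

lemma inner_sum_bary_grad:
  "measure lebesgue (tri q) * ((\<Sum>i\<in>UNIV. a i *\<^sub>R bary_grad q i) \<bullet> (\<Sum>i\<in>UNIV. b i *\<^sub>R bary_grad q i))
    = (\<Sum>i\<in>UNIV. \<Sum>j\<in>UNIV. a i * b j * stiffness q i j)"
  by (subst sum.swap) (simp add: stiffness_def inner_sum_left inner_sum_right sum_distrib_left mult_ac)

lemma refined_mesh_subset: "T \<in> M \<Longrightarrow> refined_mesh {T} n \<subseteq> refined_mesh M n"
  unfolding refined_mesh_UN[of M] by blast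

text \<open>The \<open>of_bool\<close> factors translate global nodes into local indices. For nodes
  outside the macro element they are all 0, so no case distinction on the position of
  \<open>x\<close> and \<open>y\<close> arises.\<close>

lemma grad_product_nodal_basis:
  assumes M: "triangulation M" "nondegenerate M" and p: "tri_det p \<noteq> 0" "tri p \<in> M"
    and q: "\<And>t. t \<in> refined_mesh {tri p} n \<Longrightarrow> tri (q t) = t"
    "\<And>t. t \<in> refined_mesh {tri p} n \<Longrightarrow> tri_det (q t) \<noteq> 0"
    "\<And>t. t \<in> refined_mesh {tri p} n \<Longrightarrow> \<exists>s w. s \<noteq> 0 \<and> q t = homothety s w \<circ> p"
    and xy: "x \<in> nodes (refined_mesh M n)" "y \<in> nodes (refined_mesh M n)"
  shows "grad_product (tri p) (nodal_basis (refined_mesh M n) x) (nodal_basis (refined_mesh M n) y)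
    = (\<Sum>t\<in>refined_mesh {tri p} n. \<Sum>i\<in>UNIV. \<Sum>j\<in>UNIV.
        of_bool (q t i = x) * of_bool (q t j = y) * stiffness p i j)"
proof -
  let ?N = "refined_mesh M n" and ?R = "refined_mesh {tri p} n"
  have aff: "nodal_basis ?N z \<xi> = (\<Sum>i\<in>UNIV. of_bool (q t i = z) *\<^sub>R bary_grad (q t) i) \<bullet> \<xi>
      + (\<Sum>i\<in>UNIV. of_bool (q t i = z) * bary (q t) i 0)"
    if z: "z \<in> nodes ?N" and t: "t \<in> ?R" and \<xi>: "\<xi> \<in> t" for z t \<xi>
  proof (rule affine_from_vertices[OF q(2)[OF t]])
    show "nodal_basis ?N z x = (\<Sum>i\<in>UNIV. of_bool (q t i = z) * bary (q t) i x)" if "x \<in> tri (q t)" for x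
      using nodal_basis_nodal[OF M z] _ q(2)[OF t] that
      by (rule nodal_on_tri) (use refined_mesh_subset[OF p(2)] t q(1)[OF t] in auto)
    show "\<xi> \<in> tri (q t)"
      using \<xi> q(1)[OF t] by simp
  qed
  have "grad_product (tri p) (nodal_basis ?N x) (nodal_basis ?N y)
      = (\<Sum>t\<in>?R. measure lebesgue t * ((\<Sum>i\<in>UNIV. of_bool (q t i = x) *\<^sub>R bary_grad (q t) i)
          \<bullet> (\<Sum>i\<in>UNIV. of_bool (q t i = y) *\<^sub>R bary_grad (q t) i)))"
    using aff[OF xy(1)] aff[OF xy(2)] by (rule grad_product_refined[OF p(1)])
  also have "\<dots> = (\<Sum>t\<in>?R. \<Sum>i\<in>UNIV. \<Sum>j\<in>UNIV.
        of_bool (q t i = x) * of_bool (q t j = y) * stiffness p i j)"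
  proof (rule sum.cong[OF refl])
    fix t assume t: "t \<in> ?R"
    have "stiffness (q t) i j = stiffness p i j" for i j
      using q(3)[OF t] stiffness_homothety by auto
    then show "measure lebesgue t * ((\<Sum>i\<in>UNIV. of_bool (q t i = x) *\<^sub>R bary_grad (q t) i)
          \<bullet> (\<Sum>i\<in>UNIV. of_bool (q t i = y) *\<^sub>R bary_grad (q t) i))
      = (\<Sum>i\<in>UNIV. \<Sum>j\<in>UNIV. of_bool (q t i = x) * of_bool (q t j = y) * stiffness p i j)"
      using inner_sum_bary_grad[of "q t" "\<lambda>i. of_bool (q t i = x)" "\<lambda>i. of_bool (q t i = y)"] q(1)[OF t]
      by simp
  qed
  finally show ?thesis .
qed

text \<open>Assembly in reverse: the double sum over global nodes collapses to local index
  pairs.\<close>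

lemma sum_pairs_of_bool:
  fixes F :: "'a \<Rightarrow> 'a \<Rightarrow> real"
  assumes A: "finite A" "\<And>i. q i \<in> A"
  shows "(\<Sum>x\<in>A. \<Sum>y\<in>A. F x y * (\<Sum>i\<in>UNIV. \<Sum>j\<in>UNIV. of_bool (q i = x) * of_bool (q j = y) * S i j))
    = (\<Sum>i\<in>(UNIV :: 3 set). \<Sum>j\<in>(UNIV :: 3 set). F (q i) (q j) * S i j)"
proof -
  have 1: "(\<Sum>x\<in>A. \<Sum>y\<in>A. F x y * (of_bool (q i = x) * of_bool (q j = y) * S i j)) = F (q i) (q j) * S i j" for i j
  proof -
    have y: "(\<Sum>y\<in>A. F x y * (of_bool (q i = x) * of_bool (q j = y) * S i j))
        = (if x = q i then F (q i) (q j) * S i j else 0)" for x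
    proof -
      have "(\<Sum>y\<in>A. F x y * (of_bool (q i = x) * of_bool (q j = y) * S i j))
          = (\<Sum>y\<in>A. if y = q j then F x (q j) * of_bool (q i = x) * S i j else 0)"
        by (intro sum.cong refl) auto
      then show ?thesis
        using A(1) A(2)[of j] by simp
    qed
    show ?thesis
      unfolding y using A(1) A(2)[of i] by simp
  qed
  have "(\<Sum>x\<in>A. \<Sum>y\<in>A. F x y * (\<Sum>i\<in>UNIV. \<Sum>j\<in>UNIV. of_bool (q i = x) * of_bool (q j = y) * S i j))
      = (\<Sum>i\<in>UNIV. \<Sum>j\<in>UNIV. \<Sum>x\<in>A. \<Sum>y\<in>A. F x y * (of_bool (q i = x) * of_bool (q j = y) * S i j))"
    unfolding sum_3 distrib_left sum.distrib ..
  then show ?thesis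
    unfolding 1 .
qed

text \<open>The minus sign comes from multiplying a difference by its reverse in
  \<open>scaled_form\<close>, the factor 1/2 from counting ordered pairs; diagonal terms
  vanish.\<close>

definition element_energy :: "(3 \<Rightarrow> pt) \<Rightarrow> (3 \<Rightarrow> 3 \<Rightarrow> real) \<Rightarrow> (3 \<Rightarrow> real) \<Rightarrow> real" where
  "element_energy p \<kappa> z = - (1/2) * (\<Sum>i\<in>UNIV. \<Sum>j\<in>UNIV. \<kappa> i j * (z i - z j)\<^sup>2 * stiffness p i j)"

text \<open>Terms with \<open>y = x\<close> are 0 and may be added, after which the sums over nodes
  and over elements can be swapped. The factor 2 cancels the 1/2 in front of
  \<open>scaled_form\<close>.\<close>

lemma scaled_form_eq_element_energies:
  assumes M: "triangulation M" "nondegenerate M" and p: "tri_det p \<noteq> 0" "tri p \<in> M"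
    and q: "\<And>t. t \<in> refined_mesh {tri p} n \<Longrightarrow> tri (q t) = t"
    "\<And>t. t \<in> refined_mesh {tri p} n \<Longrightarrow> tri_det (q t) \<noteq> 0"
    "\<And>t. t \<in> refined_mesh {tri p} n \<Longrightarrow> \<exists>s w. s \<noteq> 0 \<and> q t = homothety s w \<circ> p"
  shows "(\<Sum>x\<in>nodes (refined_mesh M n). \<Sum>y\<in>nodes (refined_mesh M n) - {x}.
      \<kappa> x y * (v x - v y) * (v y - v x)
        * grad_product (tri p) (nodal_basis (refined_mesh M n) x) (nodal_basis (refined_mesh M n) y))
    = 2 * (\<Sum>t\<in>refined_mesh {tri p} n. element_energy p (\<lambda>i j. \<kappa> (q t i) (q t j)) (\<lambda>i. v (q t i)))"
proof -
  let ?N = "refined_mesh M n" and ?R = "refined_mesh {tri p} n"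
  let ?A = "nodes ?N"
  let ?F = "\<lambda>x y. \<kappa> x y * (v x - v y) * (v y - v x)"
  let ?B = "\<lambda>t x y. \<Sum>i\<in>UNIV. \<Sum>j\<in>UNIV. of_bool (q t i = x) * of_bool (q t j = y) * stiffness p i j"
  have A: "finite ?A"
    using nondegenerate_refined_mesh[OF M(2)] by (rule finite_nodes)
  have qA: "q t i \<in> ?A" if t: "t \<in> ?R" for t i
    using tri_vertex_in_nodes[of "q t" ?N i] q(1,2)[OF t] refined_mesh_subset[OF p(2)] t by auto
  have "(\<Sum>x\<in>?A. \<Sum>y\<in>?A - {x}. ?F x y * grad_product (tri p) (nodal_basis ?N x) (nodal_basis ?N y))
      = (\<Sum>x\<in>?A. \<Sum>y\<in>?A. ?F x y * grad_product (tri p) (nodal_basis ?N x) (nodal_basis ?N y))"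
    using A by (intro sum.cong refl sum.mono_neutral_left) auto
  also have "\<dots> = (\<Sum>x\<in>?A. \<Sum>y\<in>?A. \<Sum>t\<in>?R. ?F x y * ?B t x y)"
    by (intro sum.cong refl) (simp add: grad_product_nodal_basis[OF M p q] sum_distrib_left)
  also have "\<dots> = (\<Sum>x\<in>?A. \<Sum>t\<in>?R. \<Sum>y\<in>?A. ?F x y * ?B t x y)"
    by (intro sum.cong refl sum.swap)
  also have "\<dots> = (\<Sum>t\<in>?R. \<Sum>x\<in>?A. \<Sum>y\<in>?A. ?F x y * ?B t x y)"
    by (rule sum.swap)
  also have "\<dots> = (\<Sum>t\<in>?R. \<Sum>i\<in>UNIV. \<Sum>j\<in>UNIV. ?F (q t i) (q t j) * stiffness p i j)"
    by (intro sum.cong refl sum_pairs_of_bool A qA)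
  also have "\<dots> = 2 * (\<Sum>t\<in>?R. element_energy p (\<lambda>i j. \<kappa> (q t i) (q t j)) (\<lambda>i. v (q t i)))"
    by (simp add: element_energy_def sum_distrib_left sum_negf[symmetric] power2_eq_square algebra_simps)
  finally show ?thesis .
qed

section \<open>Dirichlet energy and signs of the stiffness entries on one triangle\<close>

lemma stiffness_commute: "stiffness p i j = stiffness p j i"
  by (simp add: stiffness_def inner_commute)

lemma sum_stiffness: "(\<Sum>j\<in>UNIV. stiffness p i j) = 0"
  using sum_bary_grad[of p] by (simp add: stiffness_def sum_distrib_left[symmetric] inner_sum_right[symmetric])

text \<open>The points with strictly positive coordinates form an open subset containing the
  barycentre.\<close>

lemma measure_tri_pos:
  assumes p: "tri_det p \<noteq> 0"
  shows "0 < measure lebesgue (tri p)"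
proof (rule ccontr)
  assume "\<not> 0 < measure lebesgue (tri p)"
  then have "measure lebesgue (tri p) = 0"
    using measure_nonneg[of lebesgue "tri p"] by linarith
  then have neg: "negligible (tri p)"
    using lmeasurable_tri[of p] by (simp add: negligible_iff_measure0)
  define S where "S = {x. \<forall>i. 0 < bary p i x}"
  have "S = (\<Inter>i. {x. 0 < bary p i x})"
    by (auto simp: S_def)
  moreover have "open {x. 0 < bary p i x}" for i
    by (intro open_Collect_less) (auto simp: bary_def intro!: continuous_intros)
  ultimately have "open S"
    by auto
  moreover have "(1/3) *\<^sub>R (\<Sum>i\<in>UNIV. p i) \<in> S"
  proof -
    have "bary p i ((1/3) *\<^sub>R (\<Sum>j\<in>UNIV. p j)) = 1/3 * (\<Sum>j\<in>UNIV. bary p i (p j))" for i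
      by (simp add: bary_def sum_3 inner_diff_right inner_add_right)
    then have "bary p i ((1/3) *\<^sub>R (\<Sum>j\<in>UNIV. p j)) = 1/3" for i
      unfolding bary_at_vertex[OF p] by simp
    then have "0 < bary p i ((1/3) *\<^sub>R (\<Sum>j\<in>UNIV. p j))" for i
      by (metis zero_less_divide_iff zero_less_one zero_less_numeral)
    then show ?thesis
      unfolding S_def by blast
  qed
  moreover have "S \<subseteq> tri p"
    using p by (auto simp: S_def tri_eq_bary intro: less_imp_le)
  ultimately show False
    using neg open_not_negligible negligible_subset by blast
qed

text \<open>For a nondegenerate triangle, the Dirichlet energy of the linear function with vertex
  values \<open>z\<close>.\<close>

definition quad_form :: "(3 \<Rightarrow> pt) \<Rightarrow> (3 \<Rightarrow> real) \<Rightarrow> real" where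
  "quad_form p z = (\<Sum>i\<in>UNIV. \<Sum>j\<in>UNIV. z i * z j * stiffness p i j)"

lemma quad_form_eq_norm: "quad_form p z = measure lebesgue (tri p) * (norm (\<Sum>i\<in>UNIV. z i *\<^sub>R bary_grad p i))\<^sup>2"
  unfolding quad_form_def inner_sum_bary_grad[symmetric] by (simp add: power2_norm_eq_inner)

text \<open>Zero row sums eliminate the diagonal. The result has the shape of an element energy with
  all coefficients 1, which makes the two comparable term by term.\<close>

lemma quad_form_eq_differences:
  "quad_form p z = - (stiffness p 1 2 * (z 1 - z 2)\<^sup>2 + stiffness p 1 3 * (z 1 - z 3)\<^sup>2 + stiffness p 2 3 * (z 2 - z 3)\<^sup>2)"
proof -
  have d: "stiffness p 1 1 = - stiffness p 1 2 - stiffness p 1 3"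
    "stiffness p 2 2 = - stiffness p 1 2 - stiffness p 2 3"
    "stiffness p 3 3 = - stiffness p 1 3 - stiffness p 2 3"
    using sum_stiffness[of p 1] sum_stiffness[of p 2] sum_stiffness[of p 3]
      stiffness_commute[of p 2 1] stiffness_commute[of p 3 1] stiffness_commute[of p 3 2]
    by (simp_all add: sum_3)
  show ?thesis
    unfolding quad_form_def sum_3 d stiffness_commute[of p 2 1] stiffness_commute[of p 3 1] stiffness_commute[of p 3 2]
    by (simp add: power2_eq_square algebra_simps)
qed

lemma quad_form_nonneg: "0 \<le> quad_form p z"
  by (simp add: quad_form_eq_norm)

lemma quad_form_eq_0:
  assumes p: "tri_det p \<noteq> 0" and z: "quad_form p z = 0"
  shows "z i = z j"
proof -
  have g: "(\<Sum>i\<in>UNIV. z i *\<^sub>R bary_grad p i) = 0"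
    using z measure_tri_pos[OF p] by (simp add: quad_form_eq_norm)
  have "z i = z 3" for i
  proof -
    have "(\<Sum>j\<in>UNIV. z j * (bary p j (p i) - bary p j (p 3))) = (\<Sum>j\<in>UNIV. z j *\<^sub>R bary_grad p j) \<bullet> (p i - p 3)"
      by (simp add: bary_def inner_sum_left inner_diff_right right_diff_distrib sum_subtractf)
    then have "(\<Sum>j\<in>UNIV. z j * bary p j (p i)) = (\<Sum>j\<in>UNIV. z j * bary p j (p 3))"
      by (simp add: g right_diff_distrib sum_subtractf)
    then show ?thesis
      unfolding bary_at_vertex[OF p] sum_3 using exhaust_3[of i] by auto
  qed
  then show ?thesis
    by metis
qed

text \<open>Gradients are rotated sides, so an off-diagonal entry is minus the inner product of the
  two sides meeting at the remaining vertex, up to a square. Its sign thus tells whether the angle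
  there is obtuse.\<close>

lemma bary_grad_inner:
  "bary_grad p 1 \<bullet> bary_grad p 2 = - ((p 1 - p 3) \<bullet> (p 2 - p 3)) / (tri_det p)\<^sup>2"
  "bary_grad p 1 \<bullet> bary_grad p 3 = - ((p 1 - p 2) \<bullet> (p 3 - p 2)) / (tri_det p)\<^sup>2"
  "bary_grad p 2 \<bullet> bary_grad p 3 = - ((p 2 - p 1) \<bullet> (p 3 - p 1)) / (tri_det p)\<^sup>2"
  unfolding bary_grad_def inner_scaleR_left inner_scaleR_right
  by (simp_all add: inner_vec_def sum_2 power2_eq_square) (simp_all add: algebra_simps)

lemma vector_angle_gt_right:
  assumes "u \<noteq> 0" "w \<noteq> 0"
  shows "vector_angle u w > pi / 2 \<longleftrightarrow> u \<bullet> w < 0"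
proof -
  let ?r = "u \<bullet> w / (norm u * norm w)"
  have pos: "0 < norm u * norm w"
    using assms by simp
  have r: "- 1 \<le> ?r" "?r \<le> 1"
    using Cauchy_Schwarz_ineq2[of u w] pos by (auto simp: field_simps abs_le_iff)
  have "?r < 0 \<longleftrightarrow> u \<bullet> w < 0"
    using pos by (simp add: divide_less_0_iff)
  moreover have "arccos ?r > arccos 0 \<longleftrightarrow> ?r < 0"
    using r arccos_less_mono[of 0 ?r] by simp
  ultimately show ?thesis
    by (simp add: vector_angle_def)
qed

lemma local_nodes_tri:
  assumes p: "tri_det p \<noteq> 0"
  defines "l \<equiv> local_nodes (tri p)"
  shows "tri_det l \<noteq> 0" "tri l = tri p" "interior_angle l i \<le> interior_angle l 3"
proof -
  have "\<exists>i. \<forall>j. interior_angle p j \<le> interior_angle p i"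
  proof -
    have "Max (range (interior_angle p)) \<in> range (interior_angle p)"
      by (rule Max_in) auto
    then obtain i where i: "interior_angle p i = Max (range (interior_angle p))"
      by (metis rangeE)
    have "interior_angle p j \<le> interior_angle p i" for j
      unfolding i by (intro Max_ge) auto
    then show ?thesis
      by blast
  qed
  then obtain m where m: "\<And>j. interior_angle p j \<le> interior_angle p m"
    by blast
  \<comment> \<open>A witness for the choice in \<open>local_nodes\<close>. In the three-element
    index type 3 is zero, so local node 3 becomes the vertex \<open>m\<close> of largest angle, and
    \<open>interior_angle\<close> commutes with the cyclic shift.\<close>
  define q where "q j = p (j + m)" for j
  have bij: "bij (\<lambda>j::3. j + m)"
    by (rule bij_betw_byWitness[of _ "\<lambda>j. j - m"]) auto
  have "inj q"
    using inj_compose[OF tri_det_imp_inj[OF p] bij_is_inj[OF bij]] by (simp add: q_def[abs_def] o_def)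
  moreover have "range q = vertices (tri p)"
  proof -
    have "range q = p ` range (\<lambda>j. j + m)"
      unfolding q_def[abs_def] image_image ..
    also have "\<dots> = vertices (tri p)"
      by (simp only: bij_is_surj[OF bij] vertices_tri[OF p])
    finally show ?thesis .
  qed
  moreover have "interior_angle q j \<le> interior_angle q 3" for j
  proof -
    have a: "interior_angle q j = interior_angle p (j + m)" for j
      by (simp add: interior_angle_def q_def ac_simps)
    have "(3::3) + m = m"
      by simp
    then show ?thesis
      using m[of "j + m"] by (simp only: a)
  qed
  ultimately have "\<exists>q. inj q \<and> range q = vertices (tri p) \<and> (\<forall>j. interior_angle q j \<le> interior_angle q 3)"
    by blast
  then have l: "inj l \<and> range l = vertices (tri p) \<and> (\<forall>i. interior_angle l i \<le> interior_angle l 3)"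
    unfolding l_def local_nodes_def by (rule someI_ex)
  then have r: "range l = range p"
    by (simp add: vertices_tri[OF p])
  then show "tri_det l \<noteq> 0"
    using l p by (simp add: tri_det_neq_0_iff)
  show "tri l = tri p"
    using r by (simp add: tri_def)
  show "interior_angle l i \<le> interior_angle l 3"
    using l by blast
qed

lemma interior_angle_gt_right:
  assumes "tri_det p \<noteq> 0"
  shows "interior_angle p 1 > pi / 2 \<longleftrightarrow> (p 2 - p 1) \<bullet> (p 3 - p 1) < 0"
    "interior_angle p 2 > pi / 2 \<longleftrightarrow> (p 1 - p 2) \<bullet> (p 3 - p 2) < 0"
    "interior_angle p 3 > pi / 2 \<longleftrightarrow> (p 1 - p 3) \<bullet> (p 2 - p 3) < 0"
proof -
  have "p 1 \<noteq> p 2" "p 1 \<noteq> p 3" "p 2 \<noteq> p 3"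
    using tri_det_imp_inj[OF assms] by (auto simp: inj_eq)
  moreover have "(1::3) + 1 = 2" "(1::3) + 2 = 3" "(2::3) + 1 = 3" "(2::3) + 2 = 1" "(3::3) + 1 = 1" "(3::3) + 2 = 2"
    by simp_all
  ultimately show "interior_angle p 1 > pi / 2 \<longleftrightarrow> (p 2 - p 1) \<bullet> (p 3 - p 1) < 0"
    "interior_angle p 2 > pi / 2 \<longleftrightarrow> (p 1 - p 2) \<bullet> (p 3 - p 2) < 0"
    "interior_angle p 3 > pi / 2 \<longleftrightarrow> (p 1 - p 3) \<bullet> (p 2 - p 3) < 0"
    unfolding interior_angle_def by (simp_all only:) (subst vector_angle_gt_right; simp add: inner_commute)+
qed

text \<open>Only one angle can be obtuse: with u and w the sides from local node 3, the inner
  product at node 2 is w.w - u.w, and at node 1 it is u.u - u.w, both nonnegative when u.w is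
  negative.\<close>

lemma stiffness_obtuse:
  assumes p: "tri_det p \<noteq> 0"
  defines "l \<equiv> local_nodes (tri p)"
  assumes obt: "has_obtuse_angle (tri p)"
  shows "stiffness l 1 2 > 0" "stiffness l 1 3 \<le> 0" "stiffness l 2 3 \<le> 0"
proof -
  note l = local_nodes_tri[OF p, folded l_def]
  obtain i where "interior_angle l i > pi / 2"
    using obt by (auto simp: has_obtuse_angle_def l_def)
  then have "interior_angle l 3 > pi / 2"
    using l(3)[of i] by linarith
  then have n: "(l 1 - l 3) \<bullet> (l 2 - l 3) < 0"
    using interior_angle_gt_right(3)[OF l(1)] by simp
  have sq: "0 \<le> (l 1 - l 3) \<bullet> (l 1 - l 3)" "0 \<le> (l 2 - l 3) \<bullet> (l 2 - l 3)"
    by simp_all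
  have "0 \<le> (l 1 - l 2) \<bullet> (l 3 - l 2)" "0 \<le> (l 2 - l 1) \<bullet> (l 3 - l 1)"
    using n sq by (simp_all add: inner_diff_left inner_diff_right inner_commute)
  then show "stiffness l 1 3 \<le> 0" "stiffness l 2 3 \<le> 0"
    using measure_tri_pos[OF l(1)]
    by (auto simp: stiffness_def bary_grad_inner mult_le_0_iff divide_le_0_iff)
  have "0 < - ((l 1 - l 3) \<bullet> (l 2 - l 3)) / (tri_det l)\<^sup>2"
    using n l(1) by (intro divide_pos_pos) auto
  then show "stiffness l 1 2 > 0"
    unfolding stiffness_def bary_grad_inner using measure_tri_pos[OF l(1)] by (rule mult_pos_pos[rotated])
qed

lemma stiffness_nonobtuse:
  assumes p: "tri_det p \<noteq> 0"
  defines "l \<equiv> local_nodes (tri p)"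
  assumes nobt: "\<not> has_obtuse_angle (tri p)"
  shows "stiffness l 1 2 \<le> 0" "stiffness l 1 3 \<le> 0" "stiffness l 2 3 \<le> 0"
proof -
  note l = local_nodes_tri[OF p, folded l_def]
  have "\<not> interior_angle l i > pi / 2" for i
    using nobt by (auto simp: has_obtuse_angle_def l_def)
  then have "0 \<le> (l 1 - l 3) \<bullet> (l 2 - l 3)" "0 \<le> (l 1 - l 2) \<bullet> (l 3 - l 2)" "0 \<le> (l 2 - l 1) \<bullet> (l 3 - l 1)"
    using interior_angle_gt_right[OF l(1)] by (meson not_le)+
  then show "stiffness l 1 2 \<le> 0" "stiffness l 1 3 \<le> 0" "stiffness l 2 3 \<le> 0"
    using measure_tri_pos[OF l(1)]
    by (auto simp: stiffness_def bary_grad_inner mult_le_0_iff divide_le_0_iff)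
qed

lemma simplex_tri: "tri_det p \<noteq> 0 \<Longrightarrow> 2 simplex (tri p)"
  unfolding simplex_def tri_def tri_det_neq_0_iff by (intro exI[of _ "range p"]) (simp add: card_image)

text \<open>One triangle is a triangulation by itself, so the formula for hat functions applies at
  level 0.\<close>

lemma local_stiffness_eq:
  assumes p: "tri_det p \<noteq> 0"
  shows "local_stiffness (tri p) = (\<chi> i j. stiffness (local_nodes (tri p)) i j)"
proof -
  define l where "l = local_nodes (tri p)"
  note l = local_nodes_tri[OF p, folded l_def]
  let ?M = "{tri p}"
  have tr: "triangulation ?M"
    using simplex_tri[OF p] convex_tri[of p] by (auto simp: triangulation_def face_of_refl)
  have nd: "nondegenerate ?M"
    using p by (auto simp: nondegenerate_def)
  have r0: "refined_mesh ?M 0 = ?M" "refined_mesh {tri l} 0 = {tri l}"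
    by (simp_all add: refined_mesh_0)
  have "grad_product (tri l) (nodal_basis ?M (l i)) (nodal_basis ?M (l j)) = stiffness l i j" for i j
  proof -
    have "\<exists>s w. s \<noteq> 0 \<and> l = homothety s w \<circ> l"
      by (rule exI[of _ 1], rule exI[of _ 0]) (simp add: homothety_def o_def)
    moreover have "l i \<in> nodes ?M" for i
      using vertices_tri[OF l(1)] l(2) by (auto simp: nodes_def)
    ultimately have "grad_product (tri l) (nodal_basis ?M (l i)) (nodal_basis ?M (l j))
        = (\<Sum>t\<in>{tri l}. \<Sum>i'\<in>UNIV. \<Sum>j'\<in>UNIV. of_bool (l i' = l i) * of_bool (l j' = l j) * stiffness l i' j')"
      using grad_product_nodal_basis[OF tr nd l(1), of 0 "\<lambda>_. l" "l i" "l j"] l(1,2) unfolding r0 by auto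
    also have "\<dots> = (\<Sum>i'\<in>UNIV. \<Sum>j'\<in>UNIV. of_bool (i' = i) * of_bool (j' = j) * stiffness l i' j')"
      using tri_det_imp_inj[OF l(1)] by (simp add: inj_eq)
    also have "\<dots> = stiffness l i j"
      using exhaust_3[of i] exhaust_3[of j] by (auto simp: sum_3)
    finally show ?thesis .
  qed
  then show ?thesis
    using l(2) by (simp add: local_stiffness_def l_def)
qed

section \<open>The smallest eigenvalue and coercivity on an element\<close>

text \<open>The quadratic form of \<open>reference_matrix\<close>, the graph Laplacian of three
  mutually joined vertices.\<close>

definition sum_sq_diff :: "(3 \<Rightarrow> real) \<Rightarrow> real" where
  "sum_sq_diff z = (z 1 - z 2)\<^sup>2 + (z 1 - z 3)\<^sup>2 + (z 2 - z 3)\<^sup>2"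

lemma inner_reference_matrix: "z \<bullet> (reference_matrix *v z) = sum_sq_diff (\<lambda>i. z $ i)"
  by (simp add: reference_matrix_def matrix_vector_mult_def inner_vec_def sum_3 sum_sq_diff_def
      power2_eq_square algebra_simps)

lemma inner_stiffness_matrix: "z \<bullet> ((\<chi> i j. stiffness p i j) *v z) = quad_form p (\<lambda>i. z $ i)"
  by (simp add: matrix_vector_mult_def inner_vec_def quad_form_def sum_distrib_left mult_ac)

text \<open>First-order optimality at t = 0 without derivatives. The contradiction uses t = -B/(C +
  1), where the 1 takes care of C = 0.\<close>

lemma nonneg_quadratic_linear_coeff:
  fixes B C :: real
  assumes "\<And>t. 0 \<le> 2 * t * B + t\<^sup>2 * C" "0 \<le> C"
  shows "B = 0"
proof (rule ccontr)
  assume "B \<noteq> 0"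
  define u where "u = B / (C + 1)"
  have B: "B = u * (C + 1)" and "u \<noteq> 0"
    using \<open>B \<noteq> 0\<close> assms(2) by (auto simp: u_def)
  have "2 * (- u) * B + (- u)\<^sup>2 * C = - (u\<^sup>2 * (C + 2))"
    by (simp add: B power2_eq_square algebra_simps)
  moreover have "0 < u\<^sup>2 * (C + 2)"
    using \<open>u \<noteq> 0\<close> assms(2) by (intro mult_pos_pos) auto
  ultimately show False
    using assms(1)[of "- u"] by simp
qed

text \<open>The minimiser of the Rayleigh quotient, normalised by \<open>z $ 3 = 0\<close> to factor out the common
  kernel, is an eigenvector for the smallest nonzero eigenvalue.\<close>

lemma lambda_min_spec:
  assumes p: "tri_det p \<noteq> 0"
  shows "lambda_min (tri p) > 0"
    "lambda_min (tri p) * sum_sq_diff z \<le> quad_form (local_nodes (tri p)) z"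
proof -
  define l where "l = local_nodes (tri p)"
  note l = local_nodes_tri[OF p, folded l_def]
  define q where "q z = quad_form l (\<lambda>i. z $ i)" for z :: "real^3"
  define r where "r z = sum_sq_diff (\<lambda>i. z $ i)" for z :: "real^3"
  define A :: "real^3^3" where "A = (\<chi> i j. stiffness l i j)"
  have A: "local_stiffness (tri p) = A"
    using local_stiffness_eq[OF p] by (simp add: A_def l_def)
  define K where "K = {z. r z = 1 \<and> z $ 3 = 0}"
  have cont: "continuous_on UNIV q" "continuous_on UNIV r"
    unfolding q_def r_def quad_form_def sum_sq_diff_def by (intro continuous_intros)+
  have "closed K"
    unfolding K_def using cont by (intro closed_Collect_conj closed_Collect_eq continuous_intros) auto
  moreover have "norm z \<le> 2" if z: "z \<in> K" for z
  proof -
    have "(z $ 1)\<^sup>2 + (z $ 2)\<^sup>2 + (z $ 1 - z $ 2)\<^sup>2 = 1" "z $ 3 = 0"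
      using z by (auto simp: K_def r_def sum_sq_diff_def)
    then have "(z $ 1)\<^sup>2 \<le> 1" "(z $ 2)\<^sup>2 \<le> 1"
      using zero_le_power2[of "z $ 1"] zero_le_power2[of "z $ 2"] zero_le_power2[of "z $ 1 - z $ 2"] by linarith+
    then have "\<bar>z $ 1\<bar> \<le> 1" "\<bar>z $ 2\<bar> \<le> 1"
      by (simp_all add: abs_square_le_1)
    then show ?thesis
      using norm_le_l1_cart[of z] \<open>z $ 3 = 0\<close> by (simp add: sum_3)
  qed
  ultimately have "compact K"
    unfolding compact_eq_bounded_closed bounded_iff by blast
  moreover have "vector [1 / sqrt 2, 0, 0] \<in> K"
    by (simp add: K_def r_def sum_sq_diff_def power_divide)
  ultimately obtain z0 where z0: "z0 \<in> K" "\<And>z. z \<in> K \<Longrightarrow> q z0 \<le> q z"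
    using continuous_attains_inf[of K q] cont(1) continuous_on_subset by (metis empty_iff subset_UNIV)
  define \<mu> where "\<mu> = q z0"
  have r0: "r z0 = 1"
    using z0(1) by (simp add: K_def)
  have r_nonneg: "0 \<le> r z" for z
    by (simp add: r_def sum_sq_diff_def)
  have q_nonneg: "0 \<le> q z" for z
    by (simp add: q_def quad_form_nonneg)
  have \<mu>: "\<mu> > 0"
  proof (rule ccontr)
    assume "\<not> \<mu> > 0"
    then have "quad_form l (\<lambda>i. z0 $ i) = 0"
      using q_nonneg[of z0] by (simp add: \<mu>_def q_def)
    from quad_form_eq_0[OF l(1) this, of 1 2] quad_form_eq_0[OF l(1) this, of 1 3]
    have "r z0 = 0"
      by (simp add: r_def sum_sq_diff_def)
    then show False
      using r0 by simp
  qed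
  have ge: "\<mu> * r z \<le> q z" for z
  proof (cases "r z = 0")
    case True
    then show ?thesis
      using q_nonneg by simp
  next
    case False
    then have pos: "0 < r z"
      using r_nonneg[of z] by simp
    define R where "R = r z"
    \<comment> \<open>The shift leaves all differences, hence both forms, unchanged, and the scaling
      divides both by \<open>R\<close>; so \<open>w\<close> lands in \<open>K\<close>.\<close>
    define w :: "real^3" where "w = (\<chi> i. (z $ i - z $ 3) / sqrt R)"
    have d: "(w $ i - w $ j)\<^sup>2 = (z $ i - z $ j)\<^sup>2 / R" for i j
      using pos unfolding R_def[symmetric] by (simp add: w_def diff_divide_distrib[symmetric] power_divide)
    have "r w = r z / R"
      by (simp add: r_def sum_sq_diff_def d add_divide_distrib)
    moreover have "w $ 3 = 0"
      by (simp add: w_def)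
    ultimately have "w \<in> K"
      using pos by (simp add: K_def R_def)
    then have "\<mu> \<le> q w"
      unfolding \<mu>_def by (rule z0(2))
    also have "q w = q z / R"
      unfolding q_def quad_form_eq_differences d by (simp add: add_divide_distrib diff_divide_distrib)
    finally show ?thesis
      using pos by (simp add: field_simps R_def)
  qed
  have inner: "z \<bullet> (A *v z) = q z" "z \<bullet> (reference_matrix *v z) = r z" for z
    by (simp_all add: A_def q_def r_def inner_reference_matrix inner_stiffness_matrix)
  have sym: "y \<bullet> (A *v z) = z \<bullet> (A *v y)" "y \<bullet> (reference_matrix *v z) = z \<bullet> (reference_matrix *v y)" for y z
    by (simp_all add: A_def reference_matrix_def matrix_vector_mult_def inner_vec_def sum_3 algebra_simps
        stiffness_commute[of l 2 1] stiffness_commute[of l 3 1] stiffness_commute[of l 3 2])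
  have eig: "A *v z0 = \<mu> *\<^sub>R (reference_matrix *v z0)"
  proof -
    \<comment> \<open>The residual of the eigenvalue equation serves as direction of variation: q -
      \<mu> r is nonnegative and zero at \<open>z0\<close>, so its linear coefficient along
      \<open>y\<close>, which is \<open>y \<bullet> y\<close>, must vanish.\<close>
    define y where "y = A *v z0 - \<mu> *\<^sub>R (reference_matrix *v z0)"
    have "y \<bullet> y = 0"
    proof (rule nonneg_quadratic_linear_coeff)
      show "0 \<le> q y - \<mu> * r y"
        using ge[of y] by simp
      fix t
      have "0 \<le> q (z0 + t *\<^sub>R y) - \<mu> * r (z0 + t *\<^sub>R y)"
        using ge by simp
      also have "\<dots> = (q z0 - \<mu> * r z0) + 2 * t * (y \<bullet> (A *v z0) - \<mu> * (y \<bullet> (reference_matrix *v z0)))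
          + t\<^sup>2 * (q y - \<mu> * r y)"
        unfolding inner[symmetric]
        by (simp add: matrix_vector_right_distrib matrix_vector_mult_scaleR inner_add_left inner_add_right
            sym[of z0 y] algebra_simps power2_eq_square)
      also have "y \<bullet> (A *v z0) - \<mu> * (y \<bullet> (reference_matrix *v z0)) = y \<bullet> y"
        by (simp add: y_def inner_diff_right)
      finally show "0 \<le> 2 * t * (y \<bullet> y) + t\<^sup>2 * (q y - \<mu> * r y)"
        by (simp add: r0 \<mu>_def)
    qed
    then show ?thesis
      by (simp add: y_def)
  qed
  have "lambda_min (tri p) = \<mu>"
    unfolding lambda_min_def A
  proof (rule Least_equality)
    have "reference_matrix *v z0 \<noteq> 0"
      using inner(2)[of z0] r0 by auto
    then show "\<mu> \<noteq> 0 \<and> (\<exists>z. reference_matrix *v z \<noteq> 0 \<and> A *v z = \<mu> *\<^sub>R (reference_matrix *v z))"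
      using \<mu> eig by auto
    fix \<nu>
    assume "\<nu> \<noteq> 0 \<and> (\<exists>z. reference_matrix *v z \<noteq> 0 \<and> A *v z = \<nu> *\<^sub>R (reference_matrix *v z))"
    then obtain z where z: "reference_matrix *v z \<noteq> 0" "A *v z = \<nu> *\<^sub>R (reference_matrix *v z)"
      by blast
    have "r z \<noteq> 0"
    proof
      assume "r z = 0"
      then have "z $ 1 = z $ 2" "z $ 1 = z $ 3"
        by (simp_all add: r_def sum_sq_diff_def add_nonneg_eq_0_iff)
      then have "reference_matrix *v z = 0"
        by (simp add: reference_matrix_def matrix_vector_mult_def vec_eq_iff forall_3 sum_3)
      then show False
        using z(1) by simp
    qed
    then have "0 < r z"
      using r_nonneg[of z] by simp
    moreover have "q z = \<nu> * r z"
      unfolding inner[symmetric] z(2) by simp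
    ultimately show "\<mu> \<le> \<nu>"
      using ge[of z] by simp
  qed
  then show "lambda_min (tri p) > 0" "lambda_min (tri p) * sum_sq_diff z \<le> quad_form (local_nodes (tri p)) z"
    using \<mu> ge[of "\<chi> i. z i"] by (simp_all add: q_def r_def l_def)
qed

lemma element_energy_symmetric:
  assumes "\<And>i j. \<kappa> i j = \<kappa> j i"
  shows "element_energy p \<kappa> z = - (\<kappa> 1 2 * stiffness p 1 2 * (z 1 - z 2)\<^sup>2
    + \<kappa> 1 3 * stiffness p 1 3 * (z 1 - z 3)\<^sup>2 + \<kappa> 2 3 * stiffness p 2 3 * (z 2 - z 3)\<^sup>2)"
  unfolding element_energy_def sum_3 assms[of 2 1] assms[of 3 1] assms[of 3 2]
    stiffness_commute[of p 2 1] stiffness_commute[of p 3 1] stiffness_commute[of p 3 2]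
    power2_commute[of "z 2" "z 1"] power2_commute[of "z 3" "z 1"] power2_commute[of "z 3" "z 2"]
  by (simp add: field_simps)

text \<open>All three off-diagonal entries are at most 0, so every term of the energy is nonnegative
  and its coefficient can be lowered separately.\<close>

lemma element_energy_nonobtuse:
  assumes p: "tri_det p \<noteq> 0" "\<not> has_obtuse_angle (tri p)"
    and \<kappa>: "\<And>i j. \<kappa> i j = \<kappa> j i" "\<And>i j. \<kappa>\<^sub>0 \<le> \<kappa> i j"
  shows "\<kappa>\<^sub>0 * quad_form (local_nodes (tri p)) z \<le> element_energy (local_nodes (tri p)) \<kappa> z"
proof -
  note s = stiffness_nonobtuse[OF p]
  have "\<kappa>\<^sub>0 * (- s * d) \<le> \<kappa> i j * (- s * d)" if "s \<le> 0" "0 \<le> d" for s d i j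
    using that by (intro mult_right_mono \<kappa> mult_nonneg_nonneg) auto
  from this[OF s(1), of "(z 1 - z 2)\<^sup>2" 1 2] this[OF s(2), of "(z 1 - z 3)\<^sup>2" 1 3] this[OF s(3), of "(z 2 - z 3)\<^sup>2" 2 3]
  show ?thesis
    unfolding element_energy_symmetric[OF \<kappa>(1)] quad_form_eq_differences by (simp add: algebra_simps)
qed

text \<open>Two estimates meet in the squared differences to node 3. Dropping the term of the
  positive entry bounds \<open>quad_form\<close> above by the divisor times their sum; the added 1
  keeps the divisor positive when the two entries are only known to be at most 0. The Rayleigh
  bound, with the node 1-2 term moved across, bounds the energy below.\<close>

lemma element_energy_obtuse:
  assumes p: "tri_det p \<noteq> 0" "has_obtuse_angle (tri p)"
  defines "l \<equiv> local_nodes (tri p)"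
  assumes \<kappa>: "\<And>i j. \<kappa> i j = \<kappa> j i" and m: "0 < \<kappa>\<^sub>0" "\<kappa>\<^sub>0 \<le> m" "m \<le> \<kappa> 1 3" "m \<le> \<kappa> 2 3"
    "\<kappa> 1 2 * stiffness l 1 2 \<le> m * (stiffness l 1 2 + lambda_min (tri p))"
  shows "\<kappa>\<^sub>0 * lambda_min (tri p) / (1 - stiffness l 1 3 - stiffness l 2 3) * quad_form l z \<le> element_energy l \<kappa> z"
proof -
  note s = stiffness_obtuse[OF p, folded l_def]
  let ?lam = "lambda_min (tri p)" and ?C = "1 - stiffness l 1 3 - stiffness l 2 3"
  note \<lambda> = lambda_min_spec[OF p(1), folded l_def]
  let ?a = "(z 1 - z 2)\<^sup>2" and ?b = "(z 1 - z 3)\<^sup>2" and ?c = "(z 2 - z 3)\<^sup>2"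
  have C: "?C > 0"
    using s by simp
  have q: "quad_form l z = - (stiffness l 1 2 * ?a + stiffness l 1 3 * ?b + stiffness l 2 3 * ?c)"
    by (rule quad_form_eq_differences)
  have "quad_form l z \<le> ?C * (?b + ?c)"
  proof -
    have "0 \<le> stiffness l 1 2 * ?a" "stiffness l 1 3 * ?c \<le> 0" "stiffness l 2 3 * ?b \<le> 0"
      using s by (auto intro: mult_nonneg_nonneg mult_nonpos_nonneg)
    moreover have "0 \<le> ?b" "0 \<le> ?c"
      by simp_all
    moreover have "?C * (?b + ?c) - quad_form l z = ?b + ?c + stiffness l 1 2 * ?a - stiffness l 1 3 * ?c - stiffness l 2 3 * ?b"
      unfolding q by (simp add: algebra_simps)
    ultimately show ?thesis
      by linarith
  qed
  then have "\<kappa>\<^sub>0 * ?lam / ?C * quad_form l z \<le> \<kappa>\<^sub>0 * ?lam / ?C * (?C * (?b + ?c))"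
    using m(1) \<lambda>(1) C by (intro mult_left_mono) auto
  also have "\<dots> = \<kappa>\<^sub>0 * (?lam * (?b + ?c))"
    using C by simp
  also have "\<dots> \<le> m * (?lam * (?b + ?c))"
    using m(2) \<lambda>(1) by (intro mult_right_mono mult_nonneg_nonneg) auto
  also have "\<dots> \<le> m * (quad_form l z - ?lam * ?a)"
    using \<lambda>(2)[of z] m(1,2) by (intro mult_left_mono) (auto simp: sum_sq_diff_def algebra_simps)
  \<comment> \<open>Subtracting the eigenvalue term raises the negative coefficient to exactly the
    bound that the modification enforces.\<close>
  also have "\<dots> = - (m * (stiffness l 1 2 + ?lam) * ?a) + m * (- stiffness l 1 3 * ?b) + m * (- stiffness l 2 3 * ?c)"
    unfolding q by (simp add: algebra_simps)
  also have "\<dots> \<le> - (\<kappa> 1 2 * stiffness l 1 2 * ?a) + \<kappa> 1 3 * (- stiffness l 1 3 * ?b) + \<kappa> 2 3 * (- stiffness l 2 3 * ?c)"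
    using m(3-5) s(2,3)
    by (intro add_mono mult_right_mono le_imp_neg_le mult_nonneg_nonneg) auto
  also have "\<dots> = element_energy l \<kappa> z"
    unfolding element_energy_symmetric[OF \<kappa>] by simp
  finally show ?thesis .
qed

section \<open>The modified coefficient on fine elements\<close>

lemma k_edge_mod_commute: "k_edge_mod k N T x y = k_edge_mod k N T y x"
proof -
  have "gray_edge N T x y = gray_edge N T y x"
  proof -
    have "(\<exists>c. y - x = c *\<^sub>R d) \<longleftrightarrow> (\<exists>c. x - y = c *\<^sub>R d)" for d :: pt
      by (metis minus_diff_eq scaleR_minus_left)
    then show ?thesis
      by (simp add: gray_edge_def closed_segment_commute[of x y])
  qed
  moreover have "k_edge k T x y = k_edge k T y x"
    by (simp add: k_edge_def add.commute)
  moreover have "k_edge_min k N T x y = k_edge_min k N T y x"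
    by (simp add: k_edge_min_def closed_segment_commute[of x y])
  ultimately show ?thesis
    by (auto simp: k_edge_mod_def Let_def)
qed

lemma tri_edge:
  assumes p: "tri_det p \<noteq> 0" and ij: "i \<noteq> j"
  shows "closed_segment (p i) (p j) edge_of tri p"
proof -
  have "p i \<noteq> p j"
    using tri_det_imp_inj[OF p] ij by (simp add: inj_eq)
  moreover have "convex hull {p i, p j} face_of convex hull (range p)"
  proof (rule iffD2[OF face_of_convex_hull_affine_independent], goal_cases)
    case 1
    then show ?case
      using p by (simp add: tri_det_neq_0_iff)
  next
    case 2
    show ?case
      by (rule exI[of _ "{p i, p j}"]) simp
  qed
  ultimately show ?thesis
    by (simp add: edge_of_def tri_def segment_convex_hull aff_dim_convex_hull)
qed

lemma aff_dim_tri: "tri_det p \<noteq> 0 \<Longrightarrow> aff_dim (tri p) = 2"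
  using aff_dim_simplex[OF simplex_tri] .

text \<open>\<open>edge_patch\<close> asks for edges inside the frontier; this puts an element into
  the patch of each of its own edges.\<close>

lemma tri_edge_subset_frontier:
  assumes "e edge_of tri p" "tri_det p \<noteq> 0"
  shows "e \<subseteq> frontier (tri p)"
proof -
  have e: "e face_of tri p" "e \<noteq> tri p"
    using assms aff_dim_tri[OF assms(2)] by (auto simp: edge_of_def)
  have "e \<inter> interior (tri p) = {}"
    using e by (rule face_of_disjoint_interior)
  moreover have "e \<subseteq> tri p"
    using e(1) by (rule face_of_imp_subset)
  ultimately show ?thesis
    using closure_subset[of "tri p"] by (auto simp: frontier_def)
qed

text \<open>Makes the set under the minimum in \<open>k_edge_min\<close> finite: its members come
  from pairs of nodes.\<close>

lemma mesh_edge_endpoints: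
  assumes "closed_segment x y \<in> mesh_edges N"
  shows "x \<in> nodes N" "y \<in> nodes N"
proof -
  obtain t where t: "t \<in> N" "closed_segment x y face_of t"
    using assms by (auto simp: mesh_edges_def edge_of_def)
  have "x extreme_point_of closed_segment x y" "y extreme_point_of closed_segment x y"
    by (simp_all add: extreme_point_of_segment)
  then have "x extreme_point_of t" "y extreme_point_of t"
    using extreme_point_of_face[OF t(2)] by blast+
  then show "x \<in> nodes N" "y \<in> nodes N"
    using t(1) by (auto simp: nodes_def vertices_def)
qed

text \<open>The element \<open>t\<close> belongs to the patch, so all of its edges compete in the
  minimum, which is therefore taken over a nonempty set. The patch stays inside \<open>T\<close>,
  where the coefficient is at least \<open>\<kappa>\<^sub>0\<close>.\<close>

lemma k_edge_min_props:
  assumes N: "finite (nodes N)" and k: "\<And>x. x \<in> T \<Longrightarrow> \<kappa>\<^sub>0 \<le> k T x"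
    and t: "t \<in> N" "t \<subseteq> T" "closed_segment x y \<subseteq> frontier t"
    and e: "closed_segment x' y' edge_of t"
  shows "\<kappa>\<^sub>0 \<le> k_edge_min k N T x y" "k_edge_min k N T x y \<le> k_edge k T x' y'"
proof -
  let ?S = "{k_edge k T x' y' |x' y'. closed_segment x' y' \<in> mesh_edges N \<and>
     closed_segment x' y' \<subseteq> edge_patch N T (closed_segment x y)}"
  have "?S \<subseteq> (\<lambda>(x', y'). k_edge k T x' y') ` (nodes N \<times> nodes N)"
    using mesh_edge_endpoints[of _ _ N] by auto
  then have fin: "finite ?S"
    by (rule finite_subset) (intro finite_imageI finite_cartesian_product N)
  have "t \<subseteq> edge_patch N T (closed_segment x y)"
    using t by (auto simp: edge_patch_def)
  moreover have "closed_segment x' y' \<subseteq> t"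
    using e by (rule edge_of_imp_subset)
  moreover have "closed_segment x' y' \<in> mesh_edges N"
    using e t(1) by (auto simp: mesh_edges_def)
  ultimately have mem: "k_edge k T x' y' \<in> ?S"
    by blast
  then show "k_edge_min k N T x y \<le> k_edge k T x' y'"
    unfolding k_edge_min_def using fin by (intro Min_le)
  have "\<kappa>\<^sub>0 \<le> s" if s: "s \<in> ?S" for s
  proof -
    obtain a b where ab: "s = k_edge k T a b" "closed_segment a b \<subseteq> edge_patch N T (closed_segment x y)"
      using s by blast
    moreover have "edge_patch N T (closed_segment x y) \<subseteq> T"
      by (auto simp: edge_patch_def)
    ultimately have "a \<in> T" "b \<in> T"
      using ends_in_segment[of a b] by blast+
    then show ?thesis
      using k[of a] k[of b] ab(1) by (simp add: k_edge_def)
  qed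
  then show "\<kappa>\<^sub>0 \<le> k_edge_min k N T x y"
    unfolding k_edge_min_def using fin mem by (subst Min_ge_iff) auto
qed

text \<open>Moving along the side from node 1 to node 2 preserves the third barycentric coordinate,
  while moving towards node 3 changes it. Hence only images of that side can be gray.\<close>

lemma edge_not_parallel:
  assumes l: "tri_det l \<noteq> 0" and s: "s \<noteq> 0" and i: "i \<noteq> 3"
  shows "homothety s w (l 3) - homothety s w (l i) \<noteq> c *\<^sub>R (l 2 - l 1)"
proof
  assume "homothety s w (l 3) - homothety s w (l i) = c *\<^sub>R (l 2 - l 1)"
  then have "s *\<^sub>R (l 3 - l i) = c *\<^sub>R (l 2 - l 1)"
    by (simp add: homothety_def algebra_simps)
  then have "s * (bary_grad l 3 \<bullet> (l 3 - l i)) = c * (bary_grad l 3 \<bullet> (l 2 - l 1))"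
    by (metis inner_scaleR_right)
  moreover have "bary_grad l 3 \<bullet> (l 3 - l i) = bary l 3 (l 3) - bary l 3 (l i)"
    "bary_grad l 3 \<bullet> (l 2 - l 1) = bary l 3 (l 2) - bary l 3 (l 1)"
    by (simp_all add: bary_def inner_diff_right)
  ultimately show False
    using s i by (simp add: bary_at_vertex[OF l])
qed

text \<open>The order of quantifiers is the point: \<open>c\<close> is fixed before the mesh and the
  homothety, hence is independent of the refinement level.\<close>

lemma element_energy_coercive:
  assumes p: "tri_det p \<noteq> 0"
    and k: "\<And>x. x \<in> tri p \<Longrightarrow> \<kappa>\<^sub>0 \<le> k (tri p) x" and \<kappa>\<^sub>0: "0 < \<kappa>\<^sub>0"
  defines "l \<equiv> local_nodes (tri p)"
  shows "\<exists>c>0. \<forall>N s w z. finite (nodes N) \<longrightarrow> s \<noteq> 0 \<longrightarrow> tri (homothety s w \<circ> l) \<in> N \<longrightarrow>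
      tri (homothety s w \<circ> l) \<subseteq> tri p \<longrightarrow>
    c * quad_form l z \<le> element_energy l
      (\<lambda>i j. k_edge_mod k N (tri p) (homothety s w (l i)) (homothety s w (l j))) z"
proof -
  note l = local_nodes_tri[OF p, folded l_def]
  show ?thesis
  proof (cases "has_obtuse_angle (tri p)")
    case False
    show ?thesis
    proof (intro exI[of _ \<kappa>\<^sub>0] conjI allI impI \<kappa>\<^sub>0)
      fix N s w z
      assume sub: "tri (homothety s w \<circ> l) \<subseteq> tri p"
      have in_T: "homothety s w (l i) \<in> tri p" for i
        using sub tri_vertex_in[of "homothety s w \<circ> l" i] by auto
      have "\<kappa>\<^sub>0 \<le> k_edge_mod k N (tri p) (homothety s w (l i)) (homothety s w (l j))" for i j
        using k[OF in_T[of i]] k[OF in_T[of j]] False by (simp add: k_edge_mod_def gray_edge_def k_edge_def)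
      then show "\<kappa>\<^sub>0 * quad_form l z \<le> element_energy l
          (\<lambda>i j. k_edge_mod k N (tri p) (homothety s w (l i)) (homothety s w (l j))) z"
        unfolding l_def using k_edge_mod_commute by (intro element_energy_nonobtuse[OF p False])
    qed
  next
    case True
    note st = stiffness_obtuse[OF p True, folded l_def]
    let ?lam = "lambda_min (tri p)"
    have lam: "?lam > 0"
      by (rule lambda_min_spec(1)[OF p])
    show ?thesis
    proof (intro exI[of _ "\<kappa>\<^sub>0 * ?lam / (1 - stiffness l 1 3 - stiffness l 2 3)"] conjI allI impI)
      show "\<kappa>\<^sub>0 * ?lam / (1 - stiffness l 1 3 - stiffness l 2 3) > 0"
        using \<kappa>\<^sub>0 lam st by (intro divide_pos_pos mult_pos_pos) auto
      fix N s w z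
      assume N: "finite (nodes N)" and s: "s \<noteq> 0"
        and t: "tri (homothety s w \<circ> l) \<in> N" "tri (homothety s w \<circ> l) \<subseteq> tri p"
      let ?q = "homothety s w \<circ> l"
      let ?x = "\<lambda>i. homothety s w (l i)"
      have q: "tri_det ?q \<noteq> 0"
        using l(1) s by (simp add: tri_det_homothety)
      define m where "m = k_edge_min k N (tri p) (?x 1) (?x 2)"
      have edge: "closed_segment (?x i) (?x j) edge_of tri ?q" if "i \<noteq> j" for i j
        using tri_edge[OF q that] by simp
      have fr: "closed_segment (?x 1) (?x 2) \<subseteq> frontier (tri ?q)"
        by (rule tri_edge_subset_frontier[OF edge q]) simp
      have m: "\<kappa>\<^sub>0 \<le> m" "m \<le> k_edge k (tri p) (?x i) (?x j)" if "i \<noteq> j" for i j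
        unfolding m_def
        by (rule k_edge_min_props[where \<kappa>\<^sub>0 = \<kappa>\<^sub>0 and T = "tri p" and k = k, OF N k t fr edge[OF that]]; assumption)+
      have not_gray: "k_edge_mod k N (tri p) (?x i) (?x 3) = k_edge k (tri p) (?x i) (?x 3)" if "i \<noteq> 3" for i
        using edge_not_parallel[OF l(1) s that] by (simp add: k_edge_mod_def gray_edge_def l_def)
      have gray: "gray_edge N (tri p) (?x 1) (?x 2)"
        unfolding gray_edge_def
      proof (intro conjI)
        show "has_obtuse_angle (tri p)"
          by (rule True)
        have e: "closed_segment (?x 1) (?x 2) edge_of tri ?q"
          by (rule edge) simp
        show "closed_segment (?x 1) (?x 2) \<in> mesh_edges N"
          using e t(1) by (auto simp: mesh_edges_def)
        show "closed_segment (?x 1) (?x 2) \<subseteq> tri p"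
          using edge_of_imp_subset[OF e] t(2) by blast
        show "\<exists>c. ?x 2 - ?x 1 = c *\<^sub>R (local_nodes (tri p) 2 - local_nodes (tri p) 1)"
          by (rule exI[of _ s]) (simp add: homothety_def l_def scaleR_diff_right)
      qed
      show "\<kappa>\<^sub>0 * ?lam / (1 - stiffness l 1 3 - stiffness l 2 3) * quad_form l z
          \<le> element_energy l (\<lambda>i j. k_edge_mod k N (tri p) (?x i) (?x j)) z"
      proof (rule element_energy_obtuse[OF p True, folded l_def])
        show "k_edge_mod k N (tri p) (?x i) (?x j) = k_edge_mod k N (tri p) (?x j) (?x i)" for i j
          by (rule k_edge_mod_commute)
        show "0 < \<kappa>\<^sub>0" "\<kappa>\<^sub>0 \<le> m"
          using \<kappa>\<^sub>0 m(1)[of 1 2] by auto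
        show "m \<le> k_edge_mod k N (tri p) (?x 1) (?x 3)" "m \<le> k_edge_mod k N (tri p) (?x 2) (?x 3)"
          using not_gray[of 1] not_gray[of 2] m(2)[of 1 3] m(2)[of 2 3] by auto
        have a12: "local_stiffness (tri p) $ 1 $ 2 = stiffness l 1 2"
          by (simp add: local_stiffness_eq[OF p] l_def)
        show "k_edge_mod k N (tri p) (?x 1) (?x 2) * stiffness l 1 2 \<le> m * (stiffness l 1 2 + ?lam)"
        \<comment> \<open>When the modification triggers, the bound holds with equality; otherwise
          the failed test is the bound itself, rearranged.\<close>
        proof (cases "(k_edge k (tri p) (?x 1) (?x 2) - m) * stiffness l 1 2 > m * ?lam")
          case True
          then have "k_edge_mod k N (tri p) (?x 1) (?x 2) = m * (1 + ?lam / stiffness l 1 2)"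
            using gray by (simp add: k_edge_mod_def a12 m_def)
          then show ?thesis
            using st(1) by (simp add: field_simps)
        next
          case False
          then have "k_edge_mod k N (tri p) (?x 1) (?x 2) = k_edge k (tri p) (?x 1) (?x 2)"
            using gray by (simp add: k_edge_mod_def a12 m_def)
          then show ?thesis
            using False by (simp add: algebra_simps)
        qed
      qed
    qed
  qed
qed

text \<open>By continuity the set where the bound fails in the interior is open; being null it is
  empty, and the closure of the interior is the whole triangle. Nodes on the boundary are thereby
  covered.\<close>

lemma coefficient_lower_bound:
  fixes f :: "pt \<Rightarrow> real"
  assumes p: "tri_det p \<noteq> 0" and f: "continuous_on (tri p) f"
    and ae: "AE x in lebesgue_on (interior (tri p)). \<kappa> \<le> f x" and x: "x \<in> tri p"
  shows "\<kappa> \<le> f x"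
proof -
  let ?I = "interior (tri p)"
  have "?I \<noteq> {}"
  proof
    assume "?I = {}"
    then have "tri p = frontier (tri p)"
      using compact_imp_closed[OF compact_tri[of p]] by (simp add: frontier_def)
    then have "negligible (tri p)"
      using negligible_convex_frontier[OF convex_tri[of p]] by simp
    then show False
      using measure_tri_pos[OF p] lmeasurable_tri[of p] by (simp add: negligible_iff_measure0)
  qed
  then have cl: "closure ?I = tri p"
    using convex_closure_interior[OF convex_tri] compact_imp_closed[OF compact_tri[of p]] by simp
  let ?S = "?I \<inter> f -` {..<\<kappa>}"
  have "open ?S"
    using f interior_subset by (intro continuous_open_preimage) (auto intro: continuous_on_subset)
  moreover have "negligible ?S"
  proof -
    have "AE x in lebesgue. x \<in> ?I \<longrightarrow> \<kappa> \<le> f x"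
      using ae by (subst (asm) AE_restrict_space_iff) auto
    then have "AE x in lebesgue. x \<notin> ?S"
      by eventually_elim auto
    then show ?thesis
      using \<open>open ?S\<close> by (simp add: negligible_iff_null_sets AE_iff_null_sets)
  qed
  ultimately have "?S = {}"
    using open_not_negligible by blast
  then have "\<kappa> \<le> f y" if "y \<in> ?I" for y
    using that by force
  then show ?thesis
    using continuous_ge_on_closure[of ?I f x \<kappa>] f x unfolding cl by blast
qed

section \<open>Coercivity of the modified form\<close>

text \<open>As only an upper bound is claimed, it suffices that the pieces cover the domain:
  overlaps merely enlarge the right-hand side.\<close>

lemma weak_grad_norm_le_elements:
  fixes \<Omega> :: "'a::euclidean_space set" and v :: "'a \<Rightarrow> real" and E :: "'i \<Rightarrow> 'a set"
  assumes \<Omega>: "open \<Omega>" and g: "is_weak_grad \<Omega> v g" "L2 \<Omega> g" and I: "finite I"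
    and E: "\<And>i. i \<in> I \<Longrightarrow> convex (E i)" "\<And>i. i \<in> I \<Longrightarrow> E i \<in> lmeasurable" "\<And>i. i \<in> I \<Longrightarrow> interior (E i) \<subseteq> \<Omega>"
    and cover: "\<Omega> \<subseteq> (\<Union>i\<in>I. E i)"
    and v: "\<And>i x. i \<in> I \<Longrightarrow> x \<in> E i \<Longrightarrow> v x = G i \<bullet> x + c i"
  shows "(LINT x|lebesgue_on \<Omega>. (norm (weak_grad \<Omega> v x))\<^sup>2) \<le> (\<Sum>i\<in>I. measure lebesgue (E i) * (norm (G i))\<^sup>2)"
proof -
  let ?W = "weak_grad \<Omega> v"
  have ind: "integrable lebesgue (\<lambda>x. indicator (E i) x :: real)" if "i \<in> I" for i
    using E(2)[OF that] by (simp only: lmeasurable_iff_integrable[symmetric])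
  have \<Omega>_sets: "\<Omega> \<in> sets lebesgue"
    using \<Omega> by simp
  have ind\<Omega>: "integrable lebesgue (\<lambda>x. indicator \<Omega> x *\<^sub>R (indicator (E i) x :: real))" if "i \<in> I" for i
    using \<Omega>_sets ind[OF that] by (rule integrable_mult_indicator)
  then have i: "integrable (lebesgue_on \<Omega>) (\<lambda>x. indicator (E i) x :: real)" if "i \<in> I" for i
    using that \<Omega>_sets by (subst integrable_restrict_space) auto
  have le: "(LINT x|lebesgue_on \<Omega>. indicator (E i) x :: real) \<le> measure lebesgue (E i)" if "i \<in> I" for i
  proof -
    have "(LINT x|lebesgue_on \<Omega>. indicator (E i) x :: real) = (LINT x|lebesgue. indicator \<Omega> x *\<^sub>R (indicator (E i) x :: real))"
      using \<Omega>_sets by (intro integral_restrict_space) auto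
    also have "\<dots> \<le> (LINT x|lebesgue. indicator (E i) x :: real)"
      using ind\<Omega>[OF that] ind[OF that] by (rule integral_mono) (simp add: indicator_def)
    also have "\<dots> = measure lebesgue (E i)"
      by simp
    finally show ?thesis .
  qed
  have "AE x in lebesgue. \<forall>i\<in>I. (x \<in> interior (E i) \<longrightarrow> ?W x = G i) \<and> x \<notin> frontier (E i)"
  proof (rule AE_ball_countable[THEN iffD2, OF countable_finite[OF I]], rule ballI)
    fix i assume i: "i \<in> I"
    have "AE x in lebesgue_on (interior (E i)). ?W x = G i"
      using v[OF i] interior_subset by (intro weak_grad_affine_AE[OF g(1) \<Omega> _ E(3)[OF i], of _ "c i"]) auto
    then have "AE x in lebesgue. x \<in> interior (E i) \<longrightarrow> ?W x = G i"
      by (subst (asm) AE_restrict_space_iff) auto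
    moreover have "AE x in lebesgue. x \<notin> frontier (E i)"
      using negligible_convex_frontier[OF E(1)[OF i]] by (intro AE_not_in) (simp add: negligible_iff_null_sets)
    ultimately show "AE x in lebesgue. (x \<in> interior (E i) \<longrightarrow> ?W x = G i) \<and> x \<notin> frontier (E i)"
      by eventually_elim simp
  qed
  then have "AE x in lebesgue. x \<in> \<Omega> \<longrightarrow> (norm (?W x))\<^sup>2 \<le> (\<Sum>i\<in>I. indicator (E i) x * (norm (G i))\<^sup>2)"
  proof eventually_elim
    case (elim x)
    show ?case
    proof
      assume "x \<in> \<Omega>"
      then obtain i where i: "i \<in> I" "x \<in> E i"
        using cover by blast
      then have "x \<in> interior (E i)"
        using elim closure_subset[of "E i"] by (auto simp: frontier_def)
      then have "(norm (?W x))\<^sup>2 = indicator (E i) x * (norm (G i))\<^sup>2"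
        using elim i by simp
      also have "\<dots> \<le> (\<Sum>i\<in>I. indicator (E i) x * (norm (G i))\<^sup>2)"
        using i(1) I by (intro member_le_sum) auto
      finally show "(norm (?W x))\<^sup>2 \<le> (\<Sum>i\<in>I. indicator (E i) x * (norm (G i))\<^sup>2)" .
    qed
  qed
  then have ae: "AE x in lebesgue_on \<Omega>. (norm (?W x))\<^sup>2 \<le> (\<Sum>i\<in>I. indicator (E i) x * (norm (G i))\<^sup>2)"
    using \<Omega>_sets by (subst AE_restrict_space_iff) auto
  have "integrable (lebesgue_on \<Omega>) (\<lambda>x. (norm (?W x))\<^sup>2)"
    using L2_weak_grad(1)[OF \<Omega> g] by (simp add: L2_def)
  then have "(LINT x|lebesgue_on \<Omega>. (norm (?W x))\<^sup>2) \<le> (LINT x|lebesgue_on \<Omega>. (\<Sum>i\<in>I. indicator (E i) x * (norm (G i))\<^sup>2))"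
    using i ae by (intro integral_mono_AE Bochner_Integration.integrable_sum integrable_mult_left)
  also have "\<dots> = (\<Sum>i\<in>I. (LINT x|lebesgue_on \<Omega>. indicator (E i) x) * (norm (G i))\<^sup>2)"
    using i by (subst Bochner_Integration.integral_sum)
      (auto simp del: Bochner_Integration.integral_indicator intro!: integrable_mult_left)
  also have "\<dots> \<le> (\<Sum>i\<in>I. measure lebesgue (E i) * (norm (G i))\<^sup>2)"
    using le by (intro sum_mono mult_right_mono) auto
  finally show ?thesis .
qed

lemma triangulation_of_nondegenerate:
  assumes "triangulation_of \<Omega> M"
  shows "triangulation M" "nondegenerate M"
proof -
  show "triangulation M"
    using assms by (simp add: triangulation_of_def)
  then have "finite M"
    by (simp add: triangulation_def)
  moreover have "\<exists>p. tri_det p \<noteq> 0 \<and> T = tri p" if T: "T \<in> M" for T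
  proof -
    have "2 simplex T"
      using assms T by (simp add: triangulation_of_def)
    then obtain p where "tri_det p \<noteq> 0" "T = tri p"
      by (rule simplex_2_imp_tri)
    then show ?thesis
      by blast
  qed
  ultimately show "nondegenerate M"
    by (simp add: nondegenerate_def)
qed

lemma finite_common_lower_bound:
  assumes "finite A" "\<And>x. x \<in> A \<Longrightarrow> \<exists>c::real>0. P x c"
    and mono: "\<And>x c c'. P x c \<Longrightarrow> 0 < c' \<Longrightarrow> c' \<le> c \<Longrightarrow> P x c'"
  shows "\<exists>c>0. \<forall>x\<in>A. P x c"
  using assms(1,2)
proof (induction A)
  case empty
  show ?case
    by (rule exI[of _ 1]) simp
next
  case (insert x A)
  obtain c where c: "c > 0" "\<forall>y\<in>A. P y c"
    using insert by blast
  obtain c' where c': "c' > 0" "P x c'"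
    using insert.prems by blast
  have "\<forall>y\<in>insert x A. P y (min c c')"
    using mono[OF c'(2), of "min c c'"] mono[OF c(2)[rule_format], of _ "min c c'"] c(1) c'(1) by auto
  then show ?case
    using c(1) c'(1) by (intro exI[of _ "min c c'"]) simp
qed

theorem lemma4p3:
  fixes \<Omega> :: "(real^2) set" and TH :: "(real^2) set set"
    and k :: "real^2 \<Rightarrow> real" and kT :: "(real^2) set \<Rightarrow> real^2 \<Rightarrow> real"
  assumes "polygonal_domain \<Omega>"
    and "triangulation_of \<Omega> TH"
    and "\<exists>\<kappa>>0. AE x in lebesgue_on \<Omega>. \<kappa> \<le> k x"
    and "\<And>T. T \<in> TH \<Longrightarrow> W2_infty (interior T) k"
    and "\<And>T. T \<in> TH \<Longrightarrow> continuous_on T (kT T) \<and> (AE x in lebesgue_on (interior T). kT T x = k x)"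
  shows "\<exists>c>0. \<forall>n\<ge>1. \<forall>v \<in> P1_space (refined_mesh TH n) \<inter> H1_0 \<Omega>.
           a_h_mod kT TH (refined_mesh TH n) v v \<ge> c * (H1_norm \<Omega> v)\<^sup>2"
proof -
  have \<Omega>: "open \<Omega>" "bounded \<Omega>"
    using assms(1) by (auto simp: polygonal_domain_def)
  note M = triangulation_of_nondegenerate[OF assms(2)]
  have fin: "finite TH"
    using M(2) by (simp add: nondegenerate_def)
  define l where "l T = local_nodes T" for T
  have l: "tri_det (l T) \<noteq> 0" "tri (l T) = T" if T: "T \<in> TH" for T
  proof -
    obtain p where "tri_det p \<noteq> 0" "T = tri p"
      using M(2) T by (auto simp: nondegenerate_def)
    then show "tri_det (l T) \<noteq> 0" "tri (l T) = T"
      using local_nodes_tri(1,2)[of p] by (simp_all add: l_def)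
  qed
  obtain \<kappa>\<^sub>0 where \<kappa>\<^sub>0: "\<kappa>\<^sub>0 > 0" "AE x in lebesgue_on \<Omega>. \<kappa>\<^sub>0 \<le> k x"
    using assms(3) by blast
  have kT: "\<kappa>\<^sub>0 \<le> kT T x" if T: "T \<in> TH" and x: "x \<in> T" for T x
  proof -
    have "interior T \<subseteq> \<Omega>"
      using assms(2) T by (simp add: triangulation_of_def)
    then have "AE x in lebesgue. x \<in> interior T \<longrightarrow> \<kappa>\<^sub>0 \<le> k x"
      using \<kappa>\<^sub>0(2) \<Omega>(1) by (subst (asm) AE_restrict_space_iff) (auto elim: eventually_mono)
    moreover have "AE x in lebesgue. x \<in> interior T \<longrightarrow> kT T x = k x"
      using assms(5)[OF T] by (subst (asm) AE_restrict_space_iff) auto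
    ultimately have "AE x in lebesgue. x \<in> interior T \<longrightarrow> \<kappa>\<^sub>0 \<le> kT T x"
      by eventually_elim auto
    then have "AE x in lebesgue_on (interior T). \<kappa>\<^sub>0 \<le> kT T x"
      by (subst AE_restrict_space_iff) auto
    then show ?thesis
      using coefficient_lower_bound[OF l(1)[OF T], of "kT T" \<kappa>\<^sub>0 x] assms(5)[OF T] x
      unfolding l(2)[OF T] by blast
  qed
  \<comment> \<open>Phrased as a property of the constant so that a minimum over the macro elements
    can be taken; it is monotone because \<open>quad_form\<close> is nonnegative.\<close>
  define coercive where "coercive T c \<longleftrightarrow> (\<forall>N s w z. finite (nodes N) \<longrightarrow> s \<noteq> 0 \<longrightarrow>
      tri (homothety s w \<circ> l T) \<in> N \<longrightarrow> tri (homothety s w \<circ> l T) \<subseteq> T \<longrightarrow>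
    c * quad_form (l T) z \<le> element_energy (l T)
      (\<lambda>i j. k_edge_mod kT N T (homothety s w (l T i)) (homothety s w (l T j))) z)" for T and c :: real
  have "\<exists>c>0. \<forall>T\<in>TH. coercive T c"
  proof (rule finite_common_lower_bound[OF fin])
    fix T assume T: "T \<in> TH"
    have "\<kappa>\<^sub>0 \<le> kT (tri (l T)) x" if "x \<in> tri (l T)" for x
      using kT[OF T, of x] that unfolding l(2)[OF T] by simp
    from element_energy_coercive[where k = kT and \<kappa>\<^sub>0 = \<kappa>\<^sub>0, OF l(1)[OF T] this \<kappa>\<^sub>0(1)]
    show "\<exists>c>0. coercive T c"
      unfolding l(2)[OF T] coercive_def unfolding l_def .
  next
    fix T and c c' :: real
    assume "coercive T c" "0 < c'" "c' \<le> c"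
    then show "coercive T c'"
      unfolding coercive_def by (meson mult_right_mono order_trans quad_form_nonneg)
  qed
  then obtain c where c: "c > 0" "\<And>T. T \<in> TH \<Longrightarrow> coercive T c"
    by blast
  obtain C where C: "C \<ge> 0" "\<And>v. v \<in> H1_0 \<Omega> \<Longrightarrow>
    (LINT x|lebesgue_on \<Omega>. (v x)\<^sup>2) \<le> C * (LINT x|lebesgue_on \<Omega>. (norm (weak_grad \<Omega> v x))\<^sup>2)"
    by (rule poincare_H1_0[OF \<Omega>]) blast
  \<comment> \<open>The two parts of the squared norm are at most \<open>C\<close> times and once
    the squared gradient norm, whence the divisor \<open>C + 1\<close>.\<close>
  have "c / (C + 1) * (H1_norm \<Omega> v)\<^sup>2 \<le> a_h_mod kT TH (refined_mesh TH n) v v"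
    if v: "v \<in> P1_space (refined_mesh TH n)" "v \<in> H1_0 \<Omega>" for n v
  proof -
    let ?N = "refined_mesh TH n" and ?R = "\<lambda>T. refined_mesh {T} n"
    obtain g where g: "is_weak_grad \<Omega> v g" "L2 \<Omega> g"
      using v(2) by (auto simp: H1_0_def H1_def)
    have "\<forall>T\<in>TH. \<exists>q. \<forall>t\<in>?R T. tri (q t) = t \<and> tri_det (q t) \<noteq> 0 \<and> (\<exists>s w. s \<noteq> 0 \<and> q t = homothety s w \<circ> l T)"
    proof
      fix T assume T: "T \<in> TH"
      show "\<exists>q. \<forall>t\<in>?R T. tri (q t) = t \<and> tri_det (q t) \<noteq> 0 \<and> (\<exists>s w. s \<noteq> 0 \<and> q t = homothety s w \<circ> l T)"
        using refined_mesh_vertices[OF l(1)[OF T], of n] unfolding l(2)[OF T] by metis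
    qed
    from bchoice[OF this] obtain q where "\<forall>T\<in>TH. \<forall>t\<in>?R T. tri (q T t) = t \<and> tri_det (q T t) \<noteq> 0 \<and>
        (\<exists>s w. s \<noteq> 0 \<and> q T t = homothety s w \<circ> l T)" ..
    then have q: "tri (q T t) = t" "tri_det (q T t) \<noteq> 0" "\<exists>s w. s \<noteq> 0 \<and> q T t = homothety s w \<circ> l T"
      if "T \<in> TH" "t \<in> ?R T" for T t
      using that by blast+
    have finN: "finite (nodes ?N)"
      by (rule finite_nodes[OF nondegenerate_refined_mesh[OF M(2)]])
    have subT: "t \<subseteq> T" if "T \<in> TH" "t \<in> ?R T" for T t
      using refined_mesh_cover[OF l(1)[OF that(1)], of n] that unfolding l(2)[OF that(1)] by blast
    have finR: "finite (?R T)" if "T \<in> TH" for T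
      using refined_mesh_finite_card(1)[OF l(1)[OF that], of n] unfolding l(2)[OF that] .
    let ?Q = "\<lambda>T t. quad_form (l T) (\<lambda>i. v (q T t i))"
    have "a_h_mod kT TH ?N v v = (\<Sum>T\<in>TH. \<Sum>t\<in>?R T. element_energy (l T)
        (\<lambda>i j. k_edge_mod kT ?N T (q T t i) (q T t j)) (\<lambda>i. v (q T t i)))"
    proof -
      have "(\<Sum>x\<in>nodes ?N. \<Sum>y\<in>nodes ?N - {x}.
          k_edge_mod kT ?N T x y * (v x - v y) * (v y - v x) * grad_product T (nodal_basis ?N x) (nodal_basis ?N y))
        = 2 * (\<Sum>t\<in>?R T. element_energy (l T) (\<lambda>i j. k_edge_mod kT ?N T (q T t i) (q T t j)) (\<lambda>i. v (q T t i)))"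
        if T: "T \<in> TH" for T
        using scaled_form_eq_element_energies[OF M l(1)[OF T], of n "q T" "k_edge_mod kT ?N T" v] q[OF T] T
        unfolding l(2)[OF T] by blast
      then show ?thesis
        by (simp add: a_h_mod_def scaled_form_def sum_distrib_left)
    qed
    moreover have "c * ?Q T t \<le> element_energy (l T) (\<lambda>i j. k_edge_mod kT ?N T (q T t i) (q T t j)) (\<lambda>i. v (q T t i))"
      if T: "T \<in> TH" and t: "t \<in> ?R T" for T t
    proof -
      obtain s w where sw: "s \<noteq> 0" "q T t = homothety s w \<circ> l T"
        using q(3)[OF T t] by blast
      have "tri (homothety s w \<circ> l T) = t"
        using q(1)[OF T t] sw(2) by simp
      then show ?thesis
        using c(2)[OF T] finN sw refined_mesh_subset[OF T, of n] t subT[OF T t]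
        unfolding coercive_def by (simp add: subset_iff)
    qed
    ultimately have energy: "c * (\<Sum>T\<in>TH. \<Sum>t\<in>?R T. ?Q T t) \<le> a_h_mod kT TH ?N v v"
      by (simp add: sum_distrib_left sum_mono)
    define G where "G T t = (\<Sum>i\<in>UNIV. v (q T t i) *\<^sub>R bary_grad (q T t) i)" for T t
    have Q: "?Q T t = measure lebesgue t * (norm (G T t))\<^sup>2" if T: "T \<in> TH" and t: "t \<in> ?R T" for T t
    proof -
      have "stiffness (q T t) i j = stiffness (l T) i j" for i j
        using q(3)[OF T t] stiffness_homothety by auto
      then have "?Q T t = quad_form (q T t) (\<lambda>i. v (q T t i))"
        by (simp add: quad_form_def)
      then show ?thesis
        by (simp add: quad_form_eq_norm q(1)[OF T t] G_def)
    qed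
    \<comment> \<open>Indexing by pairs \<open>(T, t)\<close> matches the double sum of energies
      directly, without comparing fine elements of different macro elements.\<close>
    have "(LINT x|lebesgue_on \<Omega>. (norm (weak_grad \<Omega> v x))\<^sup>2)
        \<le> (\<Sum>i\<in>(SIGMA T:TH. ?R T). measure lebesgue (snd i) * (norm (G (fst i) (snd i)))\<^sup>2)"
    proof (rule weak_grad_norm_le_elements[OF \<Omega>(1) g])
      show "finite (SIGMA T:TH. ?R T)"
        using fin finR by auto
      fix i assume i: "i \<in> (SIGMA T:TH. ?R T)"
      then obtain T t where Tt: "i = (T, t)" "T \<in> TH" "t \<in> ?R T"
        by blast
      note qT = q(1)[OF Tt(2,3)]
      show "convex (snd i)" "snd i \<in> lmeasurable"
        using convex_tri[of "q T t"] lmeasurable_tri[of "q T t"] unfolding qT by (simp_all add: Tt(1))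
      have "interior t \<subseteq> interior T"
        using subT[OF Tt(2,3)] by (rule interior_mono)
      also have "\<dots> \<subseteq> \<Omega>"
        using assms(2) Tt(2) by (simp add: triangulation_of_def)
      finally show "interior (snd i) \<subseteq> \<Omega>"
        by (simp add: Tt(1))
      show "v x = G (fst i) (snd i) \<bullet> x + (\<Sum>j\<in>UNIV. v (q (fst i) (snd i) j) * bary (q (fst i) (snd i)) j 0)"
        if "x \<in> snd i" for x
      proof -
        have x: "x \<in> tri (q T t)"
          using that by (simp add: Tt(1) qT)
        have "tri (q T t) \<in> ?N"
          using refined_mesh_subset[OF Tt(2)] Tt(3) qT by auto
        then have "v y = (\<Sum>i\<in>UNIV. v (q T t i) * bary (q T t) i y)" if "y \<in> tri (q T t)" for y
          using P1_on_tri[OF v(1) _ q(2)[OF Tt(2,3)] that] by blast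
        from affine_from_vertices[OF q(2)[OF Tt(2,3)] this x] show ?thesis
          by (simp add: G_def Tt(1))
      qed
    next
      show "\<Omega> \<subseteq> (\<Union>i\<in>(SIGMA T:TH. ?R T). snd i)"
      proof
        fix x assume "x \<in> \<Omega>"
        then have "x \<in> \<Union>TH"
          using assms(2) closure_subset[of \<Omega>] by (auto simp: triangulation_of_def)
        then obtain T where T: "T \<in> TH" "x \<in> T"
          by blast
        then have "x \<in> \<Union>(?R T)"
          using refined_mesh_cover[OF l(1)[OF T(1)], of n] unfolding l(2)[OF T(1)] by blast
        with T(1) show "x \<in> (\<Union>i\<in>(SIGMA T:TH. ?R T). snd i)"
          by force
      qed
    qed
    also have "\<dots> = (\<Sum>T\<in>TH. \<Sum>t\<in>?R T. ?Q T t)"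
      using fin finR by (subst sum.Sigma) (auto simp: Q intro!: sum.cong)
    finally have grad: "(LINT x|lebesgue_on \<Omega>. (norm (weak_grad \<Omega> v x))\<^sup>2) \<le> (\<Sum>T\<in>TH. \<Sum>t\<in>?R T. ?Q T t)" .
    have "(H1_norm \<Omega> v)\<^sup>2 \<le> (C + 1) * (LINT x|lebesgue_on \<Omega>. (norm (weak_grad \<Omega> v x))\<^sup>2)"
      unfolding H1_norm_squared using C(2)[OF v(2)] by (simp add: distrib_right)
    also have "\<dots> \<le> (C + 1) * (\<Sum>T\<in>TH. \<Sum>t\<in>?R T. ?Q T t)"
      using grad C(1) by (intro mult_left_mono) auto
    finally have "c / (C + 1) * (H1_norm \<Omega> v)\<^sup>2 \<le> c / (C + 1) * ((C + 1) * (\<Sum>T\<in>TH. \<Sum>t\<in>?R T. ?Q T t))"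
      using c(1) C(1) by (intro mult_left_mono) auto
    also have "\<dots> = c * (\<Sum>T\<in>TH. \<Sum>t\<in>?R T. ?Q T t)"
      using C(1) by simp
    finally show ?thesis
      using energy by linarith
  qed
  then show ?thesis
    using c(1) C(1) by (intro exI[of _ "c / (C + 1)"]) auto
qed

end
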